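(* Let $l\in\mathbb{N}$ and let $\overline{\mathcal{O}_{\mathbb{P}}(1)}$ be a seminormed line bundle structure on the line bundle $\mathcal{O}_{\mathbb{P}}(1)$ over $\mathbb{P}^l_{\mathbb{Z}}$. Then $$\underline{c}_{l+1}(\mathbb{P}^l_{\mathbb{Z}},\overline{\mathcal{O}_{\mathbb{P}}(1)},\mathcal{O}_{\mathbb{P}})=\overline{c}_{l+1}(\mathbb{P}^l_{\mathbb{Z}},\overline{\mathcal{O}_{\mathbb{P}}(1)},\mathcal{O}_{\mathbb{P}})\in\mathbb{R}\cup\{+\infty\}.$$
   Context: $\mathcal{O}_{\mathbb{P}}$ is the structure sheaf of $\mathbb{P}^l_{\mathbb{Z}}$. The definitions below are given for a projective scheme $X$ over $\operatorname{Spec}\mathbb{Z}$; they are used for $X=\mathbb{P}^l_{\mathbb{Z}}$, $\mathcal{L}=\mathcal{O}_{\mathbb{P}}(1)$, $\mathcal{F}=\mathcal{O}_{\mathbb{P}}$. $X(\mathbb{C})$ denotes the complex analytic space associated with $X_{\mathbb{C}}$. **Seminormed line bundles.** A seminorm $|\cdot|$ on a line bundle $\mathcal{L}$ on $X$ is the datum, for each (reduced) point $x$ of $X(\mathbb{C})$, of a seminorm $|\cdot|_x$ on the complex line $\mathcal{L}_{|x}=\mathcal{L}_x/\mathfrak{m}_x\mathcal{L}_x$. It is upper semicontinuous if for every open $\mathcal{U}\subset X(\mathbb{C})$ and $s\in H^0(\mathcal{U},\mathcal{L})$ the function $x\mapsto |s(x)|_x$ is upper semicontinuous. A seminormed line bundle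 $\overline{\mathcal{L}}=(\mathcal{L},|\cdot|)$ is a line bundle with an upper semicontinuous seminorm invariant by complex conjugation (not assumed definite). **Analytic tube.** Let $p_X:\mathbb{V}_X(\mathcal{L})\to X$ be the affine $X$-scheme defined by the sheaf of algebras $\bigoplus_{n\in\mathbb{N}}\mathcal{L}^{\otimes n}$; its complex points are $\{(x,\varphi): x\in X(\mathbb{C}),\ \varphi\in\mathcal{L}^\vee_{|x}\}$. The analytic tube of $\overline{\mathcal{L}}$ is the compact set $T=\{(x,\varphi): |\varphi|_x\le 1\}$, where $|\varphi|_x\in[0,+\infty]$ is the dual pseudo-norm, i.e. $|\varphi|_x=\sup\{|\varphi(v)|: v\in\mathcal{L}_{|x}, |v|_x\le 1\}$. **Bornology.** Let $\mathcal{F}$ be a coherent sheaf on $X$ and $M_\bullet=H^0(\mathbb{V}_X(\mathcal{L}),p_X^*\mathcal{F})=\bigoplus_{n\in\mathbb{N}}M_n$ with $M_n=H^0(X,\mathcal{L}^{\otimes n}\otimes\mathcal{F})$. Let $H^0(T,p_X^*\mathcal{F})$ be the locally convex direct limit of the Fréchet spaces $H^0(U,p_X^*\mathcal{F})$ (analytic sections), $U$ running through the open neighborhoods of $T$ in $\mathbb{V}_X(\mathcal{L})(\mathbb{C})$. Declare a subset of $M_\bullet\otimes_{\mathbb{Z}}\mathbb{C}$ bounded if its image under the restriction map to $H^0(T,p_X^*\mathcal{F})$ is bounded. This bornology $\mathcal{B}$ is induced by a decreasing sequence $(\|\cdot\|_i)_{i\in\mathbb{N}}$ of Hilbertian seminorms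 on $M_\bullet\otimes\mathbb{C}$, invariant by complex conjugation and with eventually constant kernel, meaning that a subset $B$ is bounded if and only if there are $i\in\mathbb{N}$ and $R>0$ with $\|v\|_i\le R$ for all $v\in B$. **Arithmetic degree.** For a finitely generated $\mathbb{Z}$-module $M$ and a Hilbertian seminorm $\|\cdot\|$ on $M_{\mathbb{R}}=M\otimes_{\mathbb{Z}}\mathbb{R}$, put $\widehat{\chi}(M,\|\cdot\|)=0$ if $M=0$; otherwise $+\infty$ if $\|\cdot\|$ is not a norm; and otherwise $-\log\operatorname{covol}(M,\|\cdot\|)+\log\#M_{\mathrm{tor}}$, the covolume (of the image of $M$ in $M_{\mathbb{R}}$) being computed with the translation-invariant measure giving mass $1$ to the unit cube on any orthonormal basis of $(M_{\mathbb{R}},\|\cdot\|)$. **Arithmetic Hilbert invariants.** For $\mathcal{L}$ ample over $\operatorname{Spec}\mathbb{Z}$ and an integer $r\ge\dim\operatorname{Supp}\mathcal{F}$, $$\overline{c}_r(X,\overline{\mathcal{L}},\mathcal{F})=\lim_i\limsup_n\frac{r!}{n^r}\widehat{\chi}(M_n,\|\cdot\|_i),\qquad \underline{c}_r(X,\overline{\mathcal{L}},\mathcal{F})=\lim_i\liminf_n\frac{r!}{n^r}\widehat{\chi}(M_n,\|\cdot\|_i),$$ where $(\|\cdot\|_i)$ is any decreasing sequence of Hilbertian seminorms invariant by complex conjugation defining $\mathcal{B}$; the values do not depend on this choice. *)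

theory Defs
  imports "HOL-Analysis.Analysis" "HOL-Analysis.Finite_Function_Topology"
begin

(* Conventions.  A type 'n of class finite indexes the homogeneous coordinates X_i, so that
   CARD('n) = l + 1 and complex ^ 'n is C^(l+1).  There are no schemes in the libraries; P^l_Z, O(1)
   and V(O(1)) enter through their standard coordinate descriptions:
   - a point of P^l(C) is a line through 0 in C^(l+1), as a set of vectors;
   - O(1) is the dual of the tautological bundle: its fibre at x is the space of linear forms on the
     line x, and the coordinate X_i restricts to the i-th coordinate form;
   - hence the dual of the fibre of O(1) at x is the line x itself, a vector v acting by evaluation,
     and the complex points (x, phi) of V(O(1)) are the pairs (x, v) with v in x. *)

section \<open>The complex projective space and the total space of the tautological bundle\<close>

definition quotient_topology :: "'a topology \<Rightarrow> ('a \<Rightarrow> 'b) \<Rightarrow> 'b topology" where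
  "quotient_topology S f =
     topology (\<lambda>U. U \<subseteq> f ` topspace S \<and> openin S {x \<in> topspace S. f x \<in> U})"

lemma openin_quotient_topology:
  "openin (quotient_topology S f) U \<longleftrightarrow>
     U \<subseteq> f ` topspace S \<and> openin S {x \<in> topspace S. f x \<in> U}"
proof -
  have "istopology (\<lambda>U. U \<subseteq> f ` topspace S \<and> openin S {x \<in> topspace S. f x \<in> U})"
    unfolding istopology_def
  proof (intro conjI allI impI)
    fix U V
    assume "U \<subseteq> f ` topspace S \<and> openin S {x \<in> topspace S. f x \<in> U}"
      and "V \<subseteq> f ` topspace S \<and> openin S {x \<in> topspace S. f x \<in> V}"
    moreover have "{x \<in> topspace S. f x \<in> U \<inter> V} =
        {x \<in> topspace S. f x \<in> U} \<inter> {x \<in> topspace S. f x \<in> V}"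
      by auto
    ultimately show "U \<inter> V \<subseteq> f ` topspace S" "openin S {x \<in> topspace S. f x \<in> U \<inter> V}"
      by auto
  next
    fix \<K>
    assume *: "\<forall>K\<in>\<K>. K \<subseteq> f ` topspace S \<and> openin S {x \<in> topspace S. f x \<in> K}"
    then show "\<Union>\<K> \<subseteq> f ` topspace S"
      by blast
    have "{x \<in> topspace S. f x \<in> \<Union>\<K>} = (\<Union>K\<in>\<K>. {x \<in> topspace S. f x \<in> K})"
      by auto
    moreover have "openin S (\<Union>K\<in>\<K>. {x \<in> topspace S. f x \<in> K})"
      using * by (intro openin_Union) auto
    ultimately show "openin S {x \<in> topspace S. f x \<in> \<Union>\<K>}"
      by simp
  qed
  from topology_inverse'[OF this] show ?thesis
    by (simp only: quotient_topology_def)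
qed

lemma topspace_quotient_topology: "topspace (quotient_topology S f) = f ` topspace S"
proof
  have "{x \<in> topspace S. f x \<in> f ` topspace S} = topspace S"
    by auto
  then have "openin (quotient_topology S f) (f ` topspace S)"
    by (simp add: openin_quotient_topology)
  then show "f ` topspace S \<subseteq> topspace (quotient_topology S f)"
    by (rule openin_subset)
  show "topspace (quotient_topology S f) \<subseteq> f ` topspace S"
    using openin_topspace[of "quotient_topology S f"] unfolding openin_quotient_topology by (rule conjunct1)
qed

lemma quotient_map_quotient_topology: "quotient_map S (quotient_topology S f) f"
  by (auto simp: quotient_map_def topspace_quotient_topology openin_quotient_topology)

definition cline :: "complex ^ 'n \<Rightarrow> (complex ^ 'n) set" where
  "cline z = range (\<lambda>c. c *s z)"

definition proj_space :: "(complex ^ 'n) set topology" where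
  "proj_space = quotient_topology (top_of_set (- {0})) cline"

type_synonym 'n tube_pt = "(complex ^ 'n) set \<times> (complex ^ 'n)"

text \<open>
  The total space is the quotient of \<open>(C^(l+1) - 0) \<times> C\<close> by the free action
  \<open>a (z, t) = (a z, t / a)\<close> of the nonzero complex numbers, through the following map, which is a
  holomorphic submersion. Its topology is the quotient topology, and a function on an open subset
  is analytic iff its pullback is.
\<close>

definition taut_map :: "(complex ^ 'n) \<times> complex \<Rightarrow> 'n::finite tube_pt" where
  "taut_map = (\<lambda>(z, t). (cline z, t *s z))"

definition taut_space :: "'n::finite tube_pt topology" where
  "taut_space = quotient_topology (top_of_set ((- {0}) \<times> UNIV)) taut_map"

text \<open>
  Holomorphy in several variables: complex Frechet differentiability at every point. The first
  argument is the multiplication by complex scalars on the domain, for which the libraries have no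
  type class.
\<close>

definition holomorphic_wrt ::
  "(complex \<Rightarrow> 'a \<Rightarrow> 'a) \<Rightarrow> ('a::real_normed_vector \<Rightarrow> complex) \<Rightarrow> 'a set \<Rightarrow> bool" where
  "holomorphic_wrt smul f S \<longleftrightarrow>
     (\<forall>x\<in>S. \<exists>D. (f has_derivative D) (at x) \<and> (\<forall>c v. D (smul c v) = c * D v))"

definition analytic_function :: "'n::finite tube_pt set \<Rightarrow> ('n tube_pt \<Rightarrow> complex) \<Rightarrow> bool" where
  "analytic_function U f \<longleftrightarrow>
     holomorphic_wrt (\<lambda>c (z, t). (c *s z, c * t)) (f \<circ> taut_map) {(z, t). z \<noteq> 0 \<and> taut_map (z, t) \<in> U}"


section \<open>Seminormed line bundle structures on O(1)\<close>

definition fibre_O1 :: "(complex ^ 'n) set \<Rightarrow> (complex ^ 'n \<Rightarrow> complex) set" where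
  "fibre_O1 x = {\<phi> \<in> extensional x.
     (\<forall>u\<in>x. \<forall>v\<in>x. \<phi> (u + v) = \<phi> u + \<phi> v) \<and> (\<forall>c. \<forall>v\<in>x. \<phi> (c *s v) = c * \<phi> v)}"

definition analytic_section_O1 ::
  "(complex ^ 'n::finite) set set \<Rightarrow> ((complex ^ 'n) set \<Rightarrow> complex ^ 'n \<Rightarrow> complex) \<Rightarrow> bool" where
  "analytic_section_O1 U s \<longleftrightarrow> (\<forall>x\<in>U. s x \<in> fibre_O1 x) \<and>
     holomorphic_wrt (*s) (\<lambda>z. s (cline z) z) {z. z \<noteq> 0 \<and> cline z \<in> U}"

definition vec_cnj :: "complex ^ 'n \<Rightarrow> complex ^ 'n" where
  "vec_cnj v = (\<chi> i. cnj (v $ i))"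

definition form_cnj ::
  "(complex ^ 'n) set \<Rightarrow> (complex ^ 'n \<Rightarrow> complex) \<Rightarrow> complex ^ 'n \<Rightarrow> complex" where
  "form_cnj x \<phi> = restrict (\<lambda>v. cnj (\<phi> (vec_cnj v))) (vec_cnj ` x)"

type_synonym 'n O1_seminorm = "(complex ^ 'n) set \<Rightarrow> (complex ^ 'n \<Rightarrow> complex) \<Rightarrow> real"

definition fibrewise_seminorm :: "'n::finite O1_seminorm \<Rightarrow> bool" where
  "fibrewise_seminorm N \<longleftrightarrow> (\<forall>x \<in> topspace proj_space.
     (\<forall>\<phi>\<in>fibre_O1 x. 0 \<le> N x \<phi>) \<and>
     (\<forall>\<phi>\<in>fibre_O1 x. \<forall>c. N x (restrict (\<lambda>v. c * \<phi> v) x) = cmod c * N x \<phi>) \<and>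
     (\<forall>\<phi>\<in>fibre_O1 x. \<forall>\<psi>\<in>fibre_O1 x. N x (restrict (\<lambda>v. \<phi> v + \<psi> v) x) \<le> N x \<phi> + N x \<psi>))"

definition usc_seminorm :: "'n::finite O1_seminorm \<Rightarrow> bool" where
  "usc_seminorm N \<longleftrightarrow> (\<forall>U s. openin proj_space U \<longrightarrow> analytic_section_O1 U s \<longrightarrow>
     (\<forall>a. openin proj_space {x \<in> U. N x (s x) < a}))"

definition cnj_invariant_seminorm :: "'n::finite O1_seminorm \<Rightarrow> bool" where
  "cnj_invariant_seminorm N \<longleftrightarrow>
     (\<forall>x \<in> topspace proj_space. \<forall>\<phi>\<in>fibre_O1 x. N (vec_cnj ` x) (form_cnj x \<phi>) = N x \<phi>)"

definition seminormed_O1 :: "'n::finite O1_seminorm \<Rightarrow> bool" where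
  "seminormed_O1 N \<longleftrightarrow> fibrewise_seminorm N \<and> usc_seminorm N \<and> cnj_invariant_seminorm N"


section \<open>The analytic tube and sections near it\<close>

definition dual_pseudonorm :: "'n::finite O1_seminorm \<Rightarrow> 'n tube_pt \<Rightarrow> ereal" where
  "dual_pseudonorm N = (\<lambda>(x, v). SUP \<phi> \<in> {\<phi> \<in> fibre_O1 x. N x \<phi> \<le> 1}. ereal (cmod (\<phi> v)))"

definition analytic_tube :: "'n::finite O1_seminorm \<Rightarrow> 'n tube_pt set" where
  "analytic_tube N = {p \<in> topspace taut_space. dual_pseudonorm N p \<le> 1}"

definition open_nbhd :: "'n::finite tube_pt set \<Rightarrow> 'n tube_pt set \<Rightarrow> bool" where
  "open_nbhd T U \<longleftrightarrow> openin taut_space U \<and> T \<subseteq> U"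

text \<open>
  Elements of \<open>H^0(T, O)\<close>, the direct limit of the \<open>H^0(U, O)\<close>, are given by representatives,
  two of them being equal in the limit iff they are related by \<open>same_germ T\<close>.
\<close>

definition near_sections :: "'n::finite tube_pt set \<Rightarrow> ('n tube_pt \<Rightarrow> complex) set" where
  "near_sections T = {f. \<exists>U. open_nbhd T U \<and> analytic_function U f}"

definition same_germ ::
  "'n::finite tube_pt set \<Rightarrow> ('n tube_pt \<Rightarrow> complex) \<Rightarrow> ('n tube_pt \<Rightarrow> complex) \<Rightarrow> bool" where
  "same_germ T f g \<longleftrightarrow> (\<exists>U. open_nbhd T U \<and> (\<forall>p\<in>U. f p = g p))"

definition seminorm_on_germs ::
  "'n::finite tube_pt set \<Rightarrow> (('n tube_pt \<Rightarrow> complex) \<Rightarrow> real) \<Rightarrow> bool" where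
  "seminorm_on_germs T q \<longleftrightarrow>
     (\<forall>f\<in>near_sections T. \<forall>g\<in>near_sections T. same_germ T f g \<longrightarrow> q f = q g) \<and>
     (\<forall>f\<in>near_sections T. 0 \<le> q f) \<and>
     (\<forall>f\<in>near_sections T. \<forall>c. q (\<lambda>p. c * f p) = cmod c * q f) \<and>
     (\<forall>f\<in>near_sections T. \<forall>g\<in>near_sections T. q (\<lambda>p. f p + g p) \<le> q f + q g)"

text \<open>
  The locally convex direct limit topology is the finest locally convex topology for which all
  canonical maps from the Frechet spaces \<open>H^0(U, O)\<close> (uniform convergence on compact subsets) are
  continuous: it is defined by all seminorms whose restriction to each \<open>H^0(U, O)\<close> is continuous.
  A set is bounded iff each of them is bounded on it.
\<close>

definition continuous_seminorm_on_germs ::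
  "'n::finite tube_pt set \<Rightarrow> (('n tube_pt \<Rightarrow> complex) \<Rightarrow> real) \<Rightarrow> bool" where
  "continuous_seminorm_on_germs T q \<longleftrightarrow> seminorm_on_germs T q \<and>
     (\<forall>U. open_nbhd T U \<longrightarrow> (\<exists>K C. compactin taut_space K \<and> K \<noteq> {} \<and> K \<subseteq> U \<and>
        (\<forall>f. analytic_function U f \<longrightarrow> q f \<le> C * (SUP p\<in>K. cmod (f p)))))"

definition bounded_germs :: "'n::finite tube_pt set \<Rightarrow> ('n tube_pt \<Rightarrow> complex) set \<Rightarrow> bool" where
  "bounded_germs T A \<longleftrightarrow> (\<forall>q. continuous_seminorm_on_germs T q \<longrightarrow> (\<exists>R. \<forall>f\<in>A. q f \<le> R))"


section \<open>Sections of O(n) over the projective space\<close>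

text \<open>
  The module \<open>H^0(P^l, O(n))\<close> over a ring of constants is that of the homogeneous polynomials of
  degree \<open>n\<close>, so that the sum of the \<open>M_n \<otimes> C\<close> over all \<open>n\<close> is the type \<open>'n cpoly\<close>. The lemma
  \<open>global_sections_O\<close> below justifies this from the gluing description of \<open>O(n)\<close>: its sections
  over the chart \<open>X_i \<noteq> 0\<close> are the elements of degree \<open>n\<close> of the polynomial ring with \<open>X_i\<close>
  inverted, and all of them restrict injectively to the torus where every \<open>X_j\<close> is inverted.
\<close>

type_synonym 'n cpoly = "('n \<Rightarrow>\<^sub>0 nat) \<Rightarrow>\<^sub>0 complex"

definition homogeneous :: "nat \<Rightarrow> (('n::finite \<Rightarrow>\<^sub>0 nat) \<Rightarrow>\<^sub>0 'a::zero) \<Rightarrow> bool" where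
  "homogeneous n P \<longleftrightarrow> (\<forall>\<alpha>\<in>Poly_Mapping.keys P. (\<Sum>i\<in>UNIV. Poly_Mapping.lookup \<alpha> i) = n)"

definition chart_sections :: "nat \<Rightarrow> 'n \<Rightarrow> (('n::finite \<Rightarrow>\<^sub>0 int) \<Rightarrow>\<^sub>0 'a::zero) set" where
  "chart_sections n i = {s. \<forall>\<beta>\<in>Poly_Mapping.keys s.
     (\<Sum>j\<in>UNIV. Poly_Mapping.lookup \<beta> j) = int n \<and> (\<forall>j. j \<noteq> i \<longrightarrow> 0 \<le> Poly_Mapping.lookup \<beta> j)}"

lemma lookup_map_int:
  "Poly_Mapping.lookup (Poly_Mapping.map int \<alpha>) j = int (Poly_Mapping.lookup \<alpha> j)"
  by (simp add: Poly_Mapping.map.rep_eq when_def)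

lemma inj_map_int: "inj (Poly_Mapping.map int :: ('n \<Rightarrow>\<^sub>0 nat) \<Rightarrow> _)"
  by (rule injI, rule poly_mapping_eqI) (metis lookup_map_int of_nat_eq_iff)

lemma keys_global_section:
  fixes s :: "('n::finite \<Rightarrow>\<^sub>0 int) \<Rightarrow>\<^sub>0 'a::zero"
  assumes s: "s \<in> (\<Inter>i. chart_sections n i)" and \<beta>: "\<beta> \<in> Poly_Mapping.keys s"
  shows "\<beta> \<in> range (Poly_Mapping.map int)"
proof -
  have deg: "(\<Sum>j\<in>UNIV. Poly_Mapping.lookup \<beta> j) = int n"
    and chart: "\<And>i j. j \<noteq> i \<Longrightarrow> 0 \<le> Poly_Mapping.lookup \<beta> j"
    using s \<beta> by (auto simp: chart_sections_def)
  have nonneg: "0 \<le> Poly_Mapping.lookup \<beta> j" for j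
  proof (cases "\<exists>i. j \<noteq> i")
    case True
    then show ?thesis using chart by blast
  next
    case False
    then have "(UNIV :: 'n set) = {j}" by auto
    then have "(\<Sum>k\<in>UNIV. Poly_Mapping.lookup \<beta> k) = (\<Sum>k\<in>{j}. Poly_Mapping.lookup \<beta> k)"
      by (rule arg_cong)
    with deg show ?thesis by simp
  qed
  have "\<beta> = Poly_Mapping.map int (Poly_Mapping.map nat \<beta>)"
    by (rule poly_mapping_eqI)
      (auto simp: lookup_map_int Poly_Mapping.map.rep_eq when_def intro: antisym nonneg)
  then show ?thesis by blast
qed

lemma global_sections_O:
  "bij_betw (Poly_Mapping.map_key (Poly_Mapping.map int))
     (\<Inter>i. chart_sections n i :: (('n::finite \<Rightarrow>\<^sub>0 int) \<Rightarrow>\<^sub>0 'a::zero) set)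
     {P. homogeneous n P}"
proof -
  let ?e = "Poly_Mapping.map int :: ('n \<Rightarrow>\<^sub>0 nat) \<Rightarrow> ('n \<Rightarrow>\<^sub>0 int)"
  let ?S = "\<Inter>i. chart_sections n i :: (('n \<Rightarrow>\<^sub>0 int) \<Rightarrow>\<^sub>0 'a) set"
  have lookup: "Poly_Mapping.lookup (Poly_Mapping.map_key ?e s) \<alpha> = Poly_Mapping.lookup s (?e \<alpha>)"
    for s :: "('n \<Rightarrow>\<^sub>0 int) \<Rightarrow>\<^sub>0 'a" and \<alpha>
    by (simp add: map_key.rep_eq inj_map_int)
  have "inj_on (Poly_Mapping.map_key ?e) ?S"
  proof (rule inj_onI, rule poly_mapping_eqI)
    fix s t \<beta>
    assume st: "s \<in> ?S" "t \<in> ?S" and eq: "Poly_Mapping.map_key ?e s = Poly_Mapping.map_key ?e t"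
    show "Poly_Mapping.lookup s \<beta> = Poly_Mapping.lookup t \<beta>"
    proof (cases "\<beta> \<in> range ?e")
      case True
      then show ?thesis using eq lookup by (metis rangeE)
    next
      case False
      then show ?thesis using st keys_global_section by (metis in_keys_iff)
    qed
  qed
  moreover have "Poly_Mapping.map_key ?e s \<in> {P. homogeneous n P}" if s: "s \<in> ?S" for s
  proof -
    have "(\<Sum>i\<in>UNIV. Poly_Mapping.lookup \<alpha> i) = n"
      if "\<alpha> \<in> Poly_Mapping.keys (Poly_Mapping.map_key ?e s)" for \<alpha>
    proof -
      have "?e \<alpha> \<in> Poly_Mapping.keys s"
        using that by (simp add: in_keys_iff lookup)
      then have "(\<Sum>i\<in>UNIV. Poly_Mapping.lookup (?e \<alpha>) i) = int n"
        using s by (auto simp: chart_sections_def)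
      then show ?thesis
        by (simp add: lookup_map_int flip: of_nat_sum)
    qed
    then show ?thesis by (simp add: homogeneous_def)
  qed
  moreover have "P \<in> Poly_Mapping.map_key ?e ` ?S" if P: "homogeneous n P" for P
  proof
    let ?c = "\<lambda>\<beta>. if \<beta> \<in> range ?e then Poly_Mapping.lookup P (inv ?e \<beta>) else 0"
    let ?s = "Abs_poly_mapping ?c"
    have sub: "{\<beta>. ?c \<beta> \<noteq> 0} \<subseteq> ?e ` Poly_Mapping.keys P"
      by (auto simp: in_keys_iff inj_map_int split: if_splits)
    then have "finite {\<beta>. ?c \<beta> \<noteq> 0}"
      by (rule finite_subset) simp
    then have s: "Poly_Mapping.lookup ?s = ?c"
      by (rule lookup_Abs_poly_mapping)
    have "Poly_Mapping.keys ?s \<subseteq> ?e ` Poly_Mapping.keys P"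
      using sub by (auto simp: in_keys_iff s)
    then show "?s \<in> ?S"
      using P by (fastforce simp: chart_sections_def homogeneous_def lookup_map_int simp flip: of_nat_sum)
    show "P = Poly_Mapping.map_key ?e ?s"
      by (rule poly_mapping_eqI) (simp add: lookup s inj_map_int)
  qed
  ultimately show ?thesis
    by (auto simp: bij_betw_def)
qed


section \<open>The bornology\<close>

definition poly_eval :: "'n::finite cpoly \<Rightarrow> complex ^ 'n \<Rightarrow> complex" where
  "poly_eval P v = (\<Sum>\<alpha>\<in>Poly_Mapping.keys P.
     Poly_Mapping.lookup P \<alpha> * (\<Prod>i\<in>UNIV. (v $ i) ^ Poly_Mapping.lookup \<alpha> i))"

text \<open>
  A section \<open>P\<close> of \<open>O(n)\<close> becomes the function mapping \<open>(x, v)\<close> to the value of \<open>v^n\<close> at \<open>P(x)\<close>,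
  which is \<open>P(v)\<close>.
\<close>

definition tube_bounded :: "'n::finite O1_seminorm \<Rightarrow> 'n cpoly set \<Rightarrow> bool" where
  "tube_bounded N B \<longleftrightarrow> bounded_germs (analytic_tube N) ((\<lambda>P (x, v). poly_eval P v) ` B)"

definition hilbertian_seminorm :: "('n::finite cpoly \<Rightarrow> real) \<Rightarrow> bool" where
  "hilbertian_seminorm h \<longleftrightarrow> (\<exists>\<Phi> :: 'n cpoly \<Rightarrow> 'n cpoly \<Rightarrow> complex.
     (\<forall>P Q S. \<Phi> (P + Q) S = \<Phi> P S + \<Phi> Q S) \<and>
     (\<forall>c P Q. \<Phi> (Poly_Mapping.single 0 c * P) Q = c * \<Phi> P Q) \<and>
     (\<forall>P Q. \<Phi> Q P = cnj (\<Phi> P Q)) \<and>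
     (\<forall>P. 0 \<le> Re (\<Phi> P P)) \<and>
     (\<forall>P. h P = sqrt (Re (\<Phi> P P))))"

definition defines_bornology :: "'n::finite O1_seminorm \<Rightarrow> (nat \<Rightarrow> 'n cpoly \<Rightarrow> real) \<Rightarrow> bool" where
  "defines_bornology N h \<longleftrightarrow>
     (\<forall>i. hilbertian_seminorm (h i)) \<and>
     (\<forall>i P. h i (Poly_Mapping.map cnj P) = h i P) \<and>
     (\<forall>i P. h (Suc i) P \<le> h i P) \<and>
     (\<forall>B. tube_bounded N B \<longleftrightarrow> (\<exists>i. \<exists>R>0. \<forall>P\<in>B. h i P \<le> R))"


section \<open>Arithmetic degree\<close>

text \<open>
  Below \<open>M\<close> is a lattice in the real vector space \<open>span M\<close>: a finitely generated subgroup having a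
  basis over the integers that is linearly independent over the reals, so that \<open>span M\<close> is
  \<open>M \<otimes> R\<close>. Such an \<open>M\<close> is torsion-free, and the torsion term of the arithmetic degree is 0.
\<close>

definition lattice_basis :: "'v::real_vector set \<Rightarrow> 'v set \<Rightarrow> bool" where
  "lattice_basis M B \<longleftrightarrow> finite B \<and> independent B \<and> M = {\<Sum>b\<in>B. of_int (k b) *\<^sub>R b |k. True}"

definition fundamental_domain :: "'v::real_vector set \<Rightarrow> 'v set" where
  "fundamental_domain B = {\<Sum>b\<in>B. t b *\<^sub>R b |t. \<forall>b\<in>B. 0 \<le> t b \<and> t b < 1}"

definition polar_inner :: "('v::real_vector \<Rightarrow> real) \<Rightarrow> 'v \<Rightarrow> 'v \<Rightarrow> real" where
  "polar_inner h u v = ((h (u + v))\<^sup>2 - (h (u - v))\<^sup>2) / 4"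

definition orthonormal_basis :: "('v::real_vector \<Rightarrow> real) \<Rightarrow> 'v set \<Rightarrow> 'v set \<Rightarrow> bool" where
  "orthonormal_basis h W E \<longleftrightarrow> finite E \<and> independent E \<and> span E = W \<and>
     (\<forall>e\<in>E. \<forall>f\<in>E. polar_inner h e f = (if e = f then 1 else 0))"

text \<open>The Lebesgue measure of the coordinates in \<open>E\<close> gives mass 1 to the unit cube on \<open>E\<close>. The
  covolume does not depend on the two bases chosen in its definition.\<close>

definition covol_wrt :: "'v::real_vector set \<Rightarrow> 'v set \<Rightarrow> real" where
  "covol_wrt B E = measure (Pi\<^sub>M E (\<lambda>_. lborel))
     {c \<in> extensional E. (\<Sum>e\<in>E. c e *\<^sub>R e) \<in> fundamental_domain B}"

definition covol :: "'v::real_vector set \<Rightarrow> ('v \<Rightarrow> real) \<Rightarrow> real" where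
  "covol M h = covol_wrt (SOME B. lattice_basis M B) (SOME E. orthonormal_basis h (span M) E)"

definition arith_degree :: "'v::real_vector set \<Rightarrow> ('v \<Rightarrow> real) \<Rightarrow> ereal" where
  "arith_degree M h =
     (if M = {0} then 0
      else if \<exists>v\<in>span M. v \<noteq> 0 \<and> h v = 0 then \<infinity>
      else ereal (- ln (covol M h)))"


section \<open>Arithmetic Hilbert invariants\<close>

text \<open>The image of \<open>H^0(P^l_Z, O(n))\<close> in \<open>H^0(P^l_Z, O(n)) \<otimes> C\<close>.\<close>

definition integral_sections :: "nat \<Rightarrow> 'n::finite cpoly set" where
  "integral_sections n = {P. homogeneous n P \<and> (\<forall>\<alpha>. Poly_Mapping.lookup P \<alpha> \<in> \<int>)}"

text \<open>
  The invariants are the common value over all sequences defining the bornology; the definite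
  description is meaningful because there are such sequences and the value is independent of them.
\<close>

definition upper_hilbert_invariant :: "nat \<Rightarrow> 'n::finite O1_seminorm \<Rightarrow> ereal" where
  "upper_hilbert_invariant r N = (THE c. \<forall>h. defines_bornology N h \<longrightarrow>
     c = lim (\<lambda>i. limsup (\<lambda>n. ereal (fact r / real n ^ r) * arith_degree (integral_sections n) (h i))))"

definition lower_hilbert_invariant :: "nat \<Rightarrow> 'n::finite O1_seminorm \<Rightarrow> ereal" where
  "lower_hilbert_invariant r N = (THE c. \<forall>h. defines_bornology N h \<longrightarrow>
     c = lim (\<lambda>i. liminf (\<lambda>n. ereal (fact r / real n ^ r) * arith_degree (integral_sections n) (h i))))"

end

theory Submission
  imports Defs "HOL-Complex_Analysis.Complex_Analysis"
begin

text \<open>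
  The tube is the preimage of a circled compact set \<open>K\<close> in \<open>C^(l+1)\<close>, and its bornology is defined
  by the sup norms of the homogeneous components on shrinking circled neighbourhoods of \<open>K\<close>.
  Replacing the sup norm on a neighbourhood by the norm of values at finitely many points, whose
  number is polynomial in the degree, costs nothing, because homogeneity makes the sup norms on two
  nested neighbourhoods differ by a factor exponential in the degree. So the bornology is Hilbertian.
  The covolume of the lattice of degree \<open>n\<close> is the product, over the monomials \<open>x^\<alpha>\<close> of degree
  \<open>n\<close>, of the distances of \<open>x^\<alpha>\<close> to the span of the smaller monomials; up to bounded factors these
  are the Chebyshev constants \<open>\<tau>(\<alpha>)\<close> for the sup norm, which are submultiplicative in \<open>\<alpha>\<close>. For
  a superadditive function such as \<open>- ln \<tau>\<close>, the sums over \<open>|\<alpha>| = n\<close> divided by \<open>n^(l+1)\<close>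
  converge. The limits increase as the neighbourhoods shrink, and their
  supremum is both invariants.
\<close>

section \<open>Translation-invariant measures on coordinate spaces\<close>

text \<open>No norm is taken on \<open>K\<close> itself: \<open>K\<close> may be as small as {0},
  whereas each of its neighbourhoods contains a ball, which makes all constructed norms definite and
  their arithmetic degrees finite. The value \<infinity> can arise only from the final supremum, for
  instance when the seminorm vanishes identically.

  Two kinds of norms have to be interleaved: sup norms are submultiplicative but not Hilbertian,
  sample norms are Hilbertian but not submultiplicative. If \<Lambda> i is the limit given by the
  sup norms on the neighbourhood of index i, the interleaving yields \<Lambda> i \<le> liminf \<le>
  limsup \<le> \<Lambda> (i + 1) for the sample norms of index i.

  For the bornology, the difficult inclusion is that a bounded set is already bounded on one
  neighbourhood. It is obtained by testing against explicit continuous seminorms built from Taylor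
  coefficients along the fibres.

  Since \<open>covol\<close> selects its bases arbitrarily, independence of them must be proved;
  uniqueness of translation-invariant measures serves for this, so that no determinant is
  computed.\<close>

abbreviation lborel_PiM :: "'i set \<Rightarrow> ('i \<Rightarrow> real) measure" where
  "lborel_PiM I \<equiv> Pi\<^sub>M I (\<lambda>_. lborel)"

text \<open>Restricted to \<open>I\<close> because a point of the product space has to be
  \<open>undefined\<close> off \<open>I\<close>.\<close>

definition vadd :: "'i set \<Rightarrow> ('i \<Rightarrow> real) \<Rightarrow> ('i \<Rightarrow> real) \<Rightarrow> 'i \<Rightarrow> real" where
  "vadd I x y = (\<lambda>i\<in>I. x i + y i)"

definition vneg :: "'i set \<Rightarrow> ('i \<Rightarrow> real) \<Rightarrow> 'i \<Rightarrow> real" where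
  "vneg I x = (\<lambda>i\<in>I. - x i)"

interpretation lborel_product: product_sigma_finite "\<lambda>_. lborel :: real measure"
  by standard

lemma space_lborel_PiM: "space (lborel_PiM I) = extensional I"
  by (auto simp: space_PiM PiE_def)

lemma sigma_finite_lborel_PiM: "finite I \<Longrightarrow> sigma_finite_measure (lborel_PiM I)"
  by (rule lborel_product.sigma_finite)

lemma vadd_ext [simp]: "vadd I x y \<in> extensional I" and vneg_ext [simp]: "vneg I x \<in> extensional I"
  by (auto simp: vadd_def vneg_def)

lemma measurable_vadd [measurable]: "(\<lambda>(x, y). vadd I x y) \<in> lborel_PiM I \<Otimes>\<^sub>M lborel_PiM I \<rightarrow>\<^sub>M lborel_PiM I"
  unfolding vadd_def by measurable

lemma measurable_vadd_left: "vadd I x \<in> lborel_PiM I \<rightarrow>\<^sub>M lborel_PiM I"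
  unfolding vadd_def by measurable

lemma measurable_vneg [measurable]: "vneg I \<in> lborel_PiM I \<rightarrow>\<^sub>M lborel_PiM I"
  unfolding vneg_def by measurable

lemma vadd_vneg: "x \<in> extensional I \<Longrightarrow> vadd I (vadd I x (vneg I y)) y = x"
  by (auto simp: vadd_def vneg_def extensional_def fun_eq_iff)

lemma vadd_commute: "vadd I x y = vadd I y x"
  by (simp add: vadd_def add.commute)

definition transl_inv :: "'i set \<Rightarrow> ('i \<Rightarrow> real) measure \<Rightarrow> bool" where
  "transl_inv I \<nu> \<longleftrightarrow> sets \<nu> = sets (lborel_PiM I) \<and> (\<forall>a\<in>extensional I. distr \<nu> \<nu> (vadd I a) = \<nu>)"

text \<open>A product measure is determined by its values on boxes, and a translation acts on a box
  one coordinate at a time.\<close>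

lemma transl_inv_lborel_PiM:
  assumes "finite I"
  shows "transl_inv I (lborel_PiM I)"
  unfolding transl_inv_def
proof (intro conjI ballI refl)
  fix a :: "'a \<Rightarrow> real" assume a: "a \<in> extensional I"
  show "distr (lborel_PiM I) (lborel_PiM I) (vadd I a) = lborel_PiM I"
  proof (rule lborel_product.PiM_eqI)
    fix A :: "'a \<Rightarrow> real set" assume A: "\<And>i. i \<in> I \<Longrightarrow> A i \<in> sets lborel"
    have eq: "vadd I a -` Pi\<^sub>E I A \<inter> space (lborel_PiM I) = Pi\<^sub>E I (\<lambda>i. (+) (a i) -` A i)"
      by (auto simp: space_lborel_PiM vadd_def PiE_def Pi_def)
    have A': "(+) (a i) -` A i \<in> sets lborel" if "i \<in> I" for i
      using measurable_sets[of "(+) (a i)" borel borel "A i"] A[OF that] by simp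
    have "emeasure (distr (lborel_PiM I) (lborel_PiM I) (vadd I a)) (Pi\<^sub>E I A) = emeasure (lborel_PiM I) (Pi\<^sub>E I (\<lambda>i. (+) (a i) -` A i))"
      using A assms by (subst emeasure_distr) (auto simp: eq measurable_vadd_left intro!: sets_PiM_I_finite)
    also have "\<dots> = (\<Prod>i\<in>I. emeasure lborel ((+) (a i) -` A i))"
      using A' assms by (intro lborel_product.emeasure_PiM) auto
    also have "\<dots> = (\<Prod>i\<in>I. emeasure lborel (A i))"
    proof (rule prod.cong)
      fix i assume "i \<in> I"
      have "emeasure lborel (A i) = emeasure (distr lborel borel ((+) (a i))) (A i)"
        by (simp add: lborel_distr_plus)
      also have "\<dots> = emeasure lborel ((+) (a i) -` A i)"
        using A[OF \<open>i \<in> I\<close>] by (subst emeasure_distr) auto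
      finally show "emeasure lborel ((+) (a i) -` A i) = emeasure lborel (A i)" ..
    qed simp
    finally show "emeasure (distr (lborel_PiM I) (lborel_PiM I) (vadd I a)) (Pi\<^sub>E I A) = (\<Prod>i\<in>I. emeasure lborel (A i))" .
  qed (use assms in auto)
qed

lemma transl_inv_emeasure:
  assumes "transl_inv I \<nu>" "a \<in> extensional I" "S \<in> sets (lborel_PiM I)"
  shows "emeasure \<nu> {x \<in> extensional I. vadd I a x \<in> S} = emeasure \<nu> S"
proof -
  have s[simp]: "sets \<nu> = sets (lborel_PiM I)" and d: "distr \<nu> \<nu> (vadd I a) = \<nu>"
    using assms by (auto simp: transl_inv_def)
  have sp: "space \<nu> = extensional I"
    using sets_eq_imp_space_eq[OF s] by (simp add: space_lborel_PiM)
  have m: "vadd I a \<in> \<nu> \<rightarrow>\<^sub>M \<nu>"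
    using measurable_vadd_left[of I a] by (simp cong: measurable_cong_sets)
  have "emeasure \<nu> S = emeasure (distr \<nu> \<nu> (vadd I a)) S" by (simp add: d)
  also have "\<dots> = emeasure \<nu> (vadd I a -` S \<inter> space \<nu>)"
    using assms(3) by (intro emeasure_distr m) simp
  also have "vadd I a -` S \<inter> space \<nu> = {x \<in> extensional I. vadd I a x \<in> S}"
    by (auto simp: sp)
  finally show ?thesis ..
qed

text \<open>Both sides evaluate the double integral of \<open>1\<^sub>S x \<cdot> 1\<^sub>T (x + y)\<close>.\<close>

lemma transl_inv_cross:
  assumes mu: "transl_inv I \<mu>" "sigma_finite_measure \<mu>"
    and nu: "transl_inv I \<nu>" "sigma_finite_measure \<nu>"
    and S[measurable]: "S \<in> sets (lborel_PiM I)" and T[measurable]: "T \<in> sets (lborel_PiM I)"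
  shows "emeasure \<mu> S * emeasure \<nu> T = emeasure \<mu> T * emeasure \<nu> {x \<in> extensional I. vneg I x \<in> S}"
proof -
  interpret pair_sigma_finite \<mu> \<nu>
    using mu nu by (simp add: pair_sigma_finite_def)
  have [measurable_cong]: "sets \<mu> = sets (lborel_PiM I)" "sets \<nu> = sets (lborel_PiM I)"
    using mu nu by (auto simp: transl_inv_def)
  have sp: "space \<nu> = extensional I" "space \<mu> = extensional I"
    using mu nu sets_eq_imp_space_eq[of \<nu> "lborel_PiM I"] sets_eq_imp_space_eq[of \<mu> "lborel_PiM I"]
    by (auto simp: transl_inv_def space_lborel_PiM)
  have dm: "distr \<mu> \<mu> (vadd I a) = \<mu>" "vadd I a \<in> \<mu> \<rightarrow>\<^sub>M \<mu>"
    and dn: "distr \<nu> \<nu> (vadd I a) = \<nu>" "vadd I a \<in> \<nu> \<rightarrow>\<^sub>M \<nu>" if "a \<in> extensional I" for a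
    using mu nu that measurable_vadd_left[of I a] by (auto simp: transl_inv_def cong: measurable_cong_sets)
  let ?f = "\<lambda>x y. indicator S x * (indicator T (vadd I x y) :: ennreal)"
  have [measurable]: "(\<lambda>(x, y). vadd I x y) \<in> \<mu> \<Otimes>\<^sub>M \<nu> \<rightarrow>\<^sub>M lborel_PiM I"
  proof -
    have "sets (\<mu> \<Otimes>\<^sub>M \<nu>) = sets (lborel_PiM I \<Otimes>\<^sub>M lborel_PiM I)"
      by (intro sets_pair_measure_cong) fact+
    from measurable_cong_sets[OF this refl] show ?thesis
      using measurable_vadd[of I] by simp
  qed
  have eq: "(\<integral>\<^sup>+x. \<integral>\<^sup>+y. ?f x y \<partial>\<nu> \<partial>\<mu>) = (\<integral>\<^sup>+y. \<integral>\<^sup>+x. ?f x y \<partial>\<mu> \<partial>\<nu>)"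
    by (rule Fubini'[symmetric]) measurable
  have "(\<integral>\<^sup>+x. \<integral>\<^sup>+y. ?f x y \<partial>\<nu> \<partial>\<mu>) = (\<integral>\<^sup>+x. indicator S x * emeasure \<nu> T \<partial>\<mu>)"
  proof (rule nn_integral_cong)
    fix x assume "x \<in> space \<mu>"
    then have x: "x \<in> extensional I" by (simp add: sp)
    have "(\<integral>\<^sup>+y. indicator T (vadd I x y) \<partial>\<nu>) = (\<integral>\<^sup>+y. indicator T y \<partial>distr \<nu> \<nu> (vadd I x))"
      by (subst nn_integral_distr) (use dn x in auto)
    also have "\<dots> = emeasure \<nu> T"
      using T by (simp add: dn x \<open>sets \<nu> = _\<close>)
    finally show "(\<integral>\<^sup>+y. ?f x y \<partial>\<nu>) = indicator S x * emeasure \<nu> T"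
      by (subst nn_integral_cmult) (auto intro: measurable_compose[OF dn(2)[OF x]])
  qed
  also have "\<dots> = emeasure \<mu> S * emeasure \<nu> T"
    by (subst nn_integral_multc) (auto simp: \<open>sets \<mu> = _\<close>)
  finally have L: "(\<integral>\<^sup>+x. \<integral>\<^sup>+y. ?f x y \<partial>\<nu> \<partial>\<mu>) = emeasure \<mu> S * emeasure \<nu> T" .
  \<comment> \<open>Translating the inner integral by \<open>- y\<close> leaves the second set to
    \<open>x\<close> alone and gives the first one \<open>x - y\<close>.\<close>
  let ?g = "\<lambda>x y. indicator S (vadd I x (vneg I y)) * (indicator T x :: ennreal)"
  have "(\<integral>\<^sup>+y. \<integral>\<^sup>+x. ?f x y \<partial>\<mu> \<partial>\<nu>) = (\<integral>\<^sup>+y. \<integral>\<^sup>+x. ?g x y \<partial>\<mu> \<partial>\<nu>)"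
  proof (rule nn_integral_cong)
    fix y assume "y \<in> space \<nu>"
    let ?n = "vneg I y"
    have [measurable]: "(\<lambda>x. vadd I x z) \<in> \<mu> \<rightarrow>\<^sub>M lborel_PiM I" for z
      using measurable_vadd_left[of I z] by (simp add: vadd_commute[of I _ z] \<open>sets \<mu> = _\<close> cong: measurable_cong_sets)
    have "(\<integral>\<^sup>+x. ?f x y \<partial>\<mu>) = (\<integral>\<^sup>+x. ?f x y \<partial>distr \<mu> \<mu> (vadd I ?n))"
      by (simp add: dm)
    also have "\<dots> = (\<integral>\<^sup>+x. ?f (vadd I ?n x) y \<partial>\<mu>)"
      by (subst nn_integral_distr) (use dm in auto)
    also have "\<dots> = (\<integral>\<^sup>+x. ?g x y \<partial>\<mu>)"
      by (rule nn_integral_cong) (simp add: sp vadd_commute[of I ?n] vadd_vneg)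
    finally show "(\<integral>\<^sup>+x. ?f x y \<partial>\<mu>) = (\<integral>\<^sup>+x. ?g x y \<partial>\<mu>)" .
  qed
  also have "\<dots> = (\<integral>\<^sup>+x. \<integral>\<^sup>+y. ?g x y \<partial>\<nu> \<partial>\<mu>)"
  proof (rule Fubini')
    have "(\<lambda>(x, y). vadd I x (vneg I y)) = (\<lambda>(x,y). vadd I x y) \<circ> (\<lambda>(x,y). (x, vneg I y))"
      by auto
    then have [measurable]: "(\<lambda>(x, y). vadd I x (vneg I y)) \<in> \<mu> \<Otimes>\<^sub>M \<nu> \<rightarrow>\<^sub>M lborel_PiM I"
      by (auto intro!: measurable_comp[OF _ measurable_vadd])
    show "(\<lambda>(x, y). ?g x y) \<in> borel_measurable (\<mu> \<Otimes>\<^sub>M \<nu>)"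
      by measurable
  qed
  also have "\<dots> = (\<integral>\<^sup>+x. indicator T x * emeasure \<nu> {x \<in> extensional I. vneg I x \<in> S} \<partial>\<mu>)"
  proof (rule nn_integral_cong)
    fix x assume "x \<in> space \<mu>"
    then have x: "x \<in> extensional I" by (simp add: sp)
    \<comment> \<open>The reflected set appears because \<open>\<nu>\<close> is only known to be
      invariant under translations. It equals \<open>S\<close> when \<open>S\<close> is symmetric,
      as a ball is.\<close>
    let ?N = "{x \<in> extensional I. vneg I x \<in> S}"
    have N: "?N \<in> sets (lborel_PiM I)"
      using measurable_sets[OF measurable_vneg S] by (simp add: space_lborel_PiM vimage_def Int_def conj_commute)
    have "(\<integral>\<^sup>+y. indicator S (vadd I x (vneg I y)) \<partial>\<nu>) = (\<integral>\<^sup>+y. indicator ?N (vadd I (vneg I x) y) \<partial>\<nu>)"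
    proof (rule nn_integral_cong)
      fix y assume "y \<in> space \<nu>"
      have "vneg I (vadd I (vneg I x) y) = vadd I x (vneg I y)"
        by (auto simp: vadd_def vneg_def fun_eq_iff)
      then show "indicator S (vadd I x (vneg I y)) = (indicator ?N (vadd I (vneg I x) y) :: ennreal)"
        by (simp add: indicator_def)
    qed
    also have "\<dots> = (\<integral>\<^sup>+y. indicator ?N y \<partial>distr \<nu> \<nu> (vadd I (vneg I x)))"
      using N by (subst nn_integral_distr) (auto simp: dn \<open>sets \<nu> = _\<close>)
    also have "\<dots> = emeasure \<nu> ?N"
      using N by (simp add: dn \<open>sets \<nu> = _\<close>)
    finally have "(\<integral>\<^sup>+y. indicator S (vadd I x (vneg I y)) \<partial>\<nu>) = emeasure \<nu> ?N" .
    moreover have "(\<lambda>y. vadd I x (vneg I y)) \<in> \<nu> \<rightarrow>\<^sub>M lborel_PiM I"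
      by (rule measurable_compose[OF _ measurable_vadd_left]) measurable
    ultimately show "(\<integral>\<^sup>+y. ?g x y \<partial>\<nu>) = indicator T x * emeasure \<nu> ?N"
      by (subst nn_integral_multc) (auto simp: mult.commute)
  qed
  also have "\<dots> = emeasure \<mu> T * emeasure \<nu> {x \<in> extensional I. vneg I x \<in> S}"
    by (subst nn_integral_multc) (auto simp: \<open>sets \<mu> = _\<close>)
  finally show ?thesis using L eq by simp
qed

lemma lborel_PiM_reindex:
  assumes \<sigma>: "bij_betw \<sigma> I J" and fin: "finite I"
  shows "distr (lborel_PiM J) (lborel_PiM I) (\<lambda>x. \<lambda>i\<in>I. x (\<sigma> i)) = lborel_PiM I"
proof (rule lborel_product.PiM_eqI)
  have finJ: "finite J" using bij_betw_finite[OF \<sigma>] fin by simp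
  have inJ: "\<sigma> i \<in> J" if "i \<in> I" for i using \<sigma> that by (auto simp: bij_betw_def)
  have m: "(\<lambda>x. \<lambda>i\<in>I. x (\<sigma> i)) \<in> lborel_PiM J \<rightarrow>\<^sub>M lborel_PiM I"
    by (rule measurable_restrict) (use inJ in measurable)
  fix A :: "'a \<Rightarrow> real set" assume A: "\<And>i. i \<in> I \<Longrightarrow> A i \<in> sets lborel"
  let ?B = "\<lambda>j. A (inv_into I \<sigma> j)"
  have inv: "inv_into I \<sigma> j \<in> I" if "j \<in> J" for j
    using \<sigma> that by (metis bij_betw_def inv_into_into)
  have eq: "(\<lambda>x. \<lambda>i\<in>I. x (\<sigma> i)) -` Pi\<^sub>E I A \<inter> space (lborel_PiM J) = Pi\<^sub>E J ?B"
  proof (rule set_eqI, rule iffI)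
    fix x assume "x \<in> (\<lambda>x. \<lambda>i\<in>I. x (\<sigma> i)) -` Pi\<^sub>E I A \<inter> space (lborel_PiM J)"
    then have x: "x \<in> extensional J" "\<And>i. i \<in> I \<Longrightarrow> x (\<sigma> i) \<in> A i"
      by (auto simp: space_lborel_PiM PiE_def Pi_def)
    have "x j \<in> ?B j" if "j \<in> J" for j
      using x(2)[OF inv[OF that]] bij_betw_inv_into_right[OF \<sigma> that] by simp
    then show "x \<in> Pi\<^sub>E J ?B" using x by (auto simp: PiE_def)
  next
    fix x assume "x \<in> Pi\<^sub>E J ?B"
    then show "x \<in> (\<lambda>x. \<lambda>i\<in>I. x (\<sigma> i)) -` Pi\<^sub>E I A \<inter> space (lborel_PiM J)"
      using inJ bij_betw_inv_into_left[OF \<sigma>] by (fastforce simp: space_lborel_PiM PiE_def Pi_def)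
  qed
  have "emeasure (distr (lborel_PiM J) (lborel_PiM I) (\<lambda>x. \<lambda>i\<in>I. x (\<sigma> i))) (Pi\<^sub>E I A) = emeasure (lborel_PiM J) (Pi\<^sub>E J ?B)"
    using A fin by (subst emeasure_distr[OF m]) (auto simp: eq intro!: sets_PiM_I_finite)
  also have "\<dots> = (\<Prod>j\<in>J. emeasure lborel (?B j))"
    using A inv finJ by (intro lborel_product.emeasure_PiM) auto
  also have "\<dots> = (\<Prod>i\<in>I. emeasure lborel (A i))"
    using bij_betw_inv_into_left[OF \<sigma>] by (intro prod.reindex_bij_betw[OF \<sigma>, symmetric, THEN trans] prod.cong) auto
  finally show "emeasure (distr (lborel_PiM J) (lborel_PiM I) (\<lambda>x. \<lambda>i\<in>I. x (\<sigma> i))) (Pi\<^sub>E I A) = (\<Prod>i\<in>I. emeasure lborel (A i))" .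
qed (use fin in auto)

text \<open>The reference set that fixes the ratio of two proportional measures: it is symmetric,
  has finite nonzero volume, and describes the same set of vectors in the coordinates of every
  orthonormal basis.\<close>

definition unit_ball :: "'i set \<Rightarrow> ('i \<Rightarrow> real) set" where
  "unit_ball I = {x \<in> extensional I. (\<Sum>i\<in>I. (x i)\<^sup>2) \<le> 1}"

lemma sets_unit_ball: "finite I \<Longrightarrow> unit_ball I \<in> sets (lborel_PiM I)"
proof -
  assume "finite I"
  have "{x \<in> space (lborel_PiM I). (\<Sum>i\<in>I. (x i)\<^sup>2) \<le> 1} \<in> sets (lborel_PiM I)"
    by measurable
  then show ?thesis by (simp add: unit_ball_def space_lborel_PiM)
qed

lemma emeasure_unit_ball_cong:
  assumes \<sigma>: "bij_betw \<sigma> I J" and fin: "finite I"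
  shows "emeasure (lborel_PiM I) (unit_ball I) = emeasure (lborel_PiM J) (unit_ball J)"
proof -
  have inJ: "\<sigma> i \<in> J" if "i \<in> I" for i using \<sigma> that by (auto simp: bij_betw_def)
  have m: "(\<lambda>x. \<lambda>i\<in>I. x (\<sigma> i)) \<in> lborel_PiM J \<rightarrow>\<^sub>M lborel_PiM I"
    by (rule measurable_restrict) (use inJ in measurable)
  have "(\<Sum>i\<in>I. (x (\<sigma> i))\<^sup>2) = (\<Sum>j\<in>J. (x j)\<^sup>2)" for x :: "'b \<Rightarrow> real"
    by (rule sum.reindex_bij_betw[OF \<sigma>])
  then have eq: "(\<lambda>x. \<lambda>i\<in>I. x (\<sigma> i)) -` unit_ball I \<inter> space (lborel_PiM J) = unit_ball J"
    by (auto simp: unit_ball_def space_lborel_PiM)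
  have "emeasure (lborel_PiM I) (unit_ball I) = emeasure (distr (lborel_PiM J) (lborel_PiM I) (\<lambda>x. \<lambda>i\<in>I. x (\<sigma> i))) (unit_ball I)"
    by (simp add: lborel_PiM_reindex[OF \<sigma> fin])
  also have "\<dots> = emeasure (lborel_PiM J) (unit_ball J)"
    by (subst emeasure_distr[OF m sets_unit_ball[OF fin]]) (simp add: eq)
  finally show ?thesis .
qed

lemma emeasure_unit_ball:
  assumes "finite I"
  shows "emeasure (lborel_PiM I) (unit_ball I) \<noteq> 0" "emeasure (lborel_PiM I) (unit_ball I) \<noteq> \<infinity>"
proof -
  \<comment> \<open>As \<open>?r \<le> 1\<close>, squares in a box of side \<open>?r\<close> are at
    most \<open>?r\<close>, and \<open>card I\<close> of them add up to less than 1.\<close>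
  let ?r = "1 / (real (card I) + 1)"
  have r: "0 < ?r" by simp
  have "Pi\<^sub>E I (\<lambda>_. {0..?r}) \<subseteq> unit_ball I"
  proof
    fix x assume x: "x \<in> Pi\<^sub>E I (\<lambda>_. {0..?r})"
    have "(\<Sum>i\<in>I. (x i)\<^sup>2) \<le> (\<Sum>i\<in>I. ?r)"
    proof (rule sum_mono)
      fix i assume "i \<in> I"
      then have "0 \<le> x i" "x i \<le> ?r" using x by (auto simp: PiE_def Pi_def)
      moreover have "?r \<le> 1" by simp
      ultimately have "0 \<le> x i" "x i \<le> ?r" "x i \<le> 1" by linarith+
      then have "(x i)\<^sup>2 \<le> ?r * 1" unfolding power2_eq_square by (intro mult_mono) auto
      then show "(x i)\<^sup>2 \<le> ?r" by simp
    qed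
    also have "\<dots> \<le> 1" by (simp add: field_simps)
    finally show "x \<in> unit_ball I" using x by (auto simp: unit_ball_def PiE_def)
  qed
  then have "emeasure (lborel_PiM I) (Pi\<^sub>E I (\<lambda>_. {0..?r})) \<le> emeasure (lborel_PiM I) (unit_ball I)"
    by (intro emeasure_mono sets_unit_ball assms)
  moreover have "emeasure (lborel_PiM I) (Pi\<^sub>E I (\<lambda>_. {0..?r})) = (\<Prod>i\<in>I. ennreal ?r)"
    using assms by (subst lborel_product.emeasure_PiM) auto
  moreover have "(\<Prod>i\<in>I. ennreal ?r) \<noteq> 0"
    using r assms by (simp add: prod_zero_iff)
  ultimately show "emeasure (lborel_PiM I) (unit_ball I) \<noteq> 0" by auto
  have "unit_ball I \<subseteq> Pi\<^sub>E I (\<lambda>_. {-1..1})"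
  proof
    fix x assume x: "x \<in> unit_ball I"
    have "\<bar>x i\<bar> \<le> 1" if "i \<in> I" for i
      using member_le_sum[of i I "\<lambda>i. (x i)\<^sup>2"] that assms x by (auto simp: unit_ball_def abs_square_le_1[symmetric])
    then show "x \<in> Pi\<^sub>E I (\<lambda>_. {-1..1})"
      using x by (auto simp: unit_ball_def PiE_def abs_le_iff minus_le_iff)
  qed
  then have "emeasure (lborel_PiM I) (unit_ball I) \<le> emeasure (lborel_PiM I) (Pi\<^sub>E I (\<lambda>_. {-1..1}))"
    using assms by (intro emeasure_mono) (auto intro!: sets_PiM_I_finite)
  also have "\<dots> < \<infinity>"
    using assms by (subst lborel_product.emeasure_PiM) (auto simp: less_top[symmetric] power_eq_top_ennreal)
  finally show "emeasure (lborel_PiM I) (unit_ball I) \<noteq> \<infinity>" by simp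
qed

section \<open>Fundamental domains of lattices\<close>

definition lin_comb :: "'v::real_vector set \<Rightarrow> ('v \<Rightarrow> real) \<Rightarrow> 'v" where
  "lin_comb E c = (\<Sum>e\<in>E. c e *\<^sub>R e)"

definition coord_set :: "'v::real_vector set \<Rightarrow> 'v set \<Rightarrow> ('v \<Rightarrow> real) set" where
  "coord_set E X = {c \<in> extensional E. lin_comb E c \<in> X}"

lemma lin_comb_cong: "(\<And>e. e \<in> E \<Longrightarrow> c e = d e) \<Longrightarrow> lin_comb E c = lin_comb E d"
  by (auto simp: lin_comb_def)

lemma lin_comb_vadd: "lin_comb E (vadd E x y) = lin_comb E x + lin_comb E y"
  by (simp add: lin_comb_def vadd_def scaleR_left_distrib sum.distrib)

lemma lin_comb_in_span: "lin_comb E c \<in> span E"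
  unfolding lin_comb_def by (intro span_sum span_scale span_base)

lemma lin_comb_representation:
  assumes "finite E" "independent E" "w \<in> span E"
  shows "lin_comb E (representation E w) = w"
  unfolding lin_comb_def using assms by (simp add: sum_representation_eq)

lemma representation_lin_comb:
  assumes "finite E" "independent E"
  shows "representation E (lin_comb E c) e = (if e \<in> E then c e else 0)"
proof (cases "e \<in> E")
  case True
  have "representation E (lin_comb E c) e = (\<Sum>f\<in>E. c f * representation E f e)"
    unfolding lin_comb_def using assms
    by (subst representation_sum) (auto simp: span_base span_scale representation_scale)
  also have "\<dots> = (\<Sum>f\<in>E. if f = e then c f else 0)"
    using assms by (intro sum.cong) (auto simp: representation_basis)
  finally show ?thesis using True assms by simp
qed (use representation_ne_zero in force)

lemma lin_comb_inject:
  assumes "finite E" "independent E" "lin_comb E c = lin_comb E d" "e \<in> E"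
  shows "c e = d e"
  using representation_lin_comb[OF assms(1,2), of c e] representation_lin_comb[OF assms(1,2), of d e] assms(3,4) by simp

lemma lattice_basis_alt: "lattice_basis M B \<longleftrightarrow> finite B \<and> independent B \<and> M = {lin_comb B (\<lambda>b. of_int (k b)) |k. True}"
  by (simp add: lattice_basis_def lin_comb_def)

lemma fundamental_domain_alt: "fundamental_domain B = {lin_comb B t |t. \<forall>b\<in>B. 0 \<le> t b \<and> t b < 1}"
  by (simp add: fundamental_domain_def lin_comb_def)

lemma fundamental_domain_iff:
  assumes "finite B" "independent B"
  shows "w \<in> fundamental_domain B \<longleftrightarrow> w \<in> span B \<and> (\<forall>b\<in>B. 0 \<le> representation B w b \<and> representation B w b < 1)"
proof
  assume "w \<in> fundamental_domain B"
  then show "w \<in> span B \<and> (\<forall>b\<in>B. 0 \<le> representation B w b \<and> representation B w b < 1)"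
    using assms by (auto simp: fundamental_domain_alt representation_lin_comb lin_comb_in_span)
next
  assume "w \<in> span B \<and> (\<forall>b\<in>B. 0 \<le> representation B w b \<and> representation B w b < 1)"
  then show "w \<in> fundamental_domain B"
    using lin_comb_representation[OF assms, of w, symmetric] unfolding fundamental_domain_alt by blast
qed

lemma representation_lin_comb_other:
  assumes "finite E" "independent B" "E \<subseteq> span B"
  shows "representation B (lin_comb E c) b = (\<Sum>e\<in>E. c e * representation B e b)"
  unfolding lin_comb_def using assms
  by (subst representation_sum) (auto simp: span_scale representation_scale subset_iff intro!: sum.cong)

text \<open>In the coordinates of \<open>E\<close> the domain is cut out by finitely many linear
  inequalities.\<close>

lemma sets_coord_set_fundamental_domain:
  assumes E: "finite E" and B: "finite B" "independent B" and sp: "span E = span B"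
  shows "coord_set E (fundamental_domain B) \<in> sets (lborel_PiM E)"
proof -
  have E_sub: "E \<subseteq> span B" using sp span_superset by blast
  have "coord_set E (fundamental_domain B) =
      {c \<in> space (lborel_PiM E). \<forall>b\<in>B. 0 \<le> (\<Sum>e\<in>E. c e * representation B e b) \<and> (\<Sum>e\<in>E. c e * representation B e b) < 1}"
    using lin_comb_in_span[of E] sp
    by (auto simp: coord_set_def fundamental_domain_iff[OF B] representation_lin_comb_other[OF E B(2) E_sub] space_lborel_PiM)
  also have "\<dots> \<in> sets (lborel_PiM E)"
    using B(1) by measurable
  finally show ?thesis .
qed

lemma coord_set_translate:
  assumes "finite E" "independent E" "v \<in> span E" "coord_set E X \<in> sets (lborel_PiM E)"
  shows "emeasure (lborel_PiM E) (coord_set E {w. w + v \<in> X}) = emeasure (lborel_PiM E) (coord_set E X)"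
    "coord_set E {w. w + v \<in> X} \<in> sets (lborel_PiM E)"
proof -
  let ?a = "restrict (representation E v) E"
  have a: "lin_comb E ?a = v"
    using lin_comb_cong[of E ?a "representation E v"] lin_comb_representation[OF assms(1-3)] by simp
  have eq: "coord_set E {w. w + v \<in> X} = {x \<in> extensional E. vadd E ?a x \<in> coord_set E X}"
    by (auto simp: coord_set_def lin_comb_vadd a add.commute)
  show "emeasure (lborel_PiM E) (coord_set E {w. w + v \<in> X}) = emeasure (lborel_PiM E) (coord_set E X)"
    unfolding eq by (rule transl_inv_emeasure) (use assms transl_inv_lborel_PiM in auto)
  show "coord_set E {w. w + v \<in> X} \<in> sets (lborel_PiM E)"
    unfolding eq using measurable_sets[OF measurable_vadd_left assms(4), of ?a]
    by (simp add: vimage_def space_lborel_PiM Int_def conj_commute)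
qed

text \<open>The half-open domain tiles the span: the lattice vector has to remove the integer part
  of every coordinate.\<close>

lemma lattice_translate_ex1:
  assumes B: "lattice_basis M B" and w: "w \<in> span B"
  shows "\<exists>!m. m \<in> M \<and> w + m \<in> fundamental_domain B"
proof -
  have fB: "finite B" and iB: "independent B" and M: "M = {lin_comb B (\<lambda>b. of_int (k b)) |k. True}"
    using B by (auto simp: lattice_basis_alt)
  let ?r = "representation B w"
  have lin_comb_rep: "lin_comb B ?r = w" by (rule lin_comb_representation[OF fB iB w])
  have add: "w + lin_comb B t = lin_comb B (\<lambda>b. ?r b + t b)" for t
    by (subst lin_comb_rep[symmetric]) (simp add: lin_comb_def scaleR_left_distrib sum.distrib)
  show ?thesis
  proof (rule ex_ex1I)
    let ?m = "lin_comb B (\<lambda>b. of_int (- \<lfloor>?r b\<rfloor>))"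
    have "?m \<in> M" unfolding M by (intro CollectI exI[of _ "\<lambda>b. - \<lfloor>?r b\<rfloor>"]) simp
    moreover have "w + ?m \<in> fundamental_domain B"
      unfolding fundamental_domain_alt add
      by (intro CollectI exI[of _ "\<lambda>b. ?r b + of_int (- \<lfloor>?r b\<rfloor>)"] conjI refl ballI; linarith)
    ultimately show "\<exists>m. m \<in> M \<and> w + m \<in> fundamental_domain B" by blast
  next
    fix m m' assume "m \<in> M \<and> w + m \<in> fundamental_domain B" "m' \<in> M \<and> w + m' \<in> fundamental_domain B"
    then obtain k k' where k: "m = lin_comb B (\<lambda>b. of_int (k b))" "m' = lin_comb B (\<lambda>b. of_int (k' b))"
      and fd: "w + m \<in> fundamental_domain B" "w + m' \<in> fundamental_domain B" unfolding M by blast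
    have "k b = k' b" if "b \<in> B" for b
    proof -
      have "0 \<le> ?r b + of_int (k b)" "?r b + of_int (k b) < 1" "0 \<le> ?r b + of_int (k' b)" "?r b + of_int (k' b) < 1"
        using fd that by (auto simp: k add fundamental_domain_iff[OF fB iB] representation_lin_comb[OF fB iB])
      then show ?thesis by linarith
    qed
    then show "m = m'" unfolding k by (intro lin_comb_cong) simp
  qed
qed

lemma countable_lattice: "lattice_basis M B \<Longrightarrow> countable M"
proof -
  assume "lattice_basis M B"
  then have fB: "finite B" and M: "M = {lin_comb B (\<lambda>b. of_int (k b)) |k. True}" by (auto simp: lattice_basis_alt)
  have "M \<subseteq> (\<lambda>k. lin_comb B (\<lambda>b. of_int (k b))) ` (B \<rightarrow>\<^sub>E (UNIV :: int set))"
  proof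
    fix m assume "m \<in> M"
    then obtain k where "m = lin_comb B (\<lambda>b. of_int (k b))" unfolding M by blast
    then have "m = lin_comb B (\<lambda>b. of_int (restrict k B b))" by (simp add: lin_comb_def)
    then show "m \<in> (\<lambda>k. lin_comb B (\<lambda>b. of_int (k b))) ` (B \<rightarrow>\<^sub>E (UNIV :: int set))"
      by (intro image_eqI[of _ _ "restrict k B"]) auto
  qed
  moreover have "countable (B \<rightarrow>\<^sub>E (UNIV :: int set))"
    using fB by (intro countable_PiE) auto
  ultimately show ?thesis by (rule countable_subset[OF _ countable_image])
qed

lemma span_lattice: "lattice_basis M B \<Longrightarrow> span M = span B"
proof -
  assume "lattice_basis M B"
  then have fB: "finite B" and M: "M = {lin_comb B (\<lambda>b. of_int (k b)) |k. True}" by (auto simp: lattice_basis_alt)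
  have "b \<in> M" if "b \<in> B" for b
  proof -
    have "b = lin_comb B (\<lambda>x. of_int (if x = b then 1 else 0))"
      using fB that by (simp add: lin_comb_def if_distrib[of of_int] if_distrib[of "\<lambda>x. x *\<^sub>R _"] cong: if_cong)
    then show ?thesis unfolding M by (intro CollectI exI[of _ "\<lambda>x. if x = b then 1 else 0"]) simp
  qed
  moreover have "M \<subseteq> span B" unfolding M using lin_comb_in_span by blast
  ultimately show ?thesis by (metis span_eq subsetI span_base)
qed

lemma lattice_minus:
  assumes "lattice_basis M B" "m \<in> M" shows "- m \<in> M"
proof -
  have M: "M = {lin_comb B (\<lambda>b. of_int (k b)) |k. True}" using assms by (auto simp: lattice_basis_alt)
  obtain k where "m = lin_comb B (\<lambda>b. of_int (k b))" using assms(2) unfolding M by blast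
  then have "- m = lin_comb B (\<lambda>b. of_int (- k b))" by (simp add: lin_comb_def sum_negf)
  then show ?thesis unfolding M by (intro CollectI exI[of _ "\<lambda>b. - k b"]) auto
qed

text \<open>Each domain is cut into countably many pieces by the lattice translates of the other,
  and translation by \<open>m\<close> carries the piece of the first with index \<open>m\<close>
  onto the piece of the second with index \<open>- m\<close>. This makes \<open>covol\<close>
  independent of the lattice basis it selects.\<close>

lemma fundamental_domains_same_volume:
  assumes B: "lattice_basis M B" and B': "lattice_basis M B'"
    and E: "finite E" "independent E" "span E = span M"
  shows "emeasure (lborel_PiM E) (coord_set E (fundamental_domain B)) = emeasure (lborel_PiM E) (coord_set E (fundamental_domain B'))"
proof -
  have s: "span E = span B" "span E = span B'"
    using span_lattice[OF B] span_lattice[OF B'] E by auto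
  have fB: "finite B" "independent B" "finite B'" "independent B'"
    using B B' by (auto simp: lattice_basis_def)
  let ?F = "fundamental_domain B" and ?F' = "fundamental_domain B'"
  note cM = countable_lattice[OF B]
  have mF: "coord_set E ?F \<in> sets (lborel_PiM E)" "coord_set E ?F' \<in> sets (lborel_PiM E)"
    using sets_coord_set_fundamental_domain fB s E by blast+
  have sp: "m \<in> span E" if "m \<in> M" for m using that E by (simp add: span_base)
  have main: "emeasure (lborel_PiM E) (coord_set E F1) =
      (\<integral>\<^sup>+m. emeasure (lborel_PiM E) (coord_set E {w. w \<in> F1 \<and> w + m \<in> F2}) \<partial>count_space M)"
    if F1: "coord_set E F1 \<in> sets (lborel_PiM E)" and F2: "coord_set E F2 \<in> sets (lborel_PiM E)"
      and ex1: "\<And>w. w \<in> span E \<Longrightarrow> \<exists>!m. m \<in> M \<and> w + m \<in> F2" for F1 F2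
  proof -
    have eq: "coord_set E {w. w \<in> F1 \<and> w + m \<in> F2} = coord_set E F1 \<inter> coord_set E {w. w + m \<in> F2}" for m
      by (auto simp: coord_set_def)
    let ?X = "\<lambda>m. coord_set E {w. w \<in> F1 \<and> w + m \<in> F2}"
    have "coord_set E F1 = (\<Union>m\<in>M. ?X m)"
    proof (rule set_eqI)
      fix c
      have "\<exists>m. m \<in> M \<and> lin_comb E c + m \<in> F2"
        using ex1[OF lin_comb_in_span] by blast
      then show "c \<in> coord_set E F1 \<longleftrightarrow> c \<in> (\<Union>m\<in>M. ?X m)"
        by (auto simp: coord_set_def)
    qed
    moreover have "disjoint_family_on ?X M"
      unfolding disjoint_family_on_def
    proof (intro ballI impI)
      fix m m' assume mm: "m \<in> M" "m' \<in> M" "m \<noteq> m'"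
      have False if c: "c \<in> ?X m" "c \<in> ?X m'" for c
      proof -
        have "lin_comb E c + m \<in> F2" "lin_comb E c + m' \<in> F2" using c by (auto simp: coord_set_def)
        then show False using ex1[OF lin_comb_in_span, of c] mm by blast
      qed
      then show "?X m \<inter> ?X m' = {}" by blast
    qed
    moreover have "?X m \<in> sets (lborel_PiM E)" if "m \<in> M" for m
      unfolding eq using coord_set_translate(2)[OF E(1,2) sp[OF that] F2] F1 by (intro sets.Int)
    ultimately show ?thesis
      using emeasure_UN_countable[where X = ?X and M = "lborel_PiM E" and I = M, OF _ cM] by simp
  qed
  have inter: "coord_set E {w. w \<in> F1 \<and> w + m \<in> F2} \<in> sets (lborel_PiM E)"
    if "coord_set E F1 \<in> sets (lborel_PiM E)" "coord_set E F2 \<in> sets (lborel_PiM E)" "m \<in> M" for F1 F2 m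
  proof -
    have "coord_set E {w. w \<in> F1 \<and> w + m \<in> F2} = coord_set E F1 \<inter> coord_set E {w. w + m \<in> F2}"
      by (auto simp: coord_set_def)
    then show ?thesis using coord_set_translate(2)[OF E(1,2) sp that(2)] that by auto
  qed
  have "emeasure (lborel_PiM E) (coord_set E ?F) = (\<integral>\<^sup>+m. emeasure (lborel_PiM E) (coord_set E {w. w \<in> ?F \<and> w + m \<in> ?F'}) \<partial>count_space M)"
    using lattice_translate_ex1[OF B'] s by (intro main mF) auto
  also have "\<dots> = (\<integral>\<^sup>+m. emeasure (lborel_PiM E) (coord_set E {w. w \<in> ?F' \<and> w + (-m) \<in> ?F}) \<partial>count_space M)"
  proof (rule nn_integral_cong)
    fix m assume "m \<in> space (count_space M)"
    then have m: "m \<in> M" "- m \<in> M" using lattice_minus[OF B] by auto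
    have "{w. w + m \<in> {w. w \<in> ?F' \<and> w + (-m) \<in> ?F}} = {w. w \<in> ?F \<and> w + m \<in> ?F'}" by auto
    then show "emeasure (lborel_PiM E) (coord_set E {w. w \<in> ?F \<and> w + m \<in> ?F'}) = emeasure (lborel_PiM E) (coord_set E {w. w \<in> ?F' \<and> w + (-m) \<in> ?F})"
      using coord_set_translate(1)[OF E(1,2) sp[OF m(1)] inter[OF mF(2,1) m(2)]] by simp
  qed
  also have "\<dots> = (\<integral>\<^sup>+m. emeasure (lborel_PiM E) (coord_set E {w. w \<in> ?F' \<and> w + m \<in> ?F}) \<partial>count_space M)"
  proof (rule nn_integral_bij_count_space)
    show "bij_betw uminus M M"
      using lattice_minus[OF B] by (intro bij_betw_byWitness[of _ uminus]) auto
  qed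
  also have "\<dots> = emeasure (lborel_PiM E) (coord_set E ?F')"
    using lattice_translate_ex1[OF B] s by (intro main[symmetric] mF) auto
  finally show ?thesis .
qed

section \<open>The covolume as a product of distances\<close>

text \<open>Fubini along \<open>e\<close>: at height \<open>y\<close> between 0 and
  \<open>\<tau>\<close> the slice of the larger domain is the smaller one translated by
  \<open>(y / \<tau>) *\<^sub>R v\<close>. This shear preserves the volume of slices, so only the
  height \<open>\<tau>\<close> enters.\<close>

lemma emeasure_coord_set_insert:
  fixes e :: "'v::real_vector"
  assumes E: "finite E" "e \<notin> E" "independent (insert e E)"
    and B: "finite B" "independent (insert b B)" "b \<notin> B" "span B = span E"
    and b: "b = \<tau> *\<^sub>R e + v" "v \<in> span E" and \<tau>: "0 < \<tau>"
  shows "emeasure (lborel_PiM (insert e E)) (coord_set (insert e E) (fundamental_domain (insert b B))) =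
    ennreal \<tau> * emeasure (lborel_PiM E) (coord_set E (fundamental_domain B))"
proof -
  let ?F = "fundamental_domain B" and ?F' = "fundamental_domain (insert b B)"
  have iE: "independent E" and iB: "independent B" using independent_mono[OF E(3)] independent_mono[OF B(2)] by auto
  have e: "e \<notin> span E" using E by (simp add: independent_insert)
  have spE: "span (insert b B) = span (insert e E)"
  proof -
    have "b \<in> span (insert e E)"
      unfolding b(1) using b(2) span_mono[of E "insert e E"]
      by (intro span_add[OF span_scale[OF span_base]]) auto
    moreover have "B \<subseteq> span (insert e E)"
      using B(4) span_superset[of B] span_mono[of E "insert e E"] by blast
    moreover have "E \<subseteq> span (insert b B)"
      using B(4) span_superset[of E] span_mono[of B "insert b B"] by blast
    moreover have "e \<in> span (insert b B)"
    proof -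
      have "(1 / \<tau>) *\<^sub>R (b - v) \<in> span (insert b B)"
        using b(2) B(4) span_mono[of B "insert b B"] by (intro span_scale span_diff[OF span_base]) auto
      moreover have "(1 / \<tau>) *\<^sub>R (b - v) = e" using b \<tau> by simp
      ultimately show ?thesis by simp
    qed
    ultimately show ?thesis
      by (subst span_eq) simp
  qed
  have F_sub: "?F \<subseteq> span E"
    using B(4) by (auto simp: fundamental_domain_alt lin_comb_in_span)
  have m': "coord_set (insert e E) ?F' \<in> sets (lborel_PiM (insert e E))"
    using E B spE by (intro sets_coord_set_fundamental_domain) auto
  have m: "coord_set E ?F \<in> sets (lborel_PiM E)"
    using E B iB by (intro sets_coord_set_fundamental_domain) auto
  have lin_comb_upd: "lin_comb (insert e E) (c(e := y)) = lin_comb E c + y *\<^sub>R e" for c y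
    using E by (auto simp: lin_comb_def intro!: sum.cong)
  have mem: "x(e := y) \<in> coord_set (insert e E) ?F' \<longleftrightarrow> 0 \<le> y \<and> y < \<tau> \<and> x \<in> coord_set E {w. w + (- (y / \<tau>)) *\<^sub>R v \<in> ?F}"
    if x: "x \<in> extensional E" for x y
  proof -
    have x': "x(e := y) \<in> extensional (insert e E)" using x by (auto simp: extensional_def)
    have "x(e := y) \<in> coord_set (insert e E) ?F' \<longleftrightarrow> lin_comb E x + y *\<^sub>R e \<in> ?F'"
      using x' by (simp add: coord_set_def lin_comb_upd)
    also have "\<dots> \<longleftrightarrow> 0 \<le> y \<and> y < \<tau> \<and> lin_comb E x + (- (y / \<tau>)) *\<^sub>R v \<in> ?F"
    proof
      assume "lin_comb E x + y *\<^sub>R e \<in> ?F'"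
      then obtain t where t: "lin_comb E x + y *\<^sub>R e = lin_comb (insert b B) t" "\<forall>c\<in>insert b B. 0 \<le> t c \<and> t c < 1"
        by (auto simp: fundamental_domain_alt)
      have eq: "lin_comb E x + y *\<^sub>R e = t b *\<^sub>R b + lin_comb B t"
        using t(1) B by (simp add: lin_comb_def)
      \<comment> \<open>Comparing components along \<open>e\<close>, which lies outside the span of
        \<open>E\<close>, forces the coefficient of \<open>b\<close> to be
        \<open>y / \<tau>\<close>.\<close>
      then have "(y - t b * \<tau>) *\<^sub>R e = t b *\<^sub>R v + lin_comb B t - lin_comb E x"
        unfolding b(1) by (simp add: algebra_simps)
      moreover have "t b *\<^sub>R v + lin_comb B t - lin_comb E x \<in> span E"
        using b(2) lin_comb_in_span[of B t] lin_comb_in_span[of E x] B(4) by (intro span_diff span_add span_scale) auto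
      ultimately have mem: "(y - t b * \<tau>) *\<^sub>R e \<in> span E" by simp
      have "y - t b * \<tau> = 0"
      proof (rule ccontr)
        assume "y - t b * \<tau> \<noteq> 0"
        then have "(1 / (y - t b * \<tau>)) *\<^sub>R (y - t b * \<tau>) *\<^sub>R e = e" by simp
        then show False using e span_scale[OF mem, of "1 / (y - t b * \<tau>)"] by simp
      qed
      then have y: "y = t b * \<tau>" by simp
      then have "lin_comb E x + (- (y / \<tau>)) *\<^sub>R v = lin_comb B t"
        using eq \<tau> unfolding b(1) by (simp add: algebra_simps)
      moreover have "lin_comb B t \<in> ?F" using t(2) unfolding fundamental_domain_alt by blast
      ultimately show "0 \<le> y \<and> y < \<tau> \<and> lin_comb E x + (- (y / \<tau>)) *\<^sub>R v \<in> ?F"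
        using t(2) \<tau> y by auto
    next
      assume *: "0 \<le> y \<and> y < \<tau> \<and> lin_comb E x + (- (y / \<tau>)) *\<^sub>R v \<in> ?F"
      then obtain t where t: "lin_comb E x + (- (y / \<tau>)) *\<^sub>R v = lin_comb B t" "\<forall>c\<in>B. 0 \<le> t c \<and> t c < 1"
        by (auto simp: fundamental_domain_alt)
      have "lin_comb (insert b B) (t(b := y / \<tau>)) = (y / \<tau>) *\<^sub>R b + lin_comb B t"
        using B by (auto simp: lin_comb_def intro!: sum.cong)
      also have "\<dots> = lin_comb E x + y *\<^sub>R e"
        unfolding t(1)[symmetric] b(1) using \<tau> by (simp add: algebra_simps)
      finally have "lin_comb E x + y *\<^sub>R e = lin_comb (insert b B) (t(b := y / \<tau>))" ..
      moreover have "\<forall>c\<in>insert b B. 0 \<le> (t(b := y / \<tau>)) c \<and> (t(b := y / \<tau>)) c < 1"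
        using t(2) * \<tau> by auto
      ultimately show "lin_comb E x + y *\<^sub>R e \<in> ?F'"
        unfolding fundamental_domain_alt by blast
    qed
    finally show ?thesis using x by (auto simp: coord_set_def)
  qed
  have "emeasure (lborel_PiM (insert e E)) (coord_set (insert e E) ?F') =
      (\<integral>\<^sup>+c. indicator (coord_set (insert e E) ?F') c \<partial>lborel_PiM (insert e E))"
    using m' by simp
  also have "\<dots> = (\<integral>\<^sup>+y. \<integral>\<^sup>+x. indicator (coord_set (insert e E) ?F') (x(e := y)) \<partial>lborel_PiM E \<partial>lborel)"
    using E m' by (intro lborel_product.product_nn_integral_insert_rev) auto
  also have "\<dots> = (\<integral>\<^sup>+y. emeasure (lborel_PiM E) (coord_set E ?F) * indicator {0..<\<tau>} y \<partial>lborel)"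
  proof (rule nn_integral_cong)
    fix y :: real
    let ?C = "coord_set E {w. w + (- (y / \<tau>)) *\<^sub>R v \<in> ?F}"
    have C: "?C \<in> sets (lborel_PiM E)" "emeasure (lborel_PiM E) ?C = emeasure (lborel_PiM E) (coord_set E ?F)"
      using coord_set_translate[OF E(1) iE _ m, of "(- (y / \<tau>)) *\<^sub>R v"] b(2) by (auto intro: span_scale span_neg)
    have "(\<integral>\<^sup>+x. indicator (coord_set (insert e E) ?F') (x(e := y)) \<partial>lborel_PiM E) = (\<integral>\<^sup>+x. indicator ?C x * indicator {0..<\<tau>} y \<partial>lborel_PiM E)"
      by (rule nn_integral_cong) (auto simp: mem space_lborel_PiM split: split_indicator)
    also have "\<dots> = emeasure (lborel_PiM E) (coord_set E ?F) * indicator {0..<\<tau>} y"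
      using C by (simp add: nn_integral_multc)
    finally show "(\<integral>\<^sup>+x. indicator (coord_set (insert e E) ?F') (x(e := y)) \<partial>lborel_PiM E) = emeasure (lborel_PiM E) (coord_set E ?F) * indicator {0..<\<tau>} y" .
  qed
  also have "\<dots> = ennreal \<tau> * emeasure (lborel_PiM E) (coord_set E ?F)"
    using \<tau> by (subst nn_integral_cmult) (auto simp: mult.commute)
  finally show ?thesis .
qed

section \<open>Orthonormal bases and Gram-Schmidt for a possibly degenerate form\<close>

locale semi_inner_product =
  fixes ip :: "'v::real_vector \<Rightarrow> 'v \<Rightarrow> real" and h :: "'v \<Rightarrow> real"
  assumes ip_add: "ip (u + v) w = ip u w + ip v w"
    and ip_scale: "ip (a *\<^sub>R u) v = a * ip u v"
    and ip_sym: "ip u v = ip v u"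
    and ip_nonneg: "0 \<le> ip v v"
    and h_eq: "h v = sqrt (ip v v)"
begin

lemma ip_add_right: "ip w (u + v) = ip w u + ip w v"
  by (simp add: ip_sym[of w] ip_add)

lemma ip_scale_right: "ip u (a *\<^sub>R v) = a * ip u v"
  by (simp add: ip_sym[of u] ip_scale)

lemma ip_zero [simp]: "ip 0 v = 0" "ip v 0 = 0"
  using ip_scale[of 0 0 v] ip_scale_right[of v 0 0] by auto

lemma ip_minus: "ip (- u) v = - ip u v" "ip v (- u) = - ip v u"
  using ip_scale[of "-1" u v] ip_scale_right[of v "-1" u] by auto

lemma ip_diff: "ip (u - v) w = ip u w - ip v w" "ip w (u - v) = ip w u - ip w v"
  using ip_add[of u "-v" w] ip_add_right[of w u "-v"] by (auto simp: ip_minus)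

lemma ip_sum: "ip (\<Sum>x\<in>A. f x) w = (\<Sum>x\<in>A. ip (f x) w)"
  by (induction A rule: infinite_finite_induct) (auto simp: ip_add)

lemma ip_sum_right: "ip w (\<Sum>x\<in>A. f x) = (\<Sum>x\<in>A. ip w (f x))"
  by (induction A rule: infinite_finite_induct) (auto simp: ip_add_right)

lemma polar_inner_eq: "polar_inner h u v = ip u v"
proof -
  have "(h w)\<^sup>2 = ip w w" for w by (simp add: h_eq ip_nonneg)
  then show ?thesis
    by (simp add: polar_inner_def ip_add ip_add_right ip_diff ip_sym[of v u])
qed

definition orthonormal :: "'v set \<Rightarrow> bool" where
  "orthonormal E \<longleftrightarrow> (\<forall>e\<in>E. \<forall>f\<in>E. ip e f = (if e = f then 1 else 0))"

lemma ip_lin_comb: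
  assumes "finite E" "orthonormal E" "f \<in> E"
  shows "ip (lin_comb E c) f = c f"
proof -
  have "ip (lin_comb E c) f = (\<Sum>e\<in>E. if e = f then c e else 0)"
    unfolding lin_comb_def ip_sum using assms by (intro sum.cong) (auto simp: ip_scale orthonormal_def)
  then show ?thesis using assms by simp
qed

lemma ip_lin_comb_self:
  assumes "finite E" "orthonormal E"
  shows "ip (lin_comb E c) (lin_comb E c) = (\<Sum>e\<in>E. (c e)\<^sup>2)"
proof -
  have "ip (lin_comb E c) (lin_comb E c) = (\<Sum>e\<in>E. c e * ip (lin_comb E c) e)"
    by (subst (2) lin_comb_def) (simp add: ip_sum_right ip_scale_right)
  also have "\<dots> = (\<Sum>e\<in>E. (c e)\<^sup>2)"
    using assms by (intro sum.cong) (auto simp: ip_lin_comb power2_eq_square)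
  finally show ?thesis .
qed

lemma orthonormal_independent:
  assumes "finite E" "orthonormal E"
  shows "independent E"
  unfolding dependent_finite[OF assms(1)]
proof
  assume "\<exists>u. (\<exists>v\<in>E. u v \<noteq> 0) \<and> (\<Sum>v\<in>E. u v *\<^sub>R v) = 0"
  then obtain u v where u: "v \<in> E" "u v \<noteq> 0" "lin_comb E u = 0" by (auto simp: lin_comb_def)
  then show False using ip_lin_comb[OF assms u(1), of u] by simp
qed

lemma orthonormal_insert:
  assumes "orthonormal E" "ip u u = 1" "\<And>f. f \<in> E \<Longrightarrow> ip u f = 0"
  shows "orthonormal (insert u E)"
  unfolding orthonormal_def
proof (intro ballI)
  fix e f assume "e \<in> insert u E" "f \<in> insert u E"
  then show "ip e f = (if e = f then 1 else 0)"
    using assms ip_sym[of e u] by (cases "e = u"; cases "f = u") (auto simp: orthonormal_def)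
qed

text \<open>
  Both measures are translation invariant, hence proportional, and they agree on the unit ball.
\<close>

lemma emeasure_coord_set_orthonormal:
  assumes E: "finite E" "orthonormal E" and F: "finite F" "orthonormal F"
    and sp: "span E = span F" and X: "coord_set F X \<in> sets (lborel_PiM F)"
  shows "emeasure (lborel_PiM E) (coord_set E X) = emeasure (lborel_PiM F) (coord_set F X)"
proof -
  have iE: "independent E" and iF: "independent F"
    using orthonormal_independent[OF E] orthonormal_independent[OF F] by auto
  define \<phi> where "\<phi> c = (\<lambda>f\<in>F. \<Sum>e\<in>E. c e * representation F e f)" for c
  define \<psi> where "\<psi> c = (\<lambda>e\<in>E. \<Sum>f\<in>F. c f * representation E f e)" for c
  have m\<phi>: "\<phi> \<in> lborel_PiM E \<rightarrow>\<^sub>M lborel_PiM F" and m\<psi>: "\<psi> \<in> lborel_PiM F \<rightarrow>\<^sub>M lborel_PiM E"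
    unfolding \<phi>_def \<psi>_def by measurable
  have sub: "E \<subseteq> span F" "F \<subseteq> span E" using sp span_superset by blast+
  have lin_comb\<phi>: "lin_comb F (\<phi> c) = lin_comb E c" for c
  proof -
    have "lin_comb F (\<phi> c) = lin_comb F (representation F (lin_comb E c))"
      by (intro lin_comb_cong) (simp add: \<phi>_def representation_lin_comb_other[OF E(1) iF sub(1)])
    also have "\<dots> = lin_comb E c" using lin_comb_in_span[of E c] sp by (intro lin_comb_representation F iF) simp
    finally show ?thesis .
  qed
  have lin_comb\<psi>: "lin_comb E (\<psi> c) = lin_comb F c" for c
  proof -
    have "lin_comb E (\<psi> c) = lin_comb E (representation E (lin_comb F c))"
      by (intro lin_comb_cong) (simp add: \<psi>_def representation_lin_comb_other[OF F(1) iE sub(2)])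
    also have "\<dots> = lin_comb F c" using lin_comb_in_span[of F c] sp by (intro lin_comb_representation E iE) simp
    finally show ?thesis .
  qed
  have ext: "\<phi> c \<in> extensional F" "\<psi> c \<in> extensional E" for c by (auto simp: \<phi>_def \<psi>_def)
  have inj: "c = d" if "lin_comb A c = lin_comb A d" "c \<in> extensional A" "d \<in> extensional A" "finite A" "independent A" for A c and d :: "'v \<Rightarrow> real"
    using lin_comb_inject[OF that(4,5,1)] that(2,3) by (intro extensionalityI) auto
  have pre: "\<phi> -` coord_set F Y \<inter> space (lborel_PiM E) = coord_set E Y" for Y
    by (auto simp: coord_set_def lin_comb\<phi> ext space_lborel_PiM)
  \<comment> \<open>The pushforward under the change of coordinates takes the place of a
    determinant: once \<open>\<nu>\<close> is known to be translation invariant, a single comparison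
    on the unit ball determines it.\<close>
  define \<nu> where "\<nu> = distr (lborel_PiM E) (lborel_PiM F) \<phi>"
  have \<nu>: "emeasure \<nu> (coord_set F Y) = emeasure (lborel_PiM E) (coord_set E Y)" if "coord_set F Y \<in> sets (lborel_PiM F)" for Y
    unfolding \<nu>_def using that by (subst emeasure_distr[OF m\<phi>]) (auto simp: pre)
  have ti: "transl_inv F \<nu>"
    unfolding transl_inv_def
  proof (intro conjI ballI)
    show s: "sets \<nu> = sets (lborel_PiM F)" by (simp add: \<nu>_def)
    fix a :: "'v \<Rightarrow> real" assume a: "a \<in> extensional F"
    have \<phi>_add: "vadd F a (\<phi> c) = \<phi> (vadd E (\<psi> a) c)" for c
      using F iF by (intro inj[where A = F]) (auto simp: lin_comb_vadd lin_comb\<phi> lin_comb\<psi> ext)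
    have "distr \<nu> \<nu> (vadd F a) = distr \<nu> (lborel_PiM F) (vadd F a)"
      by (rule distr_cong) (auto simp: s)
    also have "\<dots> = distr (lborel_PiM E) (lborel_PiM F) (vadd F a \<circ> \<phi>)"
      unfolding \<nu>_def by (intro distr_distr m\<phi> measurable_vadd_left)
    also have "\<dots> = distr (lborel_PiM E) (lborel_PiM F) (\<phi> \<circ> vadd E (\<psi> a))"
      by (rule distr_cong) (auto simp: \<phi>_add)
    also have "\<dots> = distr (distr (lborel_PiM E) (lborel_PiM E) (vadd E (\<psi> a))) (lborel_PiM F) \<phi>"
      by (intro distr_distr[symmetric] m\<phi> measurable_vadd_left)
    also have "\<dots> = \<nu>"
      using transl_inv_lborel_PiM[OF E(1)] ext by (simp add: transl_inv_def \<nu>_def)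
    finally show "distr \<nu> \<nu> (vadd F a) = \<nu>" .
  qed
  \<comment> \<open>Pushed back along the inverse change of coordinates, \<open>\<nu>\<close>
    becomes the product measure again, which is sigma-finite.\<close>
  have sf: "sigma_finite_measure \<nu>"
  proof (rule sigma_finite_measure_distr)
    have "distr \<nu> (lborel_PiM E) \<psi> = distr (lborel_PiM E) (lborel_PiM E) (\<psi> \<circ> \<phi>)"
      unfolding \<nu>_def by (intro distr_distr m\<phi> m\<psi>)
    also have "\<dots> = distr (lborel_PiM E) (lborel_PiM E) (\<lambda>x. x)"
      by (rule distr_cong) (auto simp: space_lborel_PiM lin_comb\<phi> lin_comb\<psi> ext intro!: inj[where A = E] E iE)
    also have "\<dots> = lborel_PiM E" by (simp add: distr_id2)
    finally show "sigma_finite_measure (distr \<nu> (lborel_PiM E) \<psi>)"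
      by (simp add: sigma_finite_lborel_PiM[OF E(1)])
    show "\<psi> \<in> \<nu> \<rightarrow>\<^sub>M lborel_PiM E" using m\<psi> by (simp add: \<nu>_def)
  qed
  let ?b = "{w \<in> span F. ip w w \<le> 1}"
  have ball: "coord_set F ?b = unit_ball F" "coord_set E ?b = unit_ball E"
    using E F sp lin_comb_in_span[of E] lin_comb_in_span[of F] by (auto simp: coord_set_def unit_ball_def ip_lin_comb_self)
  have neg: "{x \<in> extensional F. vneg F x \<in> unit_ball F} = unit_ball F"
    by (auto simp: unit_ball_def vneg_def)
  have "card E = card F"
    using dim_span_eq_card_independent[OF iE] dim_span_eq_card_independent[OF iF] sp by simp
  then obtain \<sigma> where "bij_betw \<sigma> E F"
    using finite_same_card_bij[OF E(1) F(1)] by blast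
  from emeasure_unit_ball_cong[OF this E(1)]
  have eqb: "emeasure (lborel_PiM E) (unit_ball E) = emeasure (lborel_PiM F) (unit_ball F)" .
  have "emeasure (lborel_PiM F) (unit_ball F) * emeasure \<nu> (coord_set F X) = emeasure (lborel_PiM F) (coord_set F X) * emeasure \<nu> (unit_ball F)"
    using transl_inv_cross[OF transl_inv_lborel_PiM[OF F(1)] sigma_finite_lborel_PiM[OF F(1)] ti sf sets_unit_ball[OF F(1)] X]
    by (simp only: neg)
  also have "emeasure \<nu> (unit_ball F) = emeasure (lborel_PiM F) (unit_ball F)"
    using \<nu>[of ?b] sets_unit_ball[OF F(1)] eqb by (simp add: ball)
  finally have "emeasure (lborel_PiM F) (unit_ball F) * emeasure \<nu> (coord_set F X) = emeasure (lborel_PiM F) (unit_ball F) * emeasure (lborel_PiM F) (coord_set F X)"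
    by (simp add: mult.commute)
  then have "emeasure \<nu> (coord_set F X) = emeasure (lborel_PiM F) (coord_set F X)"
    using emeasure_unit_ball[OF F(1)] by (simp add: ennreal_mult_cancel_left)
  then show ?thesis using \<nu>[OF X] by simp
qed

text \<open>Besides the orthonormal vectors the recursion records \<open>\<tau> k\<close>, the
  length of the part of \<open>b k\<close> orthogonal to its predecessors. The equality of all
  initial spans says that \<open>b\<close> is triangular in the new basis, and definiteness is asked
  only on the span in question.\<close>

lemma gram_schmidt:
  fixes b :: "nat \<Rightarrow> 'v"
  assumes "independent (b ` {..<d})" "inj_on b {..<d}"
    and pos: "\<And>v. v \<in> span (b ` {..<d}) \<Longrightarrow> v \<noteq> 0 \<Longrightarrow> 0 < ip v v"
  shows "\<exists>e \<tau>. inj_on e {..<d} \<and> orthonormal (e ` {..<d}) \<and> (\<forall>k\<le>d. span (e ` {..<k}) = span (b ` {..<k})) \<and>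
    (\<forall>k<d. 0 < \<tau> k \<and> b k - \<tau> k *\<^sub>R e k \<in> span (e ` {..<k}))"
  using assms
proof (induction d)
  case 0
  then show ?case by (auto simp: orthonormal_def)
next
  case (Suc d)
  have ins: "b ` {..<Suc d} = insert (b d) (b ` {..<d})" by (simp add: lessThan_Suc)
  have bsub: "span (b ` {..<d}) \<subseteq> span (b ` {..<Suc d})" by (intro span_mono) auto
  have "independent (b ` {..<d})" "inj_on b {..<d}"
    using independent_mono[OF Suc.prems(1)] inj_on_subset[OF Suc.prems(2)] by (auto simp: ins)
  moreover have "0 < ip v v" if "v \<in> span (b ` {..<d})" "v \<noteq> 0" for v
    using that bsub Suc.prems(3) by (auto simp: ins)
  ultimately obtain e \<tau> where inj: "inj_on e {..<d}" and orth: "orthonormal (e ` {..<d})"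
    and sp: "\<And>k. k \<le> d \<Longrightarrow> span (e ` {..<k}) = span (b ` {..<k})"
    and \<tau>: "\<And>k. k < d \<Longrightarrow> 0 < \<tau> k \<and> b k - \<tau> k *\<^sub>R e k \<in> span (e ` {..<k})"
    using Suc.IH by blast
  let ?E = "e ` {..<d}"
  \<comment> \<open>\<open>p\<close> is the orthogonal projection of \<open>b d\<close> to the span
    already treated; \<open>w\<close> is the remaining orthogonal part, to be normalised.\<close>
  define p where "p = lin_comb ?E (ip (b d))"
  define w where "w = b d - p"
  have fE: "finite ?E" by simp
  have p: "p \<in> span ?E" unfolding p_def by (rule lin_comb_in_span)
  have bd: "b d \<notin> b ` {..<d}" by (auto dest!: inj_onD[OF Suc.prems(2)])
  then have "b d \<notin> span (b ` {..<d})" using Suc.prems(1) by (simp add: ins independent_insert)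
  then have w0: "w \<noteq> 0" using p sp[of d] by (auto simp: w_def)
  have "w \<in> span (b ` {..<Suc d})"
    unfolding w_def using p sp[of d] bsub
    by (intro span_diff[OF span_base]) auto
  then have ipw: "0 < ip w w" using Suc.prems(3) w0 by blast
  let ?t = "sqrt (ip w w)" and ?u = "(1 / sqrt (ip w w)) *\<^sub>R w"
  have t: "0 < ?t" using ipw by simp
  have uu: "ip ?u ?u = 1" using ipw by (simp add: ip_scale ip_scale_right flip: real_sqrt_mult)
  have wf: "ip w f = 0" if "f \<in> ?E" for f
    using ip_lin_comb[OF fE orth that, of "ip (b d)"] by (simp add: w_def ip_diff p_def)
  have uf: "ip ?u f = 0" "ip f ?u = 0" if "f \<in> ?E" for f
    using wf[OF that] by (auto simp: ip_scale ip_scale_right ip_sym[of f])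
  have unE: "?u \<notin> ?E" using uf uu by fastforce
  let ?e = "e(d := ?u)" and ?\<tau> = "\<tau>(d := ?t)"
  have eim: "?e ` {..<k} = e ` {..<k}" if "k \<le> d" for k
    using that by (auto simp: image_iff)
  have eS: "?e ` {..<Suc d} = insert ?u ?E"
    using eim[OF order_refl] by (simp only: lessThan_Suc image_insert fun_upd_same)
  have "inj_on ?e {..<Suc d}"
  proof -
    have "inj_on ?e {..<d}" by (rule inj_on_fun_updI[OF inj unE])
    moreover have "?e d \<notin> ?e ` ({..<d} - {d})"
    proof -
      have "{..<d} - {d} = {..<d}" by auto
      then show ?thesis using eim[OF order_refl] unE by (simp only: fun_upd_same not_False_eq_True)
    qed
    ultimately show ?thesis by (simp only: lessThan_Suc inj_on_insert not_False_eq_True)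
  qed
  moreover have "orthonormal (?e ` {..<Suc d})"
    unfolding eS by (rule orthonormal_insert[OF orth uu uf(1)])
  moreover have "span (?e ` {..<k}) = span (b ` {..<k})" if "k \<le> Suc d" for k
  proof (cases "k \<le> d")
    case True
    then show ?thesis using eim sp by simp
  next
    case False
    then have k: "k = Suc d" using that by simp
    have "?u \<in> span (b ` {..<Suc d})" by (rule span_scale) fact
    moreover have "?E \<subseteq> span (b ` {..<Suc d})"
      using sp[of d] span_superset[of ?E] bsub by (auto simp: ins)
    moreover have "b ` {..<d} \<subseteq> span (insert ?u ?E)"
      using sp[of d] span_superset[of "b ` {..<d}"] span_mono[of ?E "insert ?u ?E"] by auto
    moreover have "b d \<in> span (insert ?u ?E)"
    proof -
      have "b d = ?t *\<^sub>R ?u + p" using t by (simp add: w_def)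
      moreover have "?t *\<^sub>R ?u + p \<in> span (insert ?u ?E)"
        using p span_mono[of ?E "insert ?u ?E"] by (intro span_add[OF span_scale[OF span_base]]) auto
      ultimately show ?thesis by metis
    qed
    ultimately show ?thesis unfolding k eS by (subst span_eq) (auto simp: ins)
  qed
  moreover have "0 < ?\<tau> k \<and> b k - ?\<tau> k *\<^sub>R ?e k \<in> span (?e ` {..<k})" if "k < Suc d" for k
  proof (cases "k = d")
    case True
    have "b d - ?t *\<^sub>R ?u = p" using t by (simp add: w_def)
    then show ?thesis using True t p eim[of d] by simp
  next
    case False
    then show ?thesis using \<tau>[of k] that eim[of k] by simp
  qed
  ultimately show ?case by blast
qed

definition lead_dist :: "(nat \<Rightarrow> 'v) \<Rightarrow> nat \<Rightarrow> real" where
  "lead_dist b k = Inf ((\<lambda>w. h (b k + w)) ` span (b ` {..<k}))"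

text \<open>In the Gram-Schmidt basis the lattice basis is triangular with diagonal entries
  \<open>\<tau> k\<close>, so the volume of its domain is their product. By Pythagoras
  \<open>\<tau> k\<close> is the minimum of \<open>h\<close> on \<open>b k\<close> plus the span of
  the earlier vectors.\<close>

theorem covol_eq_prod_lead_dist:
  assumes B: "lattice_basis M (b ` {..<d})" "inj_on b {..<d}"
    and pos: "\<And>v. v \<in> span M \<Longrightarrow> v \<noteq> 0 \<Longrightarrow> h v \<noteq> 0"
  shows "covol M h = (\<Prod>k<d. lead_dist b k)" "\<And>k. k < d \<Longrightarrow> 0 < lead_dist b k"
proof -
  have ind: "independent (b ` {..<d})" using B by (simp add: lattice_basis_def)
  have spM: "span M = span (b ` {..<d})" by (rule span_lattice[OF B(1)])
  have "0 < ip v v" if "v \<in> span (b ` {..<d})" "v \<noteq> 0" for v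
    using pos[of v] that ip_nonneg[of v] by (auto simp: spM h_eq less_le)
  from gram_schmidt[OF ind B(2) this]
  obtain e \<tau> where inj: "inj_on e {..<d}" and orth: "orthonormal (e ` {..<d})"
    and sp: "\<And>k. k \<le> d \<Longrightarrow> span (e ` {..<k}) = span (b ` {..<k})"
    and \<tau>: "\<And>k. k < d \<Longrightarrow> 0 < \<tau> k" "\<And>k. k < d \<Longrightarrow> b k - \<tau> k *\<^sub>R e k \<in> span (e ` {..<k})"
    by blast
  have lead: "lead_dist b k = \<tau> k" if k: "k < d" for k
    unfolding lead_dist_def
  proof (rule cInf_eq_minimum)
    have oE: "orthonormal (e ` {..<k})" using orth k by (auto simp: orthonormal_def)
    have ek: "e k \<notin> e ` {..<k}" using inj k by (auto dest!: inj_onD[OF inj])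
    have perp: "ip (e k) u = 0" if "u \<in> span (e ` {..<k})" for u
    proof -
      have "u = lin_comb (e ` {..<k}) (representation (e ` {..<k}) u)"
        using that oE by (intro lin_comb_representation[symmetric] orthonormal_independent) auto
      moreover have "ip (e k) (lin_comb (e ` {..<k}) c) = 0" for c
        unfolding lin_comb_def ip_sum_right using orth ek k
        by (intro sum.neutral) (auto simp: ip_scale_right orthonormal_def)
      ultimately show ?thesis by metis
    qed
    have ekk: "ip (e k) (e k) = 1" using orth k by (auto simp: orthonormal_def)
    let ?v = "b k - \<tau> k *\<^sub>R e k"
    have v: "?v \<in> span (e ` {..<k})" using \<tau> k by simp
    have h: "h (b k + w) = sqrt ((\<tau> k)\<^sup>2 + ip (?v + w) (?v + w))" if "w \<in> span (e ` {..<k})" for w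
    proof -
      have u: "?v + w \<in> span (e ` {..<k})" using v that by (rule span_add)
      have "b k + w = \<tau> k *\<^sub>R e k + (?v + w)" by simp
      then have "ip (b k + w) (b k + w) = ip (\<tau> k *\<^sub>R e k + (?v + w)) (\<tau> k *\<^sub>R e k + (?v + w))" by simp
      also have "\<dots> = (\<tau> k)\<^sup>2 + ip (?v + w) (?v + w)"
        using perp[OF u] unfolding ip_add[of "\<tau> k *\<^sub>R e k"] ip_add_right[of _ "\<tau> k *\<^sub>R e k"]
        by (simp add: ip_scale ip_scale_right ekk ip_sym[of "?v + w" "e k"] power2_eq_square)
      finally show ?thesis by (simp add: h_eq)
    qed
    have "- ?v \<in> span (b ` {..<k})" using span_neg[OF v] sp k by (simp del: minus_diff_eq)
    moreover have "h (b k + (- ?v)) = \<tau> k"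
      using h[OF span_neg[OF v]] \<tau>(1)[OF k] by simp
    ultimately show "\<tau> k \<in> (\<lambda>w. h (b k + w)) ` span (b ` {..<k})" by (metis image_eqI)
    fix x assume "x \<in> (\<lambda>w. h (b k + w)) ` span (b ` {..<k})"
    then obtain w where "w \<in> span (e ` {..<k})" "x = h (b k + w)" using sp k by auto
    then show "\<tau> k \<le> x"
      using h \<tau>(1)[OF k] ip_nonneg by (auto intro: real_le_rsqrt)
  qed
  show "0 < lead_dist b k" if "k < d" for k using lead \<tau> that by simp
  have vol: "emeasure (lborel_PiM (e ` {..<k})) (coord_set (e ` {..<k}) (fundamental_domain (b ` {..<k}))) = ennreal (\<Prod>j<k. \<tau> j)"
    if "k \<le> d" for k
    using that
  proof (induction k)
    case 0
    have "coord_set {} (fundamental_domain {}) = {\<lambda>_ :: 'v. undefined :: real}"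
      by (auto simp: coord_set_def fundamental_domain_alt lin_comb_def)
    moreover have "emeasure (lborel_PiM {}) {\<lambda>_ :: 'v. undefined :: real} = 1" by (rule emeasure_PiM_empty)
    ultimately show ?case by simp
  next
    case (Suc k)
    have ek: "e k \<notin> e ` {..<k}" "b k \<notin> b ` {..<k}" using Suc.prems by (auto dest!: inj_onD[OF inj] inj_onD[OF B(2)])
    have im: "e ` {..<Suc k} = insert (e k) (e ` {..<k})" "b ` {..<Suc k} = insert (b k) (b ` {..<k})"
      by (auto simp: lessThan_Suc)
    have "independent (e ` {..<Suc k})"
      using orth Suc.prems by (intro orthonormal_independent) (auto simp: orthonormal_def)
    moreover have "independent (b ` {..<Suc k})"
      using Suc.prems by (intro independent_mono[OF ind]) auto
    moreover have "0 \<le> (\<Prod>j<k. \<tau> j)"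
      using \<tau>(1) Suc.prems by (intro prod_nonneg) (auto simp: less_imp_le)
    ultimately show ?case
      unfolding im using Suc.prems Suc.IH ek sp[of k] \<tau>[of k]
      by (subst emeasure_coord_set_insert[where \<tau> = "\<tau> k" and v = "b k - \<tau> k *\<^sub>R e k"])
        (auto simp: mult.commute simp flip: ennreal_mult)
  qed
  let ?E0 = "e ` {..<d}"
  have ob: "orthonormal_basis h (span M) ?E0"
    using orth spM sp[of d] orthonormal_independent[of ?E0]
    by (auto simp: orthonormal_basis_def polar_inner_eq orthonormal_def)
  \<comment> \<open>The bases selected by \<open>covol\<close> bear no relation to \<open>b\<close>
    and \<open>e\<close>; the two invariance results carry the volume over from one pair to the
    other.\<close>
  define E where "E = (SOME E. orthonormal_basis h (span M) E)"
  define B' where "B' = (SOME B. lattice_basis M B)"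
  have "orthonormal_basis h (span M) E" unfolding E_def by (rule someI) (rule ob)
  then have E: "finite E" "independent E" "span E = span M" "orthonormal E"
    by (auto simp: orthonormal_basis_def polar_inner_eq orthonormal_def)
  have B': "lattice_basis M B'" unfolding B'_def by (rule someI) (rule B(1))
  have "emeasure (lborel_PiM E) (coord_set E (fundamental_domain B')) = emeasure (lborel_PiM E) (coord_set E (fundamental_domain (b ` {..<d})))"
    by (rule fundamental_domains_same_volume[OF B' B(1) E(1-3)])
  also have "\<dots> = emeasure (lborel_PiM ?E0) (coord_set ?E0 (fundamental_domain (b ` {..<d})))"
    using E orth spM sp[of d] ind
    by (intro emeasure_coord_set_orthonormal sets_coord_set_fundamental_domain) auto
  also have "\<dots> = ennreal (\<Prod>j<d. \<tau> j)" by (rule vol) simp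
  finally have em: "emeasure (lborel_PiM E) (coord_set E (fundamental_domain B')) = ennreal (\<Prod>j<d. \<tau> j)" .
  have "0 \<le> (\<Prod>j<d. \<tau> j)" using \<tau>(1) by (intro prod_nonneg) (auto simp: less_imp_le)
  with em have "measure (lborel_PiM E) (coord_set E (fundamental_domain B')) = (\<Prod>j<d. \<tau> j)"
    by (simp add: measure_def)
  moreover have "covol M h = measure (lborel_PiM E) (coord_set E (fundamental_domain B'))"
    unfolding covol_def covol_wrt_def E_def[symmetric] B'_def[symmetric] coord_set_def lin_comb_def by simp
  ultimately show "covol M h = (\<Prod>k<d. lead_dist b k)"
    using lead by simp
qed

end

section \<open>Monomials and superadditive functions\<close>

abbreviation lk :: "('a \<Rightarrow>\<^sub>0 'b::zero) \<Rightarrow> 'a \<Rightarrow> 'b" where "lk \<equiv> Poly_Mapping.lookup"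

definition mon_degree :: "('n::finite \<Rightarrow>\<^sub>0 nat) \<Rightarrow> nat" where
  "mon_degree \<alpha> = (\<Sum>i\<in>UNIV. lk \<alpha> i)"

definition monomials :: "nat \<Rightarrow> ('n::finite \<Rightarrow>\<^sub>0 nat) set" where
  "monomials n = {\<alpha>. mon_degree \<alpha> = n}"

lemma mon_degree_add: "mon_degree (\<alpha> + \<beta>) = mon_degree \<alpha> + mon_degree \<beta>"
  by (simp add: mon_degree_def lookup_add sum.distrib)

lemma lookup_le_mon_degree: "lk \<alpha> i \<le> mon_degree \<alpha>"
  unfolding mon_degree_def by (rule member_le_sum) auto

lemma lookup_Abs_finite [simp]: "lk (Abs_poly_mapping (f :: 'n::finite \<Rightarrow> nat)) = f"
  by (rule lookup_Abs_poly_mapping) simp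

text \<open>The degree determines the exponent of \<open>i0\<close> from the others. This single
  dropped coordinate is why the number of monomials is of order \<open>n ^ l\<close>.\<close>

lemma monomials_inj_on_restrict:
  fixes i0 :: "'n::finite"
  shows "inj_on (\<lambda>\<alpha>. restrict (lk \<alpha>) (- {i0})) (monomials n)"
proof (rule inj_onI, rule poly_mapping_eqI)
  fix \<alpha> \<beta> :: "'n \<Rightarrow>\<^sub>0 nat" and j
  assume a: "\<alpha> \<in> monomials n" "\<beta> \<in> monomials n" and eq: "restrict (lk \<alpha>) (- {i0}) = restrict (lk \<beta>) (- {i0})"
  have ne: "lk \<alpha> j = lk \<beta> j" if "j \<noteq> i0" for j
    using fun_cong[OF eq, of j] that by simp
  have "mon_degree \<gamma> = lk \<gamma> i0 + (\<Sum>j\<in>- {i0}. lk \<gamma> j)" for \<gamma> :: "'n \<Rightarrow>\<^sub>0 nat"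
    unfolding mon_degree_def by (subst sum.remove[of _ i0]) (auto simp: Compl_eq_Diff_UNIV)
  from this[of \<alpha>] this[of \<beta>] have "lk \<alpha> i0 = lk \<beta> i0"
    using a sum.cong[of "- {i0}" "- {i0}" "lk \<alpha>" "lk \<beta>"] ne by (simp add: monomials_def)
  then show "lk \<alpha> j = lk \<beta> j" using ne by (cases "j = i0") auto
qed

lemma monomials_restrict_subset:
  "(\<lambda>\<alpha>. restrict (lk \<alpha>) (- {i0})) ` monomials n \<subseteq> (- {i0}) \<rightarrow>\<^sub>E {..n}"
  by (auto simp: monomials_def lookup_le_mon_degree PiE_iff split: if_splits)

lemma finite_monomials [simp]: "finite (monomials n :: ('n::finite \<Rightarrow>\<^sub>0 nat) set)"
proof -
  have "finite ((- {i0 :: 'n}) \<rightarrow>\<^sub>E {..n})" for i0 by (intro finite_PiE) auto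
  then show ?thesis
    using monomials_inj_on_restrict monomials_restrict_subset by (metis finite_imageD finite_subset)
qed

lemma card_monomials_le:
  assumes "CARD('n) = l + 1"
  shows "card (monomials n :: ('n::finite \<Rightarrow>\<^sub>0 nat) set) \<le> (n + 1) ^ l"
proof -
  fix i0 :: 'n
  have "card (monomials n :: ('n \<Rightarrow>\<^sub>0 nat) set) \<le> card ((- {i0}) \<rightarrow>\<^sub>E {..n})"
    by (rule card_inj_on_le[OF monomials_inj_on_restrict monomials_restrict_subset]) (intro finite_PiE; simp)
  also have "\<dots> = (n + 1) ^ l"
    using assms by (subst card_PiE) (auto simp: Compl_eq_Diff_UNIV card_Diff_singleton)
  finally show ?thesis .
qed

lemma monomials_nonempty: "monomials n \<noteq> ({} :: ('n::finite \<Rightarrow>\<^sub>0 nat) set)"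
proof -
  fix i0 :: 'n
  have "Poly_Mapping.single i0 n \<in> monomials n"
    by (simp add: monomials_def mon_degree_def lookup_single when_def)
  then show ?thesis by blast
qed

text \<open>
  The cubes of side \<open>q\<close> at the points \<open>q \<beta>\<close> with \<open>|\<beta>| = k\<close>, taken in all coordinates but \<open>i0\<close>, are
  disjoint, and since \<open>m \<ge> q (k + l)\<close> they lie inside the simplex of the monomials of degree \<open>m\<close>.
\<close>

lemma superadditive_sum_monomials:
  fixes g :: "('n::finite \<Rightarrow>\<^sub>0 nat) \<Rightarrow> real"
  assumes L: "CARD('n) = l + 1"
    and super: "\<And>\<alpha> \<beta>. g \<alpha> + g \<beta> \<le> g (\<alpha> + \<beta>)" and nonneg: "\<And>\<alpha>. 0 \<le> g \<alpha>"
    and m: "q * (k + l) \<le> m"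
  shows "real q ^ (l + 1) * (\<Sum>\<beta>\<in>monomials k. g \<beta>) \<le> (\<Sum>\<alpha>\<in>monomials m. g \<alpha>)"
proof -
  fix i0 :: 'n
  let ?J = "- {i0}"
  let ?D = "monomials k \<times> (?J \<rightarrow>\<^sub>E {..<q})"
  have cJ: "card ?J = l" using L by (simp add: Compl_eq_Diff_UNIV card_Diff_singleton)
  define s where "s \<beta> c = (\<Sum>j\<in>?J. q * lk \<beta> j + c j)" for \<beta> :: "'n \<Rightarrow>\<^sub>0 nat" and c
  \<comment> \<open>The point \<open>c\<close> of the cube at \<open>q \<beta>\<close>; the exponent
    of \<open>i0\<close> takes up whatever is missing to the degree \<open>m\<close>.\<close>
  define A where "A = (\<lambda>(\<beta>, c). Abs_poly_mapping (\<lambda>j. if j = i0 then m - s \<beta> c else q * lk \<beta> j + c j))"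
  have split: "(\<Sum>j\<in>UNIV. f j) = f i0 + (\<Sum>j\<in>?J. f j)" for f :: "'n \<Rightarrow> nat"
    by (subst sum.remove[of _ i0]) (auto simp: Compl_eq_Diff_UNIV)
  have bound: "s \<beta> c + q * lk \<beta> i0 \<le> m" if "(\<beta>, c) \<in> ?D" for \<beta> c
  proof -
    have "(\<Sum>j\<in>?J. c j) \<le> (\<Sum>j\<in>?J. q)"
      using that by (intro sum_mono) (auto simp: less_imp_le PiE_def Pi_def)
    then have "(\<Sum>j\<in>?J. c j) \<le> q * l" using cJ by (simp add: mult.commute)
    moreover have "q * mon_degree \<beta> = q * lk \<beta> i0 + q * (\<Sum>j\<in>?J. lk \<beta> j)"
      unfolding mon_degree_def by (subst split) (simp add: distrib_left)
    moreover have "mon_degree \<beta> = k" using that by (auto simp: monomials_def)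
    ultimately show ?thesis
      using m by (simp add: s_def sum.distrib sum_distrib_left distrib_left)
  qed
  have A_monomials: "A (\<beta>, c) \<in> monomials m" if "(\<beta>, c) \<in> ?D" for \<beta> c
  proof -
    have "mon_degree (A (\<beta>, c)) = (m - s \<beta> c) + s \<beta> c"
      unfolding mon_degree_def by (subst split) (auto simp: A_def s_def intro!: sum.cong)
    then show ?thesis using bound[OF that] by (simp add: monomials_def)
  qed
  have inj: "inj_on A ?D"
  proof (rule inj_onI, clarify)
    fix \<beta> c \<beta>' c'
    assume D: "\<beta> \<in> monomials k" "c \<in> ?J \<rightarrow>\<^sub>E {..<q}" "\<beta>' \<in> monomials k" "c' \<in> ?J \<rightarrow>\<^sub>E {..<q}" and eq: "A (\<beta>, c) = A (\<beta>', c')"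
    have j: "lk \<beta> j = lk \<beta>' j \<and> c j = c' j" if "j \<noteq> i0" for j
    proof -
      have "q * lk \<beta> j + c j = q * lk \<beta>' j + c' j"
        using arg_cong[OF eq, of "\<lambda>x. lk x j"] that by (simp add: A_def)
      moreover have "c j < q" "c' j < q" using D that by auto
      moreover have "(q * x + y) div q = x \<and> (q * x + y) mod q = y" if "y < q" for x y
        using that by simp
      ultimately show ?thesis by metis
    qed
    have "restrict (lk \<beta>) ?J = restrict (lk \<beta>') ?J" using j by auto
    then have "\<beta> = \<beta>'" using inj_onD[OF monomials_inj_on_restrict[of i0 k]] D by blast
    moreover have "c = c'" using D j by (intro PiE_ext[of c ?J]) auto
    ultimately show "\<beta> = \<beta>' \<and> c = c'" ..
  qed
  have mult: "real t * g \<beta> \<le> g (Abs_poly_mapping (\<lambda>j. t * lk \<beta> j))" for t \<beta>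
  proof (induction t)
    case 0
    then show ?case using nonneg by simp
  next
    case (Suc t)
    have "Abs_poly_mapping (\<lambda>j. Suc t * lk \<beta> j) = \<beta> + Abs_poly_mapping (\<lambda>j. t * lk \<beta> j)"
      by (rule poly_mapping_eqI) (simp add: lookup_add)
    then show ?case
      using Suc super[of \<beta> "Abs_poly_mapping (\<lambda>j. t * lk \<beta> j)"] by (simp add: algebra_simps)
  qed
  have gA: "real q * g \<beta> \<le> g (A (\<beta>, c))" if D: "(\<beta>, c) \<in> ?D" for \<beta> c
  proof -
    \<comment> \<open>The point is \<open>q \<beta>\<close> plus a remainder with nonnegative
      exponents, on which \<open>g\<close> is nonnegative; superadditivity can then discard the
      remainder.\<close>
    let ?q = "Abs_poly_mapping (\<lambda>j. q * lk \<beta> j)"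
    let ?\<gamma> = "Abs_poly_mapping (\<lambda>j. if j = i0 then m - s \<beta> c - q * lk \<beta> i0 else c j)"
    have "A (\<beta>, c) = ?q + ?\<gamma>"
      by (rule poly_mapping_eqI) (use bound[OF D] in \<open>auto simp: lookup_add A_def\<close>)
    then show ?thesis using mult[of q \<beta>] super[of ?q ?\<gamma>] nonneg[of ?\<gamma>] by simp
  qed
  \<comment> \<open>Each \<beta> owns \<open>q ^ l\<close> points, each worth at least
    \<open>q * g \<beta>\<close>, hence the exponent \<open>l + 1\<close>.\<close>
  have "real q ^ (l + 1) * (\<Sum>\<beta>\<in>monomials k. g \<beta>) = (\<Sum>\<beta>\<in>monomials k. \<Sum>c\<in>?J \<rightarrow>\<^sub>E {..<q}. real q * g \<beta>)"
    using cJ by (simp add: card_PiE sum_distrib_left[symmetric] sum_distrib_right[symmetric] algebra_simps)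
  also have "\<dots> = (\<Sum>(\<beta>, c)\<in>?D. real q * g \<beta>)"
    by (rule sum.cartesian_product)
  also have "\<dots> \<le> (\<Sum>p\<in>?D. g (A p))"
    by (rule sum_mono) (use gA in auto)
  also have "\<dots> = (\<Sum>\<alpha>\<in>A ` ?D. g \<alpha>)"
    by (simp add: sum.reindex[OF inj])
  also have "\<dots> \<le> (\<Sum>\<alpha>\<in>monomials m. g \<alpha>)"
    using A_monomials nonneg by (intro sum_mono2) auto
  finally show ?thesis .
qed

lemma tendsto_div_over: "0 < c \<Longrightarrow> (\<lambda>m. real (m div c) / real m) \<longlonglongrightarrow> 1 / real c"
proof (rule tendsto_sandwich)
  assume c: "0 < c"
  show "\<forall>\<^sub>F m in sequentially. 1 / real c - 1 / real m \<le> real (m div c) / real m"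
    using eventually_gt_at_top[of 0]
  proof eventually_elim
    case (elim m)
    have "m < c * (m div c) + c" using c by (metis add.commute mod_less_divisor mult_div_mod_eq nat_add_left_cancel_less)
    then have "real m \<le> real c * real (m div c) + real c" by (metis less_imp_le of_nat_add of_nat_le_iff of_nat_mult)
    then have "(real m - real c) / (real c * real m) \<le> real c * real (m div c) / (real c * real m)"
      by (intro divide_right_mono) auto
    moreover have "1 / real c - 1 / real m = (real m - real c) / (real c * real m)"
      using c elim by (simp add: field_simps)
    ultimately show ?case using c by simp
  qed
  show "\<forall>\<^sub>F m in sequentially. real (m div c) / real m \<le> 1 / real c"
    using eventually_gt_at_top[of 0]
  proof eventually_elim
    case (elim m)
    have "real (m div c) * real c \<le> real m" by (metis div_times_less_eq_dividend of_nat_le_iff of_nat_mult)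
    then show ?case using c elim by (simp add: field_simps)
  qed
  show "(\<lambda>m. 1 / real c - 1 / real m) \<longlonglongrightarrow> 1 / real c"
    using tendsto_diff[OF tendsto_const[of "1 / real c"] lim_1_over_n[where 'a = real]] by simp
qed simp

text \<open>A form of Fekete's lemma in several variables. Taking \<open>q = m div (k + l)\<close>
  in the cube estimate and letting m grow bounds the liminf below by the normalised sum of degree k,
  up to the factor \<open>(k / (k + l)) ^ (l + 1)\<close>. That factor tends to 1 with k, so limsup
  \<le> liminf.\<close>

lemma superadditive_nonneg_limit:
  fixes g :: "('n::finite \<Rightarrow>\<^sub>0 nat) \<Rightarrow> real"
  assumes L: "CARD('n) = l + 1"
    and super: "\<And>\<alpha> \<beta>. g \<alpha> + g \<beta> \<le> g (\<alpha> + \<beta>)" and nonneg: "\<And>\<alpha>. 0 \<le> g \<alpha>"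
  shows "\<exists>\<Lambda>. (\<lambda>n. ereal ((\<Sum>\<alpha>\<in>monomials n. g \<alpha>) / real n ^ (l + 1))) \<longlonglongrightarrow> \<Lambda>"
proof -
  define S where "S n = (\<Sum>\<alpha>\<in>monomials n. g \<alpha>)" for n
  let ?A = "\<lambda>n. ereal (S n / real n ^ (l + 1))"
  have S0: "0 \<le> S n" for n unfolding S_def by (intro sum_nonneg nonneg)
  have low: "ereal (S k / real (k + l) ^ (l + 1)) \<le> liminf ?A" if k: "0 < k" for k
  proof -
    have "(\<lambda>m. (real (m div (k + l)) / real m) ^ (l + 1) * S k) \<longlonglongrightarrow> (1 / real (k + l)) ^ (l + 1) * S k"
      using k by (intro tendsto_intros tendsto_div_over) auto
    then have lim: "liminf (\<lambda>m. ereal ((real (m div (k + l)) / real m) ^ (l + 1) * S k)) = ereal ((1 / real (k + l)) ^ (l + 1) * S k)"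
      by (intro lim_imp_Liminf) auto
    have "ereal ((real (m div (k + l)) / real m) ^ (l + 1) * S k) \<le> ?A m" for m
    proof -
      have "real (m div (k + l)) ^ (l + 1) * S k \<le> S m"
        unfolding S_def by (rule superadditive_sum_monomials[OF L super nonneg]) simp
      then show ?thesis by (simp add: power_divide divide_right_mono)
    qed
    then have "liminf (\<lambda>m. ereal ((real (m div (k + l)) / real m) ^ (l + 1) * S k)) \<le> liminf ?A"
      by (intro Liminf_mono always_eventually) auto
    then show ?thesis unfolding lim by (simp add: power_divide)
  qed
  have fac: "(\<lambda>k. (real k / real (k + l)) ^ (l + 1)) \<longlonglongrightarrow> 1 ^ (l + 1)"
    by (intro tendsto_power) real_asymp
  have "limsup ?A = limsup (\<lambda>k. ereal ((real k / real (k + l)) ^ (l + 1)) * ?A k)"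
    using fac by (subst ereal_limsup_lim_mult[where a = 1]) (auto simp: one_ereal_def)
  also have "\<dots> \<le> liminf ?A"
  proof (rule Limsup_bounded)
    show "\<forall>\<^sub>F k in sequentially. ereal ((real k / real (k + l)) ^ (l + 1)) * ?A k \<le> liminf ?A"
      using eventually_gt_at_top[of 0]
    proof eventually_elim
      case (elim k)
      then have "(real k / real (k + l)) ^ (l + 1) * (S k / real k ^ (l + 1)) = S k / real (k + l) ^ (l + 1)"
        by (simp add: power_divide)
      then show ?case using low[OF elim] by simp
    qed
  qed
  finally have "?A \<longlonglongrightarrow> limsup ?A"
    using Liminf_le_Limsup[of sequentially ?A] by (intro Liminf_eq_Limsup) auto
  then show ?thesis unfolding S_def by blast
qed

lemma card_monomials_bound:
  assumes "CARD('n) = l + 1" "0 < n"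
  shows "real (card (monomials n :: ('n::finite \<Rightarrow>\<^sub>0 nat) set)) \<le> 2 ^ l * real n ^ l"
proof -
  have "real (card (monomials n :: ('n \<Rightarrow>\<^sub>0 nat) set)) \<le> real ((n + 1) ^ l)"
    using card_monomials_le[OF assms(1), of n] of_nat_le_iff by blast
  also have "\<dots> \<le> (2 * real n) ^ l"
    unfolding of_nat_power using assms(2) by (intro power_mono) auto
  finally show ?thesis by (simp add: power_mult_distrib)
qed

text \<open>Adding a multiple of the degree, which is additive, makes \<open>g\<close> nonnegative
  without spoiling superadditivity. The normalised sums of the degree itself converge to a finite
  limit, since there are at most \<open>2 ^ l * n ^ l\<close> monomials, so the correction can be
  subtracted again.\<close>

theorem superadditive_limit:
  fixes g :: "('n::finite \<Rightarrow>\<^sub>0 nat) \<Rightarrow> real"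
  assumes L: "CARD('n) = l + 1"
    and super: "\<And>\<alpha> \<beta>. g \<alpha> + g \<beta> \<le> g (\<alpha> + \<beta>)" and lower: "\<And>\<alpha>. - C * real (mon_degree \<alpha>) \<le> g \<alpha>"
  shows "\<exists>\<Lambda>. \<Lambda> \<noteq> -\<infinity> \<and> (\<lambda>n. ereal ((\<Sum>\<alpha>\<in>monomials n. g \<alpha>) / real n ^ (l + 1))) \<longlonglongrightarrow> \<Lambda>"
proof -
  let ?d = "\<lambda>n. (\<Sum>\<alpha>\<in>monomials n. real (mon_degree (\<alpha> :: 'n \<Rightarrow>\<^sub>0 nat))) / real n ^ (l + 1)"
  obtain D where D: "(\<lambda>n. ereal (?d n)) \<longlonglongrightarrow> D"
    using superadditive_nonneg_limit[OF L, of "\<lambda>\<alpha>. real (mon_degree \<alpha>)"] by (auto simp: mon_degree_add)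
  have "?d n \<le> 2 ^ l" if "0 < n" for n
  proof -
    have "(\<Sum>\<alpha>\<in>monomials n. real (mon_degree (\<alpha> :: 'n \<Rightarrow>\<^sub>0 nat))) = real n * real (card (monomials n :: ('n \<Rightarrow>\<^sub>0 nat) set))"
      by (simp add: monomials_def mult.commute)
    also have "\<dots> \<le> real n * (2 ^ l * real n ^ l)"
      by (intro mult_left_mono card_monomials_bound[OF L that]) simp
    finally show ?thesis using that by (simp add: field_simps)
  qed
  then have "D \<le> ereal (2 ^ l)"
    by (intro Lim_bounded[OF D, of 1]) auto
  moreover have "0 \<le> D"
    by (intro Lim_bounded2[OF D, of 0]) (auto intro!: divide_nonneg_nonneg sum_nonneg)
  ultimately obtain D' where D': "D = ereal D'" by (cases D) auto
  define C' where "C' = max C 0"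
  define G where "G \<alpha> = g \<alpha> + C' * real (mon_degree \<alpha>)" for \<alpha>
  have "G \<alpha> + G \<beta> \<le> G (\<alpha> + \<beta>)" for \<alpha> \<beta>
    using super[of \<alpha> \<beta>] by (simp add: G_def mon_degree_add algebra_simps)
  moreover have "0 \<le> G \<alpha>" for \<alpha>
  proof -
    have "C * real (mon_degree \<alpha>) \<le> C' * real (mon_degree \<alpha>)" unfolding C'_def by (intro mult_right_mono) auto
    then show ?thesis using lower[of \<alpha>] by (simp add: G_def)
  qed
  ultimately obtain E where E: "(\<lambda>n. ereal ((\<Sum>\<alpha>\<in>monomials n. G \<alpha>) / real n ^ (l + 1))) \<longlonglongrightarrow> E"
    and E0: "0 \<le> E"
  proof -
    assume *: "\<And>\<alpha> \<beta>. G \<alpha> + G \<beta> \<le> G (\<alpha> + \<beta>)" "\<And>\<alpha>. 0 \<le> G \<alpha>"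
      and **: "\<And>E. (\<lambda>n. ereal ((\<Sum>\<alpha>\<in>monomials n. G \<alpha>) / real n ^ (l + 1))) \<longlonglongrightarrow> E \<Longrightarrow> 0 \<le> E \<Longrightarrow> thesis"
    obtain E where E: "(\<lambda>n. ereal ((\<Sum>\<alpha>\<in>monomials n. G \<alpha>) / real n ^ (l + 1))) \<longlonglongrightarrow> E"
      using superadditive_nonneg_limit[OF L *] by blast
    have "0 \<le> E" using *(2) by (intro Lim_bounded2[OF E, of 0]) (auto intro!: divide_nonneg_nonneg sum_nonneg)
    with E ** show thesis by blast
  qed
  have eq: "(\<Sum>\<alpha>\<in>monomials n. g \<alpha>) / real n ^ (l + 1) = (\<Sum>\<alpha>\<in>monomials n. G \<alpha>) / real n ^ (l + 1) + (- C') * ?d n" for n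
  proof -
    have "(\<Sum>\<alpha>\<in>monomials n. G \<alpha>) = (\<Sum>\<alpha>\<in>monomials n. g \<alpha>) + C' * (\<Sum>\<alpha>\<in>monomials n. real (mon_degree (\<alpha> :: 'n \<Rightarrow>\<^sub>0 nat)))"
      by (simp add: G_def sum.distrib sum_distrib_left)
    then show ?thesis by (simp add: add_divide_distrib)
  qed
  have "(\<lambda>n. (- C') * ?d n) \<longlonglongrightarrow> (- C') * D'"
    using D unfolding D' by (intro tendsto_mult tendsto_const) simp
  then have "(\<lambda>n. ereal ((\<Sum>\<alpha>\<in>monomials n. G \<alpha>) / real n ^ (l + 1)) + ereal ((- C') * ?d n)) \<longlonglongrightarrow> E + ereal ((- C') * D')"
    using E E0 by (intro tendsto_add_ereal_general) auto
  then have "(\<lambda>n. ereal ((\<Sum>\<alpha>\<in>monomials n. g \<alpha>) / real n ^ (l + 1))) \<longlonglongrightarrow> E + ereal ((- C') * D')"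
    unfolding eq by simp
  moreover have "E + ereal ((- C') * D') \<noteq> -\<infinity>" using E0 by (cases E) auto
  ultimately show ?thesis by blast
qed

section \<open>A total monomial order compatible with products\<close>

definition mon_prime :: "'n::finite \<Rightarrow> nat" where
  "mon_prime = (SOME p. inj p \<and> (\<forall>i. prime (p i)))"

text \<open>The index type carries no order, so the assignment of distinct primes to the variables
  is an arbitrary choice; infinitely many primes leave room for it.\<close>

lemma mon_prime: "inj (mon_prime :: 'n::finite \<Rightarrow> nat)" "prime (mon_prime (i :: 'n))"
proof -
  obtain B :: "nat set" where B: "finite B" "card B = CARD('n)" "B \<subseteq> {p. prime p}"
    using infinite_arbitrarily_large[OF primes_infinite, of "CARD('n)"] by blast
  then obtain p where "bij_betw p (UNIV :: 'n set) B"
    using finite_same_card_bij[of "UNIV :: 'n set" B] by auto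
  then have "inj p \<and> (\<forall>i. prime (p i))" using B(3) by (auto simp: bij_betw_def)
  then have "inj (mon_prime :: 'n \<Rightarrow> nat) \<and> (\<forall>i :: 'n. prime (mon_prime i))"
    unfolding mon_prime_def
    by (rule someI[where P = "\<lambda>p. inj p \<and> (\<forall>i. prime (p i))"])
  then show "inj (mon_prime :: 'n \<Rightarrow> nat)" "prime (mon_prime (i :: 'n))" by auto
qed

text \<open>By unique factorization, comparing these numbers is a total monomial order.\<close>

definition mon_rank :: "('n::finite \<Rightarrow>\<^sub>0 nat) \<Rightarrow> nat" where
  "mon_rank \<alpha> = (\<Prod>i\<in>UNIV. mon_prime i ^ lk \<alpha> i)"

text \<open>Multiplicativity makes the order compatible with multiplication of monomials, so that
  leading monomials multiply.\<close>

lemma mon_rank_add: "mon_rank (\<alpha> + \<beta>) = mon_rank \<alpha> * mon_rank \<beta>"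
  by (simp add: mon_rank_def lookup_add power_add prod.distrib)

lemma mon_rank_pos: "0 < mon_rank \<alpha>"
  unfolding mon_rank_def by (intro prod_pos) (simp add: mon_prime prime_gt_0_nat)

lemma mon_rank_inj: "inj (mon_rank :: ('n::finite \<Rightarrow>\<^sub>0 nat) \<Rightarrow> nat)"
proof (rule injI, rule poly_mapping_eqI)
  fix \<alpha> \<beta> :: "'n \<Rightarrow>\<^sub>0 nat" and i
  assume eq: "mon_rank \<alpha> = mon_rank \<beta>"
  have "multiplicity (mon_prime i) (mon_rank \<gamma>) = lk \<gamma> i" for \<gamma> :: "'n \<Rightarrow>\<^sub>0 nat"
  proof -
    have "mon_rank \<gamma> = (\<Prod>p\<in>range (mon_prime :: 'n \<Rightarrow> nat). p ^ lk \<gamma> (inv mon_prime p))"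
      unfolding mon_rank_def by (subst prod.reindex) (auto simp: mon_prime inv_f_f)
    also have "multiplicity (mon_prime i) \<dots> = lk \<gamma> i"
      by (subst multiplicity_prod_prime_powers) (auto simp: mon_prime inv_f_f)
    finally show ?thesis .
  qed
  from this[of \<alpha>] this[of \<beta>] show "lk \<alpha> i = lk \<beta> i" using eq by simp
qed

text \<open>Provides the increasing numbering of the monomial basis that a formula for bases indexed
  by \<open>{..<d}\<close> asks for.\<close>

lemma monomials_enum:
  obtains a where "bij_betw a {..<card (monomials n :: ('n::finite \<Rightarrow>\<^sub>0 nat) set)} (monomials n :: ('n \<Rightarrow>\<^sub>0 nat) set)"
    "\<And>j k. j < card (monomials n :: ('n \<Rightarrow>\<^sub>0 nat) set) \<Longrightarrow> k < card (monomials n :: ('n \<Rightarrow>\<^sub>0 nat) set) \<Longrightarrow> mon_rank (a j) < mon_rank (a k) \<longleftrightarrow> j < k"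
proof -
  let ?M = "monomials n :: ('n \<Rightarrow>\<^sub>0 nat) set"
  have inj: "inj_on mon_rank ?M" using mon_rank_inj by (rule inj_on_subset) simp
  have card: "card (mon_rank ` ?M) = card ?M" by (rule card_image[OF inj])
  have "finite (mon_rank ` ?M)" by simp
  then obtain f where "bij_betw f {..<card (mon_rank ` ?M)} (mon_rank ` ?M)" "strict_mono_on {..<card (mon_rank ` ?M)} f"
    by (rule ex_bij_betw_strict_mono_card)
  then have f: "bij_betw f {..<card ?M} (mon_rank ` ?M)" and mono: "strict_mono_on {..<card ?M} f"
    unfolding card by auto
  let ?a = "inv_into ?M mon_rank \<circ> f"
  have bij: "bij_betw ?a {..<card ?M} ?M"
    using bij_betw_trans[OF f bij_betw_inv_into[OF inj_on_imp_bij_betw[OF inj]]] .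
  have rank: "mon_rank (?a k) = f k" if "k < card ?M" for k
  proof -
    have "f k \<in> mon_rank ` ?M" using f that by (auto simp: bij_betw_def)
    then show ?thesis by (simp add: f_inv_into_f)
  qed
  show thesis
  proof (rule that[OF bij])
    fix j k assume "j < card ?M" "k < card ?M"
    then show "mon_rank (?a j) < mon_rank (?a k) \<longleftrightarrow> j < k"
      unfolding rank[OF \<open>j < _\<close>] rank[OF \<open>k < _\<close>]
      using strict_mono_on_less[OF mono, of j k] by simp
  qed
qed

section \<open>Values of homogeneous components\<close>

definition monom_val :: "('n::finite \<Rightarrow>\<^sub>0 nat) \<Rightarrow> complex ^ 'n \<Rightarrow> complex" where
  "monom_val \<alpha> v = (\<Prod>i\<in>UNIV. (v $ i) ^ lk \<alpha> i)"

text \<open>The homogeneous component of degree \<open>n\<close> as a function; it is never formed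
  as a polynomial.\<close>

definition comp_val :: "nat \<Rightarrow> 'n::finite cpoly \<Rightarrow> complex ^ 'n \<Rightarrow> complex" where
  "comp_val n P v = (\<Sum>\<alpha>\<in>monomials n. lk P \<alpha> * monom_val \<alpha> v)"

lemma lookup_scaleR [simp]: "lk (r *\<^sub>R P) \<alpha> = r *\<^sub>R lk P \<alpha>"
  unfolding scaleR_poly_mapping_def by (subst lookup_Abs_poly_mapping) (auto intro: finite_subset[OF _ finite_lookup[of P]])

lemma monom_val_add: "monom_val (\<alpha> + \<beta>) v = monom_val \<alpha> v * monom_val \<beta> v"
  by (simp add: monom_val_def lookup_add power_add prod.distrib)

lemma monom_val_scale: "monom_val \<alpha> (c *s v) = c ^ mon_degree \<alpha> * monom_val \<alpha> v"
  by (simp add: monom_val_def mon_degree_def power_mult_distrib prod.distrib power_sum)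

lemma comp_val_scale: "comp_val n P (c *s v) = c ^ n * comp_val n P v"
  unfolding comp_val_def sum_distrib_left by (intro sum.cong) (auto simp: monom_val_scale monomials_def)

lemma poly_eval_superset:
  assumes "finite A" "Poly_Mapping.keys P \<subseteq> A"
  shows "poly_eval P v = (\<Sum>\<alpha>\<in>A. lk P \<alpha> * monom_val \<alpha> v)"
  unfolding poly_eval_def monom_val_def using assms by (intro sum.mono_neutral_left) (auto simp: in_keys_iff)

lemma poly_eval_add: "poly_eval (P + Q) v = poly_eval P v + poly_eval Q v"
proof -
  let ?A = "Poly_Mapping.keys P \<union> Poly_Mapping.keys Q"
  have "Poly_Mapping.keys (P + Q) \<subseteq> ?A" by (rule keys_add)
  then show ?thesis
    by (simp add: poly_eval_superset[of ?A] lookup_add distrib_right sum.distrib)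
qed

lemma poly_eval_zero [simp]: "poly_eval 0 v = 0"
  by (simp add: poly_eval_def)

lemma poly_eval_single: "poly_eval (Poly_Mapping.single \<alpha> c) v = c * monom_val \<alpha> v"
  by (subst poly_eval_superset[of "{\<alpha>}"]) (auto simp: lookup_single)

lemma poly_eval_sum: "poly_eval (\<Sum>x\<in>A. f x) v = (\<Sum>x\<in>A. poly_eval (f x) v)"
  by (induction A rule: infinite_finite_induct) (auto simp: poly_eval_add)

lemma poly_as_sum_single: "P = (\<Sum>\<alpha>\<in>Poly_Mapping.keys P. Poly_Mapping.single \<alpha> (lk P \<alpha>))"
proof (rule poly_mapping_eqI)
  fix \<beta>
  show "lk P \<beta> = lk (\<Sum>\<alpha>\<in>Poly_Mapping.keys P. Poly_Mapping.single \<alpha> (lk P \<alpha>)) \<beta>"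
    by (simp add: lookup_sum lookup_single when_def in_keys_iff)
qed

lemma poly_eval_mult: "poly_eval (P * Q) v = poly_eval P v * poly_eval Q v"
proof -
  let ?s = "\<lambda>P \<alpha>. Poly_Mapping.single \<alpha> (lk P \<alpha>)"
  have "P * Q = (\<Sum>\<alpha>\<in>Poly_Mapping.keys P. \<Sum>\<beta>\<in>Poly_Mapping.keys Q. ?s P \<alpha> * ?s Q \<beta>)"
    by (subst poly_as_sum_single[of P], subst poly_as_sum_single[of Q]) (simp add: sum_product)
  then have "poly_eval (P * Q) v = (\<Sum>\<alpha>\<in>Poly_Mapping.keys P. \<Sum>\<beta>\<in>Poly_Mapping.keys Q. (lk P \<alpha> * monom_val \<alpha> v) * (lk Q \<beta> * monom_val \<beta> v))"
    by (simp add: poly_eval_sum mult_single poly_eval_single monom_val_add algebra_simps)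
  also have "\<dots> = poly_eval P v * poly_eval Q v"
    by (simp add: poly_eval_superset[of "Poly_Mapping.keys P" P] poly_eval_superset[of "Poly_Mapping.keys Q" Q] sum_product)
  finally show ?thesis .
qed

lemma homogeneous_iff: "homogeneous n P \<longleftrightarrow> Poly_Mapping.keys P \<subseteq> monomials n"
  by (auto simp: homogeneous_def monomials_def mon_degree_def)

lemma comp_val_homogeneous: "homogeneous n P \<Longrightarrow> comp_val n P v = poly_eval P v"
  unfolding comp_val_def homogeneous_iff by (rule poly_eval_superset[symmetric]) auto

lemma poly_eval_eq_sum_comp_val:
  fixes P :: "'n::finite cpoly"
  assumes "finite A" "mon_degree ` Poly_Mapping.keys P \<subseteq> A"
  shows "poly_eval P v = (\<Sum>n\<in>A. comp_val n P v)"
proof -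
  have "poly_eval P v = (\<Sum>\<alpha>\<in>(\<Union>n\<in>A. monomials n). lk P \<alpha> * monom_val \<alpha> v)"
  proof (rule poly_eval_superset)
    show "finite (\<Union>n\<in>A. monomials n :: ('n \<Rightarrow>\<^sub>0 nat) set)" using assms by simp
  qed (use assms in \<open>auto simp: monomials_def\<close>)
  also have "\<dots> = (\<Sum>n\<in>A. comp_val n P v)"
  proof (unfold comp_val_def, rule sum.UNION_disjoint)
    show "\<forall>i\<in>A. finite (monomials i :: ('n \<Rightarrow>\<^sub>0 nat) set)" by simp
  qed (use assms in \<open>auto simp: monomials_def\<close>)
  finally show ?thesis .
qed

lemma comp_val_eq_0: "n \<notin> mon_degree ` Poly_Mapping.keys P \<Longrightarrow> comp_val n P v = 0"
  unfolding comp_val_def by (intro sum.neutral) (auto simp: monomials_def in_keys_iff)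

lemma comp_val_add: "comp_val n (P + Q) v = comp_val n P v + comp_val n Q v"
  by (simp add: comp_val_def lookup_add distrib_right sum.distrib)

lemma lookup_single_0_mult: "lk (Poly_Mapping.single 0 c * P) \<alpha> = c * lk P \<alpha>"
proof -
  have "Poly_Mapping.single 0 c * P = Poly_Mapping.map ((*) c) P"
    by (simp add: mult_map_scale_conv_mult)
  then show ?thesis by (simp add: Poly_Mapping.map.rep_eq when_def)
qed

lemma comp_val_cmult: "comp_val n (Poly_Mapping.single 0 c * P) v = c * comp_val n P v"
  by (simp add: comp_val_def lookup_single_0_mult sum_distrib_left mult.assoc)

lemma scaleR_eq_single_mult: "r *\<^sub>R P = Poly_Mapping.single 0 (complex_of_real r) * P"
  by (rule poly_mapping_eqI) (simp add: lookup_single_0_mult scaleR_conv_of_real)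

lemma comp_val_cnj: "comp_val n (Poly_Mapping.map cnj P) v = cnj (comp_val n P (vec_cnj v))"
proof -
  have "lk (Poly_Mapping.map cnj P) \<alpha> = cnj (lk P \<alpha>)" for \<alpha>
    by (simp add: Poly_Mapping.map.rep_eq when_def)
  then show ?thesis by (simp add: comp_val_def monom_val_def vec_cnj_def)
qed

lemma vec_cnj_cnj [simp]: "vec_cnj (vec_cnj v) = v"
  by (simp add: vec_cnj_def vec_eq_iff)

lemma continuous_monom_val: "continuous_on S (monom_val \<alpha>)"
  unfolding monom_val_def by (intro continuous_intros)

lemma continuous_comp_val: "continuous_on S (comp_val n P)"
proof -
  have "continuous_on S (\<lambda>v. \<Sum>\<alpha>\<in>monomials n. lk P \<alpha> * monom_val \<alpha> v)"
    by (intro continuous_intros continuous_monom_val)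
  then show ?thesis by (simp add: comp_val_def[abs_def])
qed

section \<open>Discrete Fourier analysis at roots of unity\<close>

definition uroot :: "nat \<Rightarrow> nat \<Rightarrow> complex" where
  "uroot m j = cis (2 * pi * real j / real m)"

lemma norm_uroot [simp]: "norm (uroot m j) = 1"
  by (simp add: uroot_def)

text \<open>A geometric sum whose ratio has \<open>m\<close>-th power 1. The ratio is itself 1 only
  if \<open>m\<close> divides \<open>a - b\<close>, and the bounds on \<open>a\<close> and
  \<open>b\<close> leave only \<open>a = b\<close>.\<close>

lemma uroot_orthogonal:
  assumes "a < m" "b < m"
  shows "(\<Sum>j<m. uroot m j ^ a * cnj (uroot m j) ^ b) = (if a = b then of_nat m else 0)"
proof -
  let ?x = "cis (2 * pi * (real a - real b) / real m)"
  have "uroot m j ^ a * cnj (uroot m j) ^ b = ?x ^ j" for j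
  proof -
    let ?\<theta> = "2 * pi * real j / real m"
    have "uroot m j ^ a * cnj (uroot m j) ^ b = cis (real a * ?\<theta> + real b * - ?\<theta>)"
      by (simp only: uroot_def cis_cnj Complex.DeMoivre cis_mult)
    also have "real a * ?\<theta> + real b * - ?\<theta> = real j * (2 * pi * (real a - real b) / real m)"
      by (simp add: diff_divide_distrib algebra_simps)
    finally show ?thesis by (simp only: Complex.DeMoivre)
  qed
  then have eq: "(\<Sum>j<m. uroot m j ^ a * cnj (uroot m j) ^ b) = (\<Sum>j<m. ?x ^ j)" by simp
  show ?thesis
  proof (cases "a = b")
    case True
    then show ?thesis unfolding eq by simp
  next
    case False
    have "?x \<noteq> 1"
    proof
      assume "?x = 1"
      then obtain k :: int where "2 * pi * (real a - real b) / real m = 2 * pi * k"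
        by (auto simp: cis_conv_exp exp_eq_1 mult_ac)
      then have "(2 * pi) * ((real a - real b) / real m) = (2 * pi) * k" by simp
      then have "(real a - real b) / real m = k" unfolding mult_cancel_left by simp
      then have "real a - real b = real_of_int k * real m"
        using assms by (simp add: field_simps)
      then have "int a - int b = k * int m"
        by (metis of_int_diff of_int_eq_iff of_int_mult of_int_of_nat_eq)
      moreover have "\<bar>int a - int b\<bar> < int m" using assms by auto
      ultimately have "\<bar>k\<bar> * int m < 1 * int m" by (simp add: abs_mult)
      then have "k = 0" by (simp only: mult_less_cancel_right) auto
      with \<open>int a - int b = k * int m\<close> False show False by simp
    qed
    moreover have "?x ^ m = 1"
    proof -
      have "?x ^ m = cis (2 * pi * of_int (int a - int b))"
        using assms by (simp add: Complex.DeMoivre)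
      also have "\<dots> = 1" by (metis cis_multiple_2pi Ints_of_int)
      finally show ?thesis .
    qed
    ultimately show ?thesis unfolding eq using False by (simp add: sum_gp_strict)
  qed
qed

text \<open>Were the two roots equal, every term of the orthogonality sum would be 1, so the sum
  could not vanish.\<close>

lemma uroot_inj:
  assumes "uroot m a = uroot m b" "a < m" "b < m"
  shows "a = b"
proof (rule ccontr)
  assume ab: "a \<noteq> b"
  have "(\<Sum>j<m. uroot m j ^ a * cnj (uroot m j) ^ b) = (\<Sum>j<m. 1)"
  proof (rule sum.cong[OF refl])
    fix j
    have swap: "uroot m j ^ c = uroot m c ^ j" for c
      by (simp add: uroot_def Complex.DeMoivre mult_ac)
    have "uroot m j ^ a * cnj (uroot m j) ^ b = uroot m a ^ j * cnj (uroot m b ^ j)"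
      by (simp only: swap[symmetric] complex_cnj_power)
    also have "\<dots> = 1"
      using complex_norm_square[of "uroot m b ^ j"] assms(1) by (simp add: norm_power)
    finally show "uroot m j ^ a * cnj (uroot m j) ^ b = 1" .
  qed
  then show False using uroot_orthogonal[OF assms(2,3)] ab assms(2) by simp
qed

text \<open>A discrete Cauchy estimate: Fourier inversion bounds every coefficient times
  \<open>\<rho> ^ k\<close> by the mean of the norms at the \<open>m\<close> points of the circle,
  and there are at most \<open>m\<close> coefficients. No integral is involved.\<close>

lemma norm_poly_le_sum_uroot:
  fixes p :: "complex poly"
  assumes deg: "degree p < m" and y: "norm y \<le> \<rho>"
  shows "norm (poly p y) \<le> (\<Sum>j<m. norm (poly p (of_real \<rho> * uroot m j)))"
proof -
  have m: "0 < m" using deg by simp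
  have \<rho>: "0 \<le> \<rho>" using y norm_ge_zero[of y] by linarith
  have p: "poly p z = (\<Sum>k<m. coeff p k * z ^ k)" for z
    unfolding poly_altdef using deg by (intro sum.mono_neutral_left) (auto simp: coeff_eq_0)
  let ?T = "\<Sum>j<m. norm (poly p (of_real \<rho> * uroot m j))"
  have coef: "norm (coeff p k) * \<rho> ^ k \<le> ?T / m" if k: "k < m" for k
  proof -
    have "(\<Sum>j<m. poly p (of_real \<rho> * uroot m j) * cnj (uroot m j) ^ k) =
        (\<Sum>j<m. \<Sum>i<m. coeff p i * of_real \<rho> ^ i * (uroot m j ^ i * cnj (uroot m j) ^ k))"
      unfolding p sum_distrib_right by (intro sum.cong refl) (simp add: power_mult_distrib mult_ac)
    also have "\<dots> = (\<Sum>i<m. coeff p i * of_real \<rho> ^ i * (\<Sum>j<m. uroot m j ^ i * cnj (uroot m j) ^ k))"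
      by (subst sum.swap) (simp add: sum_distrib_left)
    also have "\<dots> = (\<Sum>i<m. if i = k then coeff p i * of_real \<rho> ^ i * of_nat m else 0)"
      using k by (intro sum.cong) (auto simp: uroot_orthogonal)
    also have "\<dots> = coeff p k * of_real \<rho> ^ k * of_nat m" using k by simp
    finally have "norm (coeff p k * of_real \<rho> ^ k * of_nat m) = norm (\<Sum>j<m. poly p (of_real \<rho> * uroot m j) * cnj (uroot m j) ^ k)"
      by simp
    also have "\<dots> \<le> ?T"
      by (rule order_trans[OF norm_sum]) (simp add: norm_mult norm_power)
    finally show ?thesis using m \<rho> by (simp add: norm_mult norm_power field_simps)
  qed
  have "norm (poly p y) \<le> (\<Sum>k<m. norm (coeff p k) * \<rho> ^ k)"
    unfolding p using y by (intro order_trans[OF norm_sum] sum_mono) (auto simp: norm_mult norm_power intro!: mult_left_mono power_mono)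
  also have "\<dots> \<le> (\<Sum>k<m. ?T / m)" using coef by (intro sum_mono) auto
  also have "\<dots> = ?T" using m by simp
  finally show ?thesis .
qed

definition vupd :: "complex ^ 'n \<Rightarrow> 'n \<Rightarrow> complex \<Rightarrow> complex ^ 'n" where
  "vupd v i y = (\<chi> j. if j = i then y else v $ j)"

lemma comp_val_vupd_poly:
  fixes P :: "'n::finite cpoly"
  shows "\<exists>p. degree p \<le> n \<and> (\<forall>y. comp_val n P (vupd v i y) = poly p y)"
proof (intro exI conjI allI)
  let ?p = "\<Sum>\<alpha>\<in>monomials n. monom (lk P \<alpha> * (\<Prod>j\<in>- {i}. v $ j ^ lk \<alpha> j)) (lk \<alpha> i)"
  show "degree ?p \<le> n"
  proof (intro degree_sum_le finite_monomials)
    fix \<alpha> :: "'n \<Rightarrow>\<^sub>0 nat" assume "\<alpha> \<in> monomials n"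
    then have "lk \<alpha> i \<le> n" using lookup_le_mon_degree by (auto simp: monomials_def)
    then show "degree (monom (lk P \<alpha> * (\<Prod>j\<in>- {i}. v $ j ^ lk \<alpha> j)) (lk \<alpha> i)) \<le> n"
      using degree_monom_le le_trans by blast
  qed
  fix y
  have "monom_val \<alpha> (vupd v i y) = (\<Prod>j\<in>- {i}. v $ j ^ lk \<alpha> j) * y ^ lk \<alpha> i" for \<alpha>
    unfolding monom_val_def vupd_def by (subst prod.remove[of _ i]) (auto simp: Compl_eq_Diff_UNIV mult.commute)
  then show "comp_val n P (vupd v i y) = poly ?p y"
    by (simp add: comp_val_def poly_sum poly_monom mult_ac)
qed

text \<open>The number of sample points on the distinguished boundary is polynomial in the degree.\<close>

lemma norm_comp_val_polydisc:
  fixes P :: "'n::finite cpoly"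
  assumes y: "\<And>j. norm (y j) \<le> \<rho>"
  shows "norm (comp_val n P (\<chi> j. w $ j + y j)) \<le>
    (\<Sum>c\<in>(I :: 'n set) \<rightarrow>\<^sub>E {..n}. norm (comp_val n P (\<chi> j. w $ j + (if j \<in> I then of_real \<rho> * uroot (Suc n) (c j) else y j))))"
proof (induction I rule: finite_induct[OF finite])
  case 1
  then show ?case by simp
next
  case (2 i I)
  let ?v = "\<lambda>c. \<chi> j. w $ j + (if j \<in> I then of_real \<rho> * uroot (Suc n) (c j) else y j)"
  have step: "norm (comp_val n P (?v c)) \<le> (\<Sum>k\<le>n. norm (comp_val n P (vupd (?v c) i (w $ i + of_real \<rho> * uroot (Suc n) k))))" for c
  proof -
    obtain p where p: "degree p \<le> n" "\<And>y. comp_val n P (vupd (?v c) i y) = poly p y"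
      using comp_val_vupd_poly by blast
    \<comment> \<open>The discrete estimate concerns a circle around 0, so the polynomial is
      recentred at \<open>w $ i\<close>.\<close>
    let ?q = "pcompose p [:w $ i, 1:]"
    have q: "poly ?q y = comp_val n P (vupd (?v c) i (w $ i + y))" for y
      by (simp add: poly_pcompose p(2))
    have "degree ?q < Suc n" using p(1) by (simp add: degree_pcompose)
    from norm_poly_le_sum_uroot[OF this y[of i]]
    have "norm (comp_val n P (vupd (?v c) i (w $ i + y i))) \<le> (\<Sum>k\<le>n. norm (comp_val n P (vupd (?v c) i (w $ i + of_real \<rho> * uroot (Suc n) k))))"
      unfolding q by (simp add: lessThan_Suc_atMost)
    moreover have "vupd (?v c) i (w $ i + y i) = ?v c"
      using 2 by (auto simp: vupd_def vec_eq_iff)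
    ultimately show ?thesis by simp
  qed
  let ?I = "insert i I"
  let ?v' = "\<lambda>c. \<chi> j. w $ j + (if j \<in> ?I then of_real \<rho> * uroot (Suc n) (c j) else y j)"
  have "norm (comp_val n P (\<chi> j. w $ j + y j)) \<le> (\<Sum>c\<in>I \<rightarrow>\<^sub>E {..n}. norm (comp_val n P (?v c)))" by (rule 2)
  also have "\<dots> \<le> (\<Sum>c\<in>I \<rightarrow>\<^sub>E {..n}. \<Sum>k\<le>n. norm (comp_val n P (vupd (?v c) i (w $ i + of_real \<rho> * uroot (Suc n) k))))"
    by (intro sum_mono step)
  also have "\<dots> = (\<Sum>c\<in>I \<rightarrow>\<^sub>E {..n}. \<Sum>k\<le>n. norm (comp_val n P (?v' (c(i := k)))))"
  proof (intro sum.cong refl)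
    fix c k
    have "vupd (?v c) i (w $ i + of_real \<rho> * uroot (Suc n) k) = ?v' (c(i := k))"
      using 2 by (auto simp: vupd_def vec_eq_iff)
    then show "norm (comp_val n P (vupd (?v c) i (w $ i + of_real \<rho> * uroot (Suc n) k))) = norm (comp_val n P (?v' (c(i := k))))"
      by simp
  qed
  also have "\<dots> = (\<Sum>(k, c)\<in>{..n} \<times> (I \<rightarrow>\<^sub>E {..n}). norm (comp_val n P (?v' (c(i := k)))))"
    by (subst sum.swap) (rule sum.cartesian_product)
  also have "\<dots> = (\<Sum>c\<in>?I \<rightarrow>\<^sub>E {..n}. norm (comp_val n P (?v' c)))"
  proof -
    have "inj_on (\<lambda>(k, c). c(i := k)) ({..n} \<times> (I \<rightarrow>\<^sub>E {..n}))"
      by (rule inj_combinator) (rule 2)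
    then show ?thesis
      unfolding PiE_insert_eq by (subst sum.reindex) (auto simp: case_prod_unfold)
  qed
  finally show ?case .
qed

text \<open>Fourier inversion on the torus; roots of order \<open>n + 1\<close> separate all
  exponents that occur in degree \<open>n\<close>.\<close>

lemma comp_val_coeff:
  fixes P :: "'n::finite cpoly"
  assumes \<alpha>: "\<alpha> \<in> monomials n"
  shows "(\<Sum>c\<in>UNIV \<rightarrow>\<^sub>E {..n}. comp_val n P (\<chi> j. uroot (Suc n) (c j)) * (\<Prod>j\<in>UNIV. cnj (uroot (Suc n) (c j)) ^ lk \<alpha> j)) =
    of_nat (Suc n) ^ CARD('n) * lk P \<alpha>"
proof -
  let ?m = "Suc n"
  have orth: "(\<Sum>c\<in>UNIV \<rightarrow>\<^sub>E {..n}. \<Prod>j\<in>UNIV. uroot ?m (c j) ^ lk \<beta> j * cnj (uroot ?m (c j)) ^ lk \<alpha> j) =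
      (if \<beta> = \<alpha> then of_nat ?m ^ CARD('n) else 0)" if "\<beta> \<in> monomials n" for \<beta>
  proof -
    have "(\<Sum>c\<in>UNIV \<rightarrow>\<^sub>E {..n}. \<Prod>j\<in>UNIV. uroot ?m (c j) ^ lk \<beta> j * cnj (uroot ?m (c j)) ^ lk \<alpha> j) =
        (\<Prod>j\<in>(UNIV :: 'n set). \<Sum>k\<le>n. uroot ?m k ^ lk \<beta> j * cnj (uroot ?m k) ^ lk \<alpha> j)"
      by (subst prod_sum_PiE) auto
    also have "\<dots> = (\<Prod>j\<in>(UNIV :: 'n set). if lk \<beta> j = lk \<alpha> j then of_nat ?m else 0)"
    proof (rule prod.cong[OF refl])
      fix j
      have "lk \<beta> j < ?m" "lk \<alpha> j < ?m" using that \<alpha> lookup_le_mon_degree[of \<beta> j] lookup_le_mon_degree[of \<alpha> j] by (simp_all add: monomials_def)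
      then show "(\<Sum>k\<le>n. uroot ?m k ^ lk \<beta> j * cnj (uroot ?m k) ^ lk \<alpha> j) = (if lk \<beta> j = lk \<alpha> j then of_nat ?m else 0)"
        using uroot_orthogonal[of "lk \<beta> j" ?m "lk \<alpha> j"] by (simp add: lessThan_Suc_atMost)
    qed
    also have "\<dots> = (if \<beta> = \<alpha> then of_nat ?m ^ CARD('n) else 0)"
    proof (cases "\<beta> = \<alpha>")
      case False
      then obtain j where "lk \<beta> j \<noteq> lk \<alpha> j" by (auto simp: poly_mapping_eq_iff fun_eq_iff)
      then show ?thesis using False by (auto simp: prod_zero_iff)
    qed simp
    finally show ?thesis .
  qed
  have "(\<Sum>c\<in>UNIV \<rightarrow>\<^sub>E {..n}. comp_val n P (\<chi> j. uroot ?m (c j)) * (\<Prod>j\<in>UNIV. cnj (uroot ?m (c j)) ^ lk \<alpha> j)) =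
     (\<Sum>c\<in>UNIV \<rightarrow>\<^sub>E {..n}. \<Sum>\<beta>\<in>monomials n. lk P \<beta> * (\<Prod>j\<in>UNIV. uroot ?m (c j) ^ lk \<beta> j * cnj (uroot ?m (c j)) ^ lk \<alpha> j))"
    by (simp add: comp_val_def monom_val_def sum_distrib_right prod.distrib mult.assoc)
  also have "\<dots> = (\<Sum>\<beta>\<in>monomials n. lk P \<beta> * (\<Sum>c\<in>UNIV \<rightarrow>\<^sub>E {..n}. \<Prod>j\<in>UNIV. uroot ?m (c j) ^ lk \<beta> j * cnj (uroot ?m (c j)) ^ lk \<alpha> j))"
    by (subst sum.swap) (simp add: sum_distrib_left)
  also have "\<dots> = (\<Sum>\<beta>\<in>monomials n. if \<beta> = \<alpha> then lk P \<beta> * of_nat ?m ^ CARD('n) else 0)"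
    by (intro sum.cong) (auto simp: orth)
  also have "\<dots> = of_nat ?m ^ CARD('n) * lk P \<alpha>" using \<alpha> by simp
  finally show ?thesis .
qed

text \<open>Homogeneity spreads the vanishing from a ball to all vectors, in particular to the
  torus, where the coefficients are recovered.\<close>

lemma comp_val_zero_imp:
  assumes "\<And>v. norm v < \<epsilon> \<Longrightarrow> comp_val n P v = 0" "0 < \<epsilon>" "\<alpha> \<in> monomials n"
  shows "lk P \<alpha> = 0"
proof -
  have z: "comp_val n P v = 0" for v
  proof -
    obtain c :: real where c: "0 < c" "c * norm v < \<epsilon>"
    proof
      have "0 \<le> \<epsilon> * norm v" using assms(2) by simp
      show "0 < \<epsilon> / (2 * (norm v + 1))" using assms(2) by (auto intro!: divide_pos_pos add_nonneg_pos)
      have "\<epsilon> * norm v < 2 * \<epsilon> * (norm v + 1)"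
      proof -
        have "2 * \<epsilon> * (norm v + 1) = 2 * (\<epsilon> * norm v) + 2 * \<epsilon>" by (simp add: algebra_simps)
        then show ?thesis using assms(2) \<open>0 \<le> \<epsilon> * norm v\<close> by linarith
      qed
      then show "\<epsilon> / (2 * (norm v + 1)) * norm v < \<epsilon>" by (simp add: divide_less_eq add_nonneg_pos mult_ac)
    qed
    have sv: "complex_of_real c *s v = c *\<^sub>R v" unfolding vec_eq_iff
    proof
      fix i show "(complex_of_real c *s v) $ i = (c *\<^sub>R v) $ i"
        by (simp add: scaleR_conv_of_real[of c "v $ i"])
    qed
    then have "comp_val n P (of_real c *s v) = 0" using assms(1)[of "c *\<^sub>R v"] c by simp
    then show ?thesis using c by (simp add: comp_val_scale)
  qed
  show ?thesis using comp_val_coeff[OF assms(3), of P] by (simp add: z del: of_nat_Suc)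
qed

section \<open>Neighbourhoods of a circled compact set\<close>

text \<open>Bernoulli's inequality gives \<open>\<eta> * (n + 1) \<le> (1 + \<eta>) ^ n\<close> for
  \<open>\<eta> \<le> 1\<close>; with \<open>1 + \<eta>\<close> below a root of \<open>x\<close>
  this is raised to the power of that root.\<close>

lemma poly_le_exp:
  fixes x :: real
  assumes "1 < x"
  shows "\<exists>B>0. \<forall>n. (real n + 1) ^ k \<le> B * x ^ n"
proof -
  \<comment> \<open>The successor keeps the root meaningful for \<open>k = 0\<close>.\<close>
  define k' where "k' = Suc k"
  define \<eta> where "\<eta> = min 1 (root k' x - 1)"
  have r: "1 < root k' x" using assms by (simp add: k'_def)
  then have \<eta>: "0 < \<eta>" "\<eta> \<le> 1" "1 + \<eta> \<le> root k' x" by (auto simp: \<eta>_def)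
  have "(real n + 1) ^ k \<le> (1 / \<eta> ^ k') * x ^ n" for n
  proof -
    have "\<eta> * (real n + 1) \<le> 1 + real n * \<eta>" using \<eta> by (simp add: algebra_simps)
    also have "\<dots> \<le> (1 + \<eta>) ^ n" using \<eta> by (intro Bernoulli_inequality) auto
    also have "\<dots> \<le> root k' x ^ n" using \<eta> by (intro power_mono) auto
    finally have "(\<eta> * (real n + 1)) ^ k' \<le> (root k' x ^ n) ^ k'"
      using \<eta> by (intro power_mono) auto
    also have "\<dots> = (root k' x ^ k') ^ n" by (simp add: mult.commute flip: power_mult)
    also have "\<dots> = x ^ n" using assms by (simp add: k'_def del: power_Suc)
    finally have "\<eta> ^ k' * (real n + 1) ^ k' \<le> x ^ n" by (simp only: power_mult_distrib)
    moreover have "(real n + 1) ^ k \<le> (real n + 1) ^ k'" unfolding k'_def by (intro power_increasing) auto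
    moreover have "0 < \<eta> ^ k'" using \<eta> by simp
    ultimately show ?thesis by (simp add: field_simps) (meson mult_left_mono order_trans less_imp_le)
  qed
  then show ?thesis using \<eta> by (intro exI[of _ "1 / \<eta> ^ k'"]) auto
qed

definition sup_norm :: "(complex ^ 'n) set \<Rightarrow> nat \<Rightarrow> 'n::finite cpoly \<Rightarrow> real" where
  "sup_norm K n P = (SUP v\<in>K. norm (comp_val n P v))"

lemma bdd_above_comp_val: "compact K \<Longrightarrow> bdd_above ((\<lambda>v. norm (comp_val n P v)) ` K)"
  by (intro bounded_imp_bdd_above compact_imp_bounded compact_continuous_image continuous_intros continuous_comp_val)

lemma sup_norm_upper: "compact K \<Longrightarrow> v \<in> K \<Longrightarrow> norm (comp_val n P v) \<le> sup_norm K n P"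
  unfolding sup_norm_def by (intro cSUP_upper bdd_above_comp_val)

lemma sup_norm_least: "K \<noteq> {} \<Longrightarrow> (\<And>v. v \<in> K \<Longrightarrow> norm (comp_val n P v) \<le> b) \<Longrightarrow> sup_norm K n P \<le> b"
  unfolding sup_norm_def by (rule cSUP_least)

lemma sup_norm_nonneg: "compact K \<Longrightarrow> K \<noteq> {} \<Longrightarrow> 0 \<le> sup_norm K n P"
  using sup_norm_upper norm_ge_zero order_trans by blast

lemma sup_norm_mult:
  assumes K: "compact K" "K \<noteq> {}" and P: "homogeneous n P" and Q: "homogeneous m Q" and PQ: "homogeneous (n + m) (P * Q)"
  shows "sup_norm K (n + m) (P * Q) \<le> sup_norm K n P * sup_norm K m Q"
proof (rule sup_norm_least[OF K(2)])
  fix v assume v: "v \<in> K"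
  have "norm (comp_val (n + m) (P * Q) v) = norm (comp_val n P v) * norm (comp_val m Q v)"
    using P Q PQ by (simp add: comp_val_homogeneous poly_eval_mult norm_mult)
  also have "\<dots> \<le> sup_norm K n P * sup_norm K m Q"
    using v K by (intro mult_mono sup_norm_upper sup_norm_nonneg) auto
  finally show "norm (comp_val (n + m) (P * Q) v) \<le> sup_norm K n P * sup_norm K m Q" .
qed

lemma norm_le_sum_norm: "norm (v :: complex ^ 'n::finite) \<le> (\<Sum>j\<in>UNIV. norm (v $ j))"
  unfolding norm_vec_def by (rule L2_set_le_sum) simp

text \<open>Finitely many polydiscs cover \<open>K\<close>, their number not depending on the
  degree. In each of them the value at any point is controlled by at most
  \<open>(n + 1) ^ CARD('n)\<close> points of the distinguished boundary.\<close>

lemma sup_norm_le_discrete: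
  fixes K :: "(complex ^ 'n::finite) set"
  assumes K: "compact K" "K \<noteq> {}" and \<rho>: "0 < \<rho>"
    and K': "\<And>w y. w \<in> K \<Longrightarrow> norm y \<le> \<rho> \<Longrightarrow> w + y \<in> K'"
    and cnj: "\<And>w. w \<in> K' \<Longrightarrow> vec_cnj w \<in> K'"
  shows "\<exists>m. \<forall>n. \<exists>S. finite S \<and> S \<subseteq> K' \<and> vec_cnj ` S = S \<and> card S \<le> m * (n + 1) ^ CARD('n) \<and>
    (\<forall>P. sup_norm K n P \<le> (\<Sum>w\<in>S. norm (comp_val n P w)))"
proof -
  \<comment> \<open>The norm is at most the sum of the coordinates' norms, so a polydisc of radius
    \<open>r\<close> stays in the ball of radius \<open>\<rho>\<close>.\<close>
  define r where "r = \<rho> / CARD('n)"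
  have r: "0 < r" using \<rho> by (simp add: r_def)
  obtain W where W: "finite W" "W \<subseteq> K" "K \<subseteq> (\<Union>w\<in>W. ball w r)"
    using seq_compact_imp_totally_bounded[of K] K(1) r by (auto simp: compact_eq_seq_compact_metric)
  show ?thesis
  proof (intro exI[of _ "2 * card W"] allI)
    fix n :: nat
    let ?C = "(UNIV :: 'n set) \<rightarrow>\<^sub>E {..n}"
    let ?pt = "\<lambda>(w, c). \<chi> j. w $ j + of_real r * uroot (Suc n) (c j)"
    define S0 where "S0 = ?pt ` (W \<times> ?C)"
    \<comment> \<open>Adding the conjugate points makes the resulting norm invariant under
      conjugation, at the price of a factor 2 in the number of points.\<close>
    define S where "S = S0 \<union> vec_cnj ` S0"
    have finC: "finite ?C" by (intro finite_PiE) auto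
    have fin0: "finite S0" unfolding S0_def using W finC by (intro finite_imageI finite_cartesian_product)
    have sub0: "S0 \<subseteq> K'"
    proof
      fix v assume "v \<in> S0"
      then obtain w c where "w \<in> W" "v = ?pt (w, c)"
        unfolding S0_def by blast
      then have w: "w \<in> W" "v = w + (\<chi> j. of_real r * uroot (Suc n) (c j))"
        by (auto simp: vec_eq_iff)
      have "norm (\<chi> j :: 'n. of_real r * uroot (Suc n) (c j)) \<le> (\<Sum>j\<in>(UNIV :: 'n set). r)"
        using r by (intro order_trans[OF norm_le_sum_norm]) (auto simp: norm_mult intro!: sum_mono)
      also have "\<dots> = \<rho>" by (simp add: r_def)
      finally show "v \<in> K'" unfolding w(2) using K' W w by blast
    qed
    have cC: "card ?C = (n + 1) ^ CARD('n)" by (simp add: card_PiE)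
    have "card S \<le> card S0 + card (vec_cnj ` S0)" unfolding S_def by (rule card_Un_le)
    also have "\<dots> \<le> card S0 + card S0" using card_image_le[OF fin0] by simp
    also have "card S0 \<le> card W * (n + 1) ^ CARD('n)"
      unfolding S0_def cC[symmetric] using card_image_le[of "W \<times> ?C"] W finC by (simp add: card_cartesian_product)
    finally have card: "card S \<le> 2 * card W * (n + 1) ^ CARD('n)" by simp
    have "sup_norm K n P \<le> (\<Sum>w\<in>S. norm (comp_val n P w))" for P
    proof (rule sup_norm_least[OF K(2)])
      fix v assume "v \<in> K"
      then obtain w where w: "w \<in> W" "v \<in> ball w r" using W by blast
      have y: "norm (v $ j - w $ j) \<le> r" for j
        using Finite_Cartesian_Product.norm_nth_le[of "v - w" j] w by (simp add: dist_norm norm_minus_commute)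
      have "norm (comp_val n P v) = norm (comp_val n P (\<chi> j. w $ j + (v $ j - w $ j)))" by simp
      also have "\<dots> \<le> (\<Sum>c\<in>?C. norm (comp_val n P (\<chi> j. w $ j + (if j \<in> UNIV then of_real r * uroot (Suc n) (c j) else v $ j - w $ j))))"
        by (rule norm_comp_val_polydisc[OF y])
      also have "\<dots> = (\<Sum>c\<in>?C. norm (comp_val n P (?pt (w, c))))" by simp
      also have "\<dots> \<le> (\<Sum>u\<in>S. norm (comp_val n P u))"
      proof -
        have inj: "inj_on (\<lambda>c. ?pt (w, c)) ?C"
        proof (rule inj_onI)
          fix c d assume cd: "c \<in> ?C" "d \<in> ?C" "?pt (w, c) = ?pt (w, d)"
          have "c j = d j" for j
          proof -
            have "uroot (Suc n) (c j) = uroot (Suc n) (d j)"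
              using cd(3) r by (simp add: vec_eq_iff)
            moreover have "c j < Suc n" "d j < Suc n" using cd by (auto simp: less_Suc_eq_le)
            ultimately show ?thesis
              using uroot_inj by blast
          qed
          then show "c = d" by blast
        qed
        have "(\<Sum>c\<in>?C. norm (comp_val n P (?pt (w, c)))) = (\<Sum>u\<in>(\<lambda>c. ?pt (w, c)) ` ?C. norm (comp_val n P u))"
          by (subst sum.reindex[OF inj]) (simp add: o_def)
        also have "\<dots> \<le> (\<Sum>u\<in>S. norm (comp_val n P u))"
          using fin0 w by (intro sum_mono2) (auto simp: S_def S0_def)
        finally show ?thesis .
      qed
      finally show "norm (comp_val n P v) \<le> (\<Sum>w\<in>S. norm (comp_val n P w))" .
    qed
    moreover have "vec_cnj ` S = S" by (auto simp: S_def image_Un image_image)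
    moreover have "S \<subseteq> K'" using sub0 cnj by (auto simp: S_def)
    ultimately show "\<exists>S. finite S \<and> S \<subseteq> K' \<and> vec_cnj ` S = S \<and> card S \<le> 2 * card W * (n + 1) ^ CARD('n) \<and>
      (\<forall>P. sup_norm K n P \<le> (\<Sum>w\<in>S. norm (comp_val n P w)))"
      using fin0 card by (intro exI[of _ S]) (auto simp: S_def)
  qed
qed

lemma norm_vscale: "norm (c *s (v :: complex ^ 'n::finite)) = norm c * norm v"
  by (simp add: norm_vec_def norm_mult L2_set_right_distrib)

lemma norm_vec_cnj: "norm (vec_cnj (v :: complex ^ 'n::finite)) = norm v"
  by (simp add: norm_vec_def vec_cnj_def)

section \<open>Closed neighbourhoods and the exponential gain between them\<close>

locale circled_compact =
  fixes K :: "(complex ^ 'n::finite) set"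
  assumes K_compact: "compact K" and K_zero: "0 \<in> K"
    and K_circled: "\<And>c v. norm c \<le> 1 \<Longrightarrow> v \<in> K \<Longrightarrow> c *s v \<in> K"
    and K_cnj: "\<And>v. v \<in> K \<Longrightarrow> vec_cnj v \<in> K"
begin

definition closed_nbhd :: "real \<Rightarrow> (complex ^ 'n) set" where
  "closed_nbhd \<epsilon> = {v. infdist v K \<le> \<epsilon>}"

lemma K_ne: "K \<noteq> {}" using K_zero by blast

lemma closed_nbhd_iff: "v \<in> closed_nbhd \<epsilon> \<longleftrightarrow> (\<exists>k\<in>K. dist v k \<le> \<epsilon>)"
proof
  assume v: "v \<in> closed_nbhd \<epsilon>"
  obtain k where "k \<in> K" "infdist v K = dist v k"
    using infdist_attains_inf[OF compact_imp_closed[OF K_compact] K_ne, of v] by blast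
  then show "\<exists>k\<in>K. dist v k \<le> \<epsilon>" using v by (auto simp: closed_nbhd_def)
next
  assume "\<exists>k\<in>K. dist v k \<le> \<epsilon>"
  then show "v \<in> closed_nbhd \<epsilon>" unfolding closed_nbhd_def using infdist_le2 by blast
qed

lemma closed_nbhd_zero: "0 \<le> \<epsilon> \<Longrightarrow> 0 \<in> closed_nbhd \<epsilon>"
  using K_zero by (auto simp: closed_nbhd_iff intro!: bexI[of _ 0])

lemma closed_nbhd_mono: "\<epsilon> \<le> \<epsilon>' \<Longrightarrow> closed_nbhd \<epsilon> \<subseteq> closed_nbhd \<epsilon>'"
  by (auto simp: closed_nbhd_def)

lemma closed_closed_nbhd: "closed (closed_nbhd \<epsilon>)"
  unfolding closed_nbhd_def by (intro closed_Collect_le continuous_intros)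

lemma closed_nbhd_bounded: "\<exists>R>0. \<forall>v\<in>closed_nbhd \<epsilon>. norm v \<le> R"
proof -
  obtain R where R: "\<And>k. k \<in> K \<Longrightarrow> norm k \<le> R"
    using compact_imp_bounded[OF K_compact] by (auto simp: bounded_iff)
  have "norm v \<le> R + \<bar>\<epsilon>\<bar>" if v: "v \<in> closed_nbhd \<epsilon>" for v
  proof -
    obtain k where "k \<in> K" "dist v k \<le> \<epsilon>" using v closed_nbhd_iff by blast
    then show ?thesis using R[of k] norm_triangle_sub[of v k] by (simp add: dist_norm)
  qed
  moreover have "0 \<le> R" using R[OF K_zero] by simp
  ultimately show ?thesis by (intro exI[of _ "R + \<bar>\<epsilon>\<bar> + 1"]) force
qed

lemma compact_closed_nbhd: "compact (closed_nbhd \<epsilon>)"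
  using closed_closed_nbhd closed_nbhd_bounded[of \<epsilon>] by (auto simp: compact_eq_bounded_closed bounded_iff)

lemma closed_nbhd_ne: "0 \<le> \<epsilon> \<Longrightarrow> closed_nbhd \<epsilon> \<noteq> {}"
  using closed_nbhd_zero by blast

lemma closed_nbhd_circled:
  assumes "norm c \<le> 1" "v \<in> closed_nbhd \<epsilon>"
  shows "c *s v \<in> closed_nbhd \<epsilon>"
proof -
  obtain k where k: "k \<in> K" "dist v k \<le> \<epsilon>" using assms closed_nbhd_iff by blast
  have "dist (c *s v) (c *s k) = norm c * dist v k"
    by (simp add: dist_norm norm_vscale flip: vector_ssub_ldistrib)
  also have "\<dots> \<le> 1 * dist v k" using assms(1) by (intro mult_right_mono) auto
  finally show ?thesis using k K_circled[OF assms(1) k(1)] unfolding closed_nbhd_iff by (intro bexI[of _ "c *s k"]) auto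
qed

lemma closed_nbhd_cnj:
  assumes "v \<in> closed_nbhd \<epsilon>" shows "vec_cnj v \<in> closed_nbhd \<epsilon>"
proof -
  obtain k where k: "k \<in> K" "dist v k \<le> \<epsilon>" using assms closed_nbhd_iff by blast
  have "norm (vec_cnj (v - k)) = norm (v - k)" by (rule norm_vec_cnj)
  moreover have "vec_cnj (v - k) = vec_cnj v - vec_cnj k" by (simp add: vec_cnj_def vec_eq_iff)
  ultimately have "dist (vec_cnj v) (vec_cnj k) = dist v k" by (simp add: dist_norm)
  then show ?thesis using k K_cnj[OF k(1)] unfolding closed_nbhd_iff by (intro bexI[of _ "vec_cnj k"]) auto
qed

lemma closed_nbhd_add: "v \<in> closed_nbhd \<epsilon> \<Longrightarrow> norm y \<le> \<delta> \<Longrightarrow> v + y \<in> closed_nbhd (\<epsilon> + \<delta>)"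
proof -
  assume v: "v \<in> closed_nbhd \<epsilon>" "norm y \<le> \<delta>"
  then obtain k where k: "k \<in> K" "dist v k \<le> \<epsilon>" using closed_nbhd_iff by blast
  have "dist (v + y) k \<le> dist v k + norm y"
    using dist_triangle[of "v + y" k v] by (simp add: dist_norm)
  then show ?thesis using k v unfolding closed_nbhd_iff by (intro bexI[of _ k]) auto
qed

lemma ball_sub_closed_nbhd: "norm v \<le> \<epsilon> \<Longrightarrow> v \<in> closed_nbhd \<epsilon>"
  using K_zero by (auto simp: closed_nbhd_iff intro!: bexI[of _ 0])

text \<open>A vector \<open>v\<close> of the smaller neighbourhood has norm at most
  \<open>R\<close>, so adding \<open>(x - 1) v\<close>, of length at most
  \<open>\<epsilon> - \<epsilon>'\<close>, stays in the larger one. Thus \<open>x v\<close> lies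
  there, and homogeneity turns the dilation into the factor \<open>x ^ n\<close>.\<close>

lemma sup_norm_gain:
  assumes "0 \<le> \<epsilon>'" "\<epsilon>' < \<epsilon>"
  shows "\<exists>x>1. \<forall>n P. x ^ n * sup_norm (closed_nbhd \<epsilon>') n P \<le> sup_norm (closed_nbhd \<epsilon>) n P"
proof -
  obtain R where R: "R > 0" "\<And>v. v \<in> closed_nbhd \<epsilon>' \<Longrightarrow> norm v \<le> R" using closed_nbhd_bounded by blast
  define x where "x = 1 + (\<epsilon> - \<epsilon>') / R"
  have x: "1 < x" using assms R by (simp add: x_def)
  have "sup_norm (closed_nbhd \<epsilon>') n P \<le> sup_norm (closed_nbhd \<epsilon>) n P / x ^ n" for n P
  proof (rule sup_norm_least[OF closed_nbhd_ne[OF assms(1)]])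
    fix v assume v: "v \<in> closed_nbhd \<epsilon>'"
    have "norm ((x - 1) *\<^sub>R v) \<le> \<epsilon> - \<epsilon>'"
    proof -
      have "norm ((x - 1) *\<^sub>R v) = (\<epsilon> - \<epsilon>') * (norm v / R)" using assms R x by (simp add: x_def)
      also have "\<dots> \<le> (\<epsilon> - \<epsilon>') * 1" using R v assms by (intro mult_left_mono) auto
      finally show ?thesis by simp
    qed
    from closed_nbhd_add[OF v this] have "v + (x - 1) *\<^sub>R v \<in> closed_nbhd \<epsilon>" by simp
    moreover have "v + (x - 1) *\<^sub>R v = complex_of_real x *s v"
      unfolding vec_eq_iff
    proof
      fix i show "(v + (x - 1) *\<^sub>R v) $ i = (complex_of_real x *s v) $ i"
        by (simp add: scaleR_conv_of_real[of _ "v $ i"] algebra_simps)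
    qed
    ultimately have "norm (comp_val n P (complex_of_real x *s v)) \<le> sup_norm (closed_nbhd \<epsilon>) n P"
      using sup_norm_upper[OF compact_closed_nbhd] by metis
    then show "norm (comp_val n P v) \<le> sup_norm (closed_nbhd \<epsilon>) n P / x ^ n"
      using x by (simp add: comp_val_scale norm_mult norm_power field_simps)
  qed
  then show ?thesis using x by (intro exI[of _ x]) (simp add: field_simps)
qed

text \<open>
  The factor exponential in \<open>n\<close> gained between nested neighbourhoods absorbs the number of
  sample points.
\<close>

lemma sandwich:
  assumes "0 \<le> \<epsilon>'" "\<epsilon>' < \<epsilon>"
  shows "\<exists>B>0. \<exists>S. \<forall>n. finite (S n) \<and> vec_cnj ` S n = S n \<and> (\<forall>P.
    sup_norm (closed_nbhd \<epsilon>') n P \<le> B * sqrt (\<Sum>w\<in>S n. (norm (comp_val n P w))\<^sup>2) \<and>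
    (real n + 1) * sqrt (\<Sum>w\<in>S n. (norm (comp_val n P w))\<^sup>2) \<le> B * sup_norm (closed_nbhd \<epsilon>) n P)"
proof -
  define d where "d = (\<epsilon> - \<epsilon>') / 3"
  have d: "0 < d" "\<epsilon>' + d + d < \<epsilon>"
  proof -
    have "3 * d = \<epsilon> - \<epsilon>'" by (simp add: d_def)
    then show "0 < d" "\<epsilon>' + d + d < \<epsilon>" using assms by linarith+
  qed
  let ?a = "\<epsilon>' + d" and ?b = "\<epsilon>' + d + d"
  obtain x where x: "1 < x" "\<And>n P. x ^ n * sup_norm (closed_nbhd \<epsilon>') n P \<le> sup_norm (closed_nbhd ?a) n P"
    using sup_norm_gain[of \<epsilon>' ?a] assms d by auto
  obtain y where y: "1 < y" "\<And>n P. y ^ n * sup_norm (closed_nbhd ?b) n P \<le> sup_norm (closed_nbhd \<epsilon>) n P"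
    using sup_norm_gain[of ?b \<epsilon>] assms d by auto
  let ?L = "CARD('n)"
  obtain B1 where B1: "0 < B1" "\<And>n. (real n + 1) ^ ?L \<le> B1 * x ^ n" using poly_le_exp[OF x(1)] by blast
  \<comment> \<open>The exponent is one higher than the number of points requires: it also pays for
    the factor \<open>n + 1\<close>, which later makes the bounds square summable over all
    degrees.\<close>
  obtain B2 where B2: "0 < B2" "\<And>n. (real n + 1) ^ (?L + 1) \<le> B2 * y ^ n" using poly_le_exp[OF y(1)] by blast
  have "\<exists>m. \<forall>n. \<exists>S. finite S \<and> S \<subseteq> closed_nbhd ?b \<and> vec_cnj ` S = S \<and> card S \<le> m * (n + 1) ^ ?L \<and>
    (\<forall>P. sup_norm (closed_nbhd ?a) n P \<le> (\<Sum>w\<in>S. norm (comp_val n P w)))"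
    using assms d by (intro sup_norm_le_discrete[of _ d] compact_closed_nbhd closed_nbhd_ne closed_nbhd_add closed_nbhd_cnj) auto
  then obtain m S where S: "\<And>n. finite (S n)" "\<And>n. S n \<subseteq> closed_nbhd ?b" "\<And>n. vec_cnj ` S n = S n"
    "\<And>n. card (S n) \<le> m * (n + 1) ^ ?L" "\<And>n P. sup_norm (closed_nbhd ?a) n P \<le> (\<Sum>w\<in>S n. norm (comp_val n P w))"
    by metis
  let ?q = "\<lambda>n P. sqrt (\<Sum>w\<in>S n. (norm (comp_val n P w))\<^sup>2)"
  have q: "norm (comp_val n P w) \<le> ?q n P" if "w \<in> S n" for n P w
    using member_le_sum[of w "S n" "\<lambda>w. (norm (comp_val n P w))\<^sup>2"] that S(1) by (intro real_le_rsqrt) auto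
  have q0: "0 \<le> ?q n P" for n P by (simp add: sum_nonneg)
  have cardS: "real (card (S n)) \<le> real m * (real n + 1) ^ ?L" for n
    using of_nat_mono[OF S(4)[of n], where 'a = real] by (simp add: add.commute)
  define B where "B = (real m + 1) * (B1 + B2)"
  have B: "0 < B" "real m * B1 \<le> B" "real m * B2 \<le> B"
    unfolding B_def using B1(1) B2(1) by (auto intro!: mult_pos_pos add_nonneg_pos mult_mono)
  have one: "sup_norm (closed_nbhd \<epsilon>') n P \<le> B * ?q n P" for n P
  proof -
    have "x ^ n * sup_norm (closed_nbhd \<epsilon>') n P \<le> (\<Sum>w\<in>S n. norm (comp_val n P w))" using x(2) S(5) order_trans by blast
    also have "\<dots> \<le> (\<Sum>w\<in>S n. ?q n P)" by (intro sum_mono q)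
    also have "\<dots> = real (card (S n)) * ?q n P" by simp
    also have "\<dots> \<le> (real m * (B1 * x ^ n)) * ?q n P"
      using q0 B1(2)[of n] by (intro mult_right_mono order_trans[OF cardS] mult_left_mono) auto
    finally have "x ^ n * sup_norm (closed_nbhd \<epsilon>') n P \<le> x ^ n * (real m * B1 * ?q n P)" by (simp add: mult_ac)
    then have "sup_norm (closed_nbhd \<epsilon>') n P \<le> real m * B1 * ?q n P" using x(1) by simp
    also have "\<dots> \<le> B * ?q n P" using B q0 by (intro mult_right_mono) auto
    finally show ?thesis .
  qed
  have two: "(real n + 1) * ?q n P \<le> B * sup_norm (closed_nbhd \<epsilon>) n P" for n P
  proof -
    let ?s = "sup_norm (closed_nbhd ?b) n P"
    have s0: "0 \<le> ?s" "0 \<le> sup_norm (closed_nbhd \<epsilon>) n P" using assms d by (auto intro!: sup_norm_nonneg compact_closed_nbhd closed_nbhd_ne)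
    have "(\<Sum>w\<in>S n. (norm (comp_val n P w))\<^sup>2) \<le> (\<Sum>w\<in>S n. ?s\<^sup>2)"
      using S(2) by (intro sum_mono power_mono sup_norm_upper compact_closed_nbhd) auto
    also have "\<dots> = real (card (S n)) * ?s\<^sup>2" by simp
    also have "\<dots> \<le> (real (card (S n)) * ?s)\<^sup>2"
    proof -
      have "real (card (S n)) \<le> (real (card (S n)))\<^sup>2"
        by (metis of_nat_le_iff of_nat_power power2_nat_le_imp_le le_square power2_eq_square of_nat_mult)
      then show ?thesis unfolding power_mult_distrib by (intro mult_right_mono) auto
    qed
    finally have "?q n P \<le> sqrt ((real (card (S n)) * ?s)\<^sup>2)" by (rule real_sqrt_le_mono)
    also have "\<dots> = real (card (S n)) * ?s" using s0 by simp
    also have "\<dots> \<le> real m * (real n + 1) ^ ?L * ?s" using s0 cardS by (intro mult_right_mono) auto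
    finally have "(real n + 1) * ?q n P \<le> (real n + 1) * (real m * (real n + 1) ^ ?L * ?s)"
      by (intro mult_left_mono) auto
    also have "\<dots> = real m * (real n + 1) ^ (?L + 1) * ?s" by simp
    also have "\<dots> \<le> real m * (B2 * y ^ n) * ?s" using s0 B2(2)[of n] by (intro mult_right_mono mult_left_mono) auto
    also have "\<dots> = real m * B2 * (y ^ n * ?s)" by simp
    also have "\<dots> \<le> B * sup_norm (closed_nbhd \<epsilon>) n P"
      using B s0 y by (intro mult_mono y(2)) (auto intro!: mult_nonneg_nonneg)
    finally show ?thesis .
  qed
  show ?thesis using B(1) S(1,3) one two by (intro exI[of _ B] conjI exI[of _ S]) auto
qed

section \<open>A decreasing sequence of neighbourhoods with fixed sample points\<close>

definition nbhd_seq :: "nat \<Rightarrow> (complex ^ 'n) set" where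
  "nbhd_seq i = closed_nbhd (1 / real (Suc i))"

lemma nbhd_seq_mono: "i \<le> j \<Longrightarrow> nbhd_seq j \<subseteq> nbhd_seq i"
  unfolding nbhd_seq_def by (intro closed_nbhd_mono) (simp add: frac_le)

lemma compact_nbhd_seq: "compact (nbhd_seq i)" and nbhd_seq_ne: "nbhd_seq i \<noteq> {}" and nbhd_seq_zero: "0 \<in> nbhd_seq i"
  by (auto simp: nbhd_seq_def compact_closed_nbhd closed_nbhd_ne closed_nbhd_zero)

text \<open>Constants and points are bundled in a pair so that one choice fixes them together for
  all indices and degrees.\<close>

definition sample_points_spec :: "(nat \<Rightarrow> real) \<times> (nat \<Rightarrow> nat \<Rightarrow> (complex ^ 'n) set) \<Rightarrow> bool" where
  "sample_points_spec = (\<lambda>(B, S). \<forall>i. 0 < B i \<and> (\<forall>n. finite (S i n) \<and> vec_cnj ` S i n = S i n \<and> (\<forall>P.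
    sup_norm (nbhd_seq (Suc i)) n P \<le> B i * sqrt (\<Sum>w\<in>S i n. (norm (comp_val n P w))\<^sup>2) \<and>
    (real n + 1) * sqrt (\<Sum>w\<in>S i n. (norm (comp_val n P w))\<^sup>2) \<le> B i * sup_norm (nbhd_seq i) n P)))"

definition "sample_const = fst (SOME p. sample_points_spec p)"
definition "sample_points = snd (SOME p. sample_points_spec p)"

lemma sample_points_spec: "sample_points_spec (sample_const, sample_points)"
proof -
  have "\<forall>i. \<exists>B>0. \<exists>S. \<forall>n. finite (S n) \<and> vec_cnj ` S n = S n \<and> (\<forall>P.
    sup_norm (nbhd_seq (Suc i)) n P \<le> B * sqrt (\<Sum>w\<in>S n. (norm (comp_val n P w))\<^sup>2) \<and>
    (real n + 1) * sqrt (\<Sum>w\<in>S n. (norm (comp_val n P w))\<^sup>2) \<le> B * sup_norm (nbhd_seq i) n P)"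
    unfolding nbhd_seq_def by (intro allI sandwich) (auto simp: frac_less2)
  then obtain B S where "sample_points_spec (B, S)" unfolding sample_points_spec_def by (simp add: choice_iff) metis
  then have "sample_points_spec (SOME p. sample_points_spec p)" by (rule someI)
  then show ?thesis by (simp add: sample_const_def sample_points_def)
qed

definition sample_norm :: "nat \<Rightarrow> nat \<Rightarrow> 'n cpoly \<Rightarrow> real" where
  "sample_norm i n P = sqrt (\<Sum>w\<in>sample_points i n. (norm (comp_val n P w))\<^sup>2)"

lemma sample_const_pos: "0 < sample_const i" and finite_sample_points: "finite (sample_points i n)" and sample_points_cnj: "vec_cnj ` sample_points i n = sample_points i n"
  and sup_norm_le_sample_norm: "sup_norm (nbhd_seq (Suc i)) n P \<le> sample_const i * sample_norm i n P"
  and sample_norm_le_sup_norm: "(real n + 1) * sample_norm i n P \<le> sample_const i * sup_norm (nbhd_seq i) n P"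
  using sample_points_spec by (auto simp: sample_points_spec_def sample_norm_def)

lemma sample_norm_nonneg: "0 \<le> sample_norm i n P"
  by (simp add: sample_norm_def sum_nonneg)

lemma sample_norm_le_sup_norm': "sample_norm i n P \<le> sample_const i * sup_norm (nbhd_seq i) n P"
  using sample_norm_le_sup_norm[of n i P] mult_right_mono[of 1 "real n + 1" "sample_norm i n P"] sample_norm_nonneg[of i n P] by simp

text \<open>The sample norm dominates a sup norm on a neighbourhood, which contains a ball around 0
  because 0 belongs to \<open>K\<close>.\<close>

lemma sample_norm_eq_0:
  assumes "sample_norm i n P = 0" "\<alpha> \<in> monomials n"
  shows "lk P \<alpha> = 0"
proof (rule comp_val_zero_imp[OF _ _ assms(2)])
  show "(0::real) < 1 / real (Suc (Suc i))" by simp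
  fix v :: "complex ^ 'n" assume "norm v < 1 / real (Suc (Suc i))"
  then have "v \<in> nbhd_seq (Suc i)" unfolding nbhd_seq_def by (intro ball_sub_closed_nbhd) simp
  then have "norm (comp_val n P v) \<le> sup_norm (nbhd_seq (Suc i)) n P" by (rule sup_norm_upper[OF compact_nbhd_seq])
  also have "\<dots> \<le> 0" using sup_norm_le_sample_norm[of i n P] assms(1) by simp
  finally show "comp_val n P v = 0" by simp
qed

end

section \<open>Hilbertian seminorms from sample points\<close>

abbreviation degree_set :: "'n::finite cpoly \<Rightarrow> nat set" where
  "degree_set P \<equiv> mon_degree ` Poly_Mapping.keys P"

lemma keys_map_cnj: "Poly_Mapping.keys (Poly_Mapping.map cnj P) = Poly_Mapping.keys P"
  by (auto simp: in_keys_iff Poly_Mapping.map.rep_eq when_def)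

text \<open>The lattices live in real vector spaces, where the real part of the Hermitian form is
  the inner product to use.\<close>

lemma hilbertian_seminormD:
  assumes "hilbertian_seminorm h"
  obtains ip where "semi_inner_product ip h"
proof -
  from assms obtain \<Phi> where \<Phi>: "\<And>P Q S. \<Phi> (P + Q) S = \<Phi> P S + \<Phi> Q S"
    "\<And>c P Q. \<Phi> (Poly_Mapping.single 0 c * P) Q = c * \<Phi> P Q"
    "\<And>P Q. \<Phi> Q P = cnj (\<Phi> P Q)" "\<And>P. 0 \<le> Re (\<Phi> P P)" "\<And>P. h P = sqrt (Re (\<Phi> P P))"
    unfolding hilbertian_seminorm_def by blast
  have "semi_inner_product (\<lambda>P Q. Re (\<Phi> P Q)) h"
  proof
    show "Re (\<Phi> u v) = Re (\<Phi> v u)" for u v by (subst \<Phi>(3)) simp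
  qed (simp_all add: \<Phi>(1,2,4,5) scaleR_eq_single_mult)
  then show thesis by (rule that)
qed

lemma hilbertian_seminorm_nonneg: "hilbertian_seminorm h \<Longrightarrow> 0 \<le> h P"
  unfolding hilbertian_seminorm_def by (metis real_sqrt_ge_zero)

lemma hilbertian_seminorm_scaleR:
  assumes "hilbertian_seminorm h" "0 \<le> c"
  shows "hilbertian_seminorm (\<lambda>P. c * h P)"
proof -
  from assms obtain \<Phi> where \<Phi>: "\<And>P Q S. \<Phi> (P + Q) S = \<Phi> P S + \<Phi> Q S"
    "\<And>c P Q. \<Phi> (Poly_Mapping.single 0 c * P) Q = c * \<Phi> P Q"
    "\<And>P Q. \<Phi> Q P = cnj (\<Phi> P Q)" "\<And>P. 0 \<le> Re (\<Phi> P P)" "\<And>P. h P = sqrt (Re (\<Phi> P P))"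
    unfolding hilbertian_seminorm_def by blast
  have "c * h P = sqrt (Re (of_real (c\<^sup>2) * \<Phi> P P))" for P
    using assms(2) by (simp add: \<Phi>(5) real_sqrt_mult)
  moreover have "of_real (c\<^sup>2) * \<Phi> Q P = cnj (of_real (c\<^sup>2) * \<Phi> P Q)" for P Q
    by (subst \<Phi>(3)) simp
  ultimately show ?thesis
    unfolding hilbertian_seminorm_def
    by (intro exI[of _ "\<lambda>P Q. of_real (c\<^sup>2) * \<Phi> P Q"]) (simp add: \<Phi>(1,2,4) distrib_left)
qed

lemma hilbertian_seminorm_cmult:
  assumes "hilbertian_seminorm h"
  shows "h (Poly_Mapping.single 0 c * P) = norm c * h P"
proof -
  from assms obtain \<Phi> where \<Phi>: "\<And>c P Q. \<Phi> (Poly_Mapping.single 0 c * P) Q = c * \<Phi> P Q"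
    "\<And>P Q. \<Phi> Q P = cnj (\<Phi> P Q)" "\<And>P. 0 \<le> Re (\<Phi> P P)" "\<And>P. h P = sqrt (Re (\<Phi> P P))"
    unfolding hilbertian_seminorm_def by blast
  let ?P = "Poly_Mapping.single 0 c * P"
  have "\<Phi> ?P ?P = c * \<Phi> P ?P" by (rule \<Phi>(1))
  also have "\<Phi> P ?P = cnj (\<Phi> ?P P)" by (rule \<Phi>(2))
  also have "\<dots> = cnj c * cnj (\<Phi> P P)" by (simp add: \<Phi>(1))
  also have "cnj (\<Phi> P P) = \<Phi> P P" by (rule \<Phi>(2)[symmetric])
  finally have "\<Phi> ?P ?P = of_real ((norm c)\<^sup>2) * \<Phi> P P"
    using complex_norm_square[of c] by (simp add: mult.assoc)
  then have "Re (\<Phi> ?P ?P) = (norm c)\<^sup>2 * Re (\<Phi> P P)"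
    by (simp add: times_complex.sel)
  then show ?thesis by (simp add: \<Phi>(4) real_sqrt_mult)
qed

section \<open>Hilbert sums over all degrees\<close>

context circled_compact
begin

definition total_norm :: "nat \<Rightarrow> 'n cpoly \<Rightarrow> real" where
  "total_norm i P = sqrt (\<Sum>n\<in>degree_set P. (sample_norm i n P)\<^sup>2)"

lemma sample_norm_eq_0_degree_set: "n \<notin> degree_set P \<Longrightarrow> sample_norm i n P = 0"
  by (simp add: sample_norm_def comp_val_eq_0)

lemma total_norm_superset:
  assumes "finite A" "degree_set P \<subseteq> A" shows "total_norm i P = sqrt (\<Sum>n\<in>A. (sample_norm i n P)\<^sup>2)"
  unfolding total_norm_def using assms by (intro arg_cong[of _ _ sqrt] sum.mono_neutral_left) (auto simp: sample_norm_eq_0_degree_set)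

lemma total_norm_homogeneous:
  assumes "homogeneous n P" shows "total_norm i P = sample_norm i n P"
proof -
  have "degree_set P \<subseteq> {n}" using assms by (auto simp: homogeneous_iff monomials_def)
  from total_norm_superset[OF _ this] show ?thesis by (simp add: sample_norm_nonneg)
qed

lemma sample_norm_le_total_norm: "sample_norm i n P \<le> total_norm i P"
proof (cases "n \<in> degree_set P")
  case True
  then show ?thesis unfolding total_norm_def
    using member_le_sum[of n "degree_set P" "\<lambda>n. (sample_norm i n P)\<^sup>2"] by (intro real_le_rsqrt) auto
next
  case False
  then show ?thesis using sample_norm_eq_0_degree_set by (simp add: total_norm_def sum_nonneg)
qed

lemma hilbertian_total_norm: "hilbertian_seminorm (total_norm i)"
proof -
  define \<Psi> where "\<Psi> n P Q = (\<Sum>w\<in>sample_points i n. comp_val n P w * cnj (comp_val n Q w))" for n P Q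
  \<comment> \<open>Summing over the common degrees is symmetric in both arguments; since all other
    degrees contribute 0, \<open>sup\<close> may enlarge the index set to that of one argument,
    which makes linearity visible.\<close>
  define \<Phi> where "\<Phi> P Q = (\<Sum>n\<in>degree_set P \<inter> degree_set Q. \<Psi> n P Q)" for P Q
  have sup: "\<Phi> P Q = (\<Sum>n\<in>A. \<Psi> n P Q)" if "finite A" "degree_set P \<subseteq> A \<or> degree_set Q \<subseteq> A" for A P Q
  proof -
    have "\<Psi> n P Q = 0" if "n \<notin> degree_set P \<inter> degree_set Q" for n
      using that comp_val_eq_0[of n P] comp_val_eq_0[of n Q] by (auto simp: \<Psi>_def)
    then show ?thesis
      unfolding \<Phi>_def using that by (intro sum.mono_neutral_left) auto
  qed
  show ?thesis
    unfolding hilbertian_seminorm_def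
  proof (intro exI[of _ \<Phi>] conjI allI)
    fix P Q S :: "'n cpoly" and c
    have "\<Phi> X S = (\<Sum>n\<in>degree_set S. \<Psi> n X S)" for X by (rule sup) auto
    then show "\<Phi> (P + Q) S = \<Phi> P S + \<Phi> Q S"
      by (simp add: \<Psi>_def comp_val_add distrib_right sum.distrib)
    have "\<Phi> X Q = (\<Sum>n\<in>degree_set Q. \<Psi> n X Q)" for X by (rule sup) auto
    then show "\<Phi> (Poly_Mapping.single 0 c * P) Q = c * \<Phi> P Q"
      by (simp add: \<Psi>_def comp_val_cmult sum_distrib_left mult.assoc)
    show "\<Phi> Q P = cnj (\<Phi> P Q)"
      by (simp add: \<Phi>_def \<Psi>_def Int_commute mult.commute)
    have "Re (\<Psi> n P P) = (sample_norm i n P)\<^sup>2" for n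
    proof -
      have "Re (z * cnj z) = (norm z)\<^sup>2" for z
        by (simp only: complex_norm_square[symmetric] Re_complex_of_real)
      then show ?thesis by (simp add: \<Psi>_def sample_norm_def sum_nonneg)
    qed
    then have "Re (\<Phi> P P) = (\<Sum>n\<in>degree_set P. (sample_norm i n P)\<^sup>2)" by (simp add: \<Phi>_def)
    then show "0 \<le> Re (\<Phi> P P)" "total_norm i P = sqrt (Re (\<Phi> P P))" by (simp_all add: total_norm_def sum_nonneg)
  qed
qed

lemma sample_norm_cnj: "sample_norm i n (Poly_Mapping.map cnj P) = sample_norm i n P"
proof -
  have "(\<Sum>w\<in>sample_points i n. (norm (comp_val n (Poly_Mapping.map cnj P) w))\<^sup>2) = (\<Sum>w\<in>sample_points i n. (norm (comp_val n P (vec_cnj w)))\<^sup>2)"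
    by (simp add: comp_val_cnj)
  also have "\<dots> = (\<Sum>w\<in>vec_cnj ` sample_points i n. (norm (comp_val n P w))\<^sup>2)"
    by (subst sum.reindex) (auto intro: inj_on_inverseI[of _ vec_cnj])
  finally show ?thesis by (simp add: sample_norm_def sample_points_cnj)
qed

lemma total_norm_cnj: "total_norm i (Poly_Mapping.map cnj P) = total_norm i P"
  by (simp add: total_norm_def sample_norm_cnj keys_map_cnj)

text \<open>In each degree both sample norms are compared with the sup norm on the neighbourhood of
  index \<open>Suc i\<close>, which lies between them.\<close>

lemma total_norm_Suc_le: "total_norm (Suc i) P \<le> sample_const (Suc i) * sample_const i * total_norm i P"
proof -
  let ?C = "sample_const (Suc i) * sample_const i"
  have C: "0 \<le> ?C" by (intro mult_nonneg_nonneg less_imp_le sample_const_pos)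
  have q: "sample_norm (Suc i) n P \<le> ?C * sample_norm i n P" for n
    using order_trans[OF sample_norm_le_sup_norm' mult_left_mono[OF sup_norm_le_sample_norm]] sample_const_pos[of "Suc i"] by (simp add: mult.assoc)
  have "(\<Sum>n\<in>degree_set P. (sample_norm (Suc i) n P)\<^sup>2) \<le> (\<Sum>n\<in>degree_set P. (?C * sample_norm i n P)\<^sup>2)"
    by (intro sum_mono power_mono q sample_norm_nonneg)
  also have "\<dots> = ?C\<^sup>2 * (\<Sum>n\<in>degree_set P. (sample_norm i n P)\<^sup>2)" by (simp only: power_mult_distrib sum_distrib_left)
  finally have "total_norm (Suc i) P \<le> sqrt (?C\<^sup>2 * (\<Sum>n\<in>degree_set P. (sample_norm i n P)\<^sup>2))"
    unfolding total_norm_def by (rule real_sqrt_le_mono)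
  also have "\<dots> = ?C * total_norm i P" unfolding real_sqrt_mult total_norm_def using C by simp
  finally show ?thesis .
qed

text \<open>A bound uniform in the degree has to survive a sum of squares over all degrees; the
  factor \<open>n + 1\<close> of the sandwich turns it into the convergent series of inverse
  squares.\<close>

lemma total_norm_le_sup_norm:
  assumes R: "\<And>n. sup_norm (nbhd_seq i) n P \<le> R"
  shows "total_norm i P \<le> sample_const i * R * sqrt (suminf (\<lambda>n. 1 / (real n + 1)\<^sup>2))"
proof -
  have R0: "0 \<le> R" using R[of 0] sup_norm_nonneg[OF compact_nbhd_seq nbhd_seq_ne, of i 0 P] by linarith
  have sm: "summable (\<lambda>n. 1 / (real n + 1)\<^sup>2)"
    using sums_summable[OF inverse_squares_sums] by (simp add: add.commute)
  have q: "sample_norm i n P \<le> sample_const i * R / (real n + 1)" for n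
  proof -
    have "(real n + 1) * sample_norm i n P \<le> sample_const i * R"
      using order_trans[OF sample_norm_le_sup_norm mult_left_mono[OF R]] sample_const_pos[of i] by simp
    then show ?thesis by (simp add: field_simps)
  qed
  have "(\<Sum>n\<in>degree_set P. (sample_norm i n P)\<^sup>2) \<le> (\<Sum>n\<in>degree_set P. (sample_const i * R / (real n + 1))\<^sup>2)"
    by (intro sum_mono power_mono q sample_norm_nonneg)
  also have "\<dots> = (sample_const i * R)\<^sup>2 * (\<Sum>n\<in>degree_set P. 1 / (real n + 1)\<^sup>2)"
    unfolding sum_distrib_left by (intro sum.cong) (auto simp: power_divide)
  also have "\<dots> \<le> (sample_const i * R)\<^sup>2 * (suminf (\<lambda>n. 1 / (real n + 1)\<^sup>2))"
    by (intro mult_left_mono sum_le_suminf sm) auto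
  finally have "total_norm i P \<le> sqrt ((sample_const i * R)\<^sup>2 * (suminf (\<lambda>n. 1 / (real n + 1)\<^sup>2)))"
    unfolding total_norm_def by (rule real_sqrt_le_mono)
  then show ?thesis using R0 sample_const_pos[of i] by (simp add: real_sqrt_mult)
qed

text \<open>The factors are the inverses of the constants lost at each step, so that the sequence
  becomes decreasing.\<close>

definition std_norm :: "nat \<Rightarrow> 'n cpoly \<Rightarrow> real" where
  "std_norm i P = (\<Prod>j<i. 1 / (sample_const (Suc j) * sample_const j)) * total_norm i P"

lemma std_norm_const_pos: "0 < (\<Prod>j<i. 1 / (sample_const (Suc j) * sample_const j))"
  using sample_const_pos by (intro prod_pos) simp

lemma hilbertian_std_norm: "hilbertian_seminorm (std_norm i)"
  unfolding std_norm_def[abs_def] using std_norm_const_pos[of i] by (intro hilbertian_seminorm_scaleR hilbertian_total_norm) simp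

lemma std_norm_cnj: "std_norm i (Poly_Mapping.map cnj P) = std_norm i P"
  by (simp add: std_norm_def total_norm_cnj)

lemma std_norm_Suc_le: "std_norm (Suc i) P \<le> std_norm i P"
proof -
  have "1 / (sample_const (Suc i) * sample_const i) * total_norm (Suc i) P \<le> total_norm i P"
    using total_norm_Suc_le[of i P] sample_const_pos[of i] sample_const_pos[of "Suc i"] by (simp add: divide_le_eq mult_ac)
  from mult_left_mono[OF this less_imp_le[OF std_norm_const_pos[of i]]] show ?thesis
    by (simp add: std_norm_def)
qed

text \<open>Passing from sample norms to sup norms loses one index, which the existential quantifier
  over indices absorbs.\<close>

lemma std_norm_bounded_iff:
  "(\<exists>i. \<exists>R>0. \<forall>P\<in>B. std_norm i P \<le> R) \<longleftrightarrow> (\<exists>i R. \<forall>P\<in>B. \<forall>n. sup_norm (nbhd_seq i) n P \<le> R)"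
proof
  assume "\<exists>i. \<exists>R>0. \<forall>P\<in>B. std_norm i P \<le> R"
  then obtain i R where R: "0 < R" "\<And>P. P \<in> B \<Longrightarrow> std_norm i P \<le> R" by blast
  let ?c = "\<Prod>j<i. 1 / (sample_const (Suc j) * sample_const j)"
  have "sup_norm (nbhd_seq (Suc i)) n P \<le> sample_const i * (R / ?c)" if "P \<in> B" for n P
  proof -
    have "total_norm i P \<le> R / ?c"
      using R(2)[OF that] std_norm_const_pos[of i] unfolding std_norm_def by (simp add: pos_le_divide_eq mult.commute)
    then have "sample_norm i n P \<le> R / ?c" by (rule order_trans[OF sample_norm_le_total_norm])
    from order_trans[OF sup_norm_le_sample_norm mult_left_mono[OF this less_imp_le[OF sample_const_pos]]] show ?thesis .
  qed
  then show "\<exists>i R. \<forall>P\<in>B. \<forall>n. sup_norm (nbhd_seq i) n P \<le> R" by blast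
next
  assume "\<exists>i R. \<forall>P\<in>B. \<forall>n. sup_norm (nbhd_seq i) n P \<le> R"
  then obtain i R where R: "\<And>P n. P \<in> B \<Longrightarrow> sup_norm (nbhd_seq i) n P \<le> R" by blast
  let ?D = "(\<Prod>j<i. 1 / (sample_const (Suc j) * sample_const j)) * (sample_const i * R * sqrt (suminf (\<lambda>n. 1 / (real n + 1)\<^sup>2)))"
  have "std_norm i P \<le> max 1 ?D" if "P \<in> B" for P
  proof -
    have "std_norm i P \<le> ?D"
      unfolding std_norm_def using std_norm_const_pos[of i] R[OF that] by (intro mult_left_mono total_norm_le_sup_norm) auto
    then show ?thesis by simp
  qed
  then show "\<exists>i. \<exists>R>0. \<forall>P\<in>B. std_norm i P \<le> R" by (intro exI[of _ i] exI[of _ "max 1 ?D"]) auto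
qed

end

section \<open>Chebyshev constants\<close>

abbreviation xmonom :: "('n::finite \<Rightarrow>\<^sub>0 nat) \<Rightarrow> 'n cpoly" where
  "xmonom \<alpha> \<equiv> Poly_Mapping.single \<alpha> 1"

text \<open>The coefficients are real because distances are taken in the real span of the
  lattice.\<close>

definition lowers :: "('n::finite \<Rightarrow>\<^sub>0 nat) \<Rightarrow> 'n cpoly set" where
  "lowers \<alpha> = {Q. \<forall>\<beta>\<in>Poly_Mapping.keys Q. mon_degree \<beta> = mon_degree \<alpha> \<and> mon_rank \<beta> < mon_rank \<alpha> \<and> lk Q \<beta> \<in> \<real>}"

definition lead_inf :: "('n::finite cpoly \<Rightarrow> real) \<Rightarrow> ('n \<Rightarrow>\<^sub>0 nat) \<Rightarrow> real" where
  "lead_inf f \<alpha> = Inf ((\<lambda>Q. f (xmonom \<alpha> + Q)) ` lowers \<alpha>)"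

lemma zero_in_lowers: "0 \<in> lowers \<alpha>"
  by (simp add: lowers_def)

lemma homogeneous_add: "homogeneous n P \<Longrightarrow> homogeneous n Q \<Longrightarrow> homogeneous n (P + Q)"
  unfolding homogeneous_iff using keys_add[of P Q] by blast

lemma homogeneous_lowers: "Q \<in> lowers \<alpha> \<Longrightarrow> homogeneous (mon_degree \<alpha>) Q"
  by (auto simp: lowers_def homogeneous_iff monomials_def)

lemma homogeneous_xmonom: "homogeneous (mon_degree \<alpha>) (xmonom \<alpha>)"
  by (simp add: homogeneous_iff monomials_def)

lemma homogeneous_lead: "Q \<in> lowers \<alpha> \<Longrightarrow> homogeneous (mon_degree \<alpha>) (xmonom \<alpha> + Q)"
  by (intro homogeneous_add homogeneous_xmonom homogeneous_lowers)

lemma lead_inf_le: "(\<And>P. 0 \<le> f P) \<Longrightarrow> Q \<in> lowers \<alpha> \<Longrightarrow> lead_inf f \<alpha> \<le> f (xmonom \<alpha> + Q)"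
  unfolding lead_inf_def by (intro cINF_lower bdd_belowI[of _ 0]) auto

lemma lead_inf_ge: "(\<And>Q. Q \<in> lowers \<alpha> \<Longrightarrow> b \<le> f (xmonom \<alpha> + Q)) \<Longrightarrow> b \<le> lead_inf f \<alpha>"
  unfolding lead_inf_def using zero_in_lowers by (intro cINF_greatest) auto

lemma lead_inf_mono:
  assumes f: "\<And>P. 0 \<le> f P" and C: "0 < C"
    and le: "\<And>P. homogeneous (mon_degree \<alpha>) P \<Longrightarrow> f P \<le> C * f' P"
  shows "lead_inf f \<alpha> \<le> C * lead_inf f' \<alpha>"
proof -
  have "lead_inf f \<alpha> / C \<le> lead_inf f' \<alpha>"
  proof (rule lead_inf_ge)
    fix Q assume Q: "Q \<in> lowers \<alpha>"
    have "lead_inf f \<alpha> \<le> C * f' (xmonom \<alpha> + Q)"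
      using lead_inf_le[of f, OF f Q] le[OF homogeneous_lead[OF Q]] by linarith
    then show "lead_inf f \<alpha> / C \<le> f' (xmonom \<alpha> + Q)" using C by (simp add: field_simps)
  qed
  then show ?thesis using C by (simp add: field_simps)
qed

lemma mult_as_sum_single:
  "P * Q = (\<Sum>\<alpha>\<in>Poly_Mapping.keys P. \<Sum>\<beta>\<in>Poly_Mapping.keys Q. Poly_Mapping.single (\<alpha> + \<beta>) (lk P \<alpha> * lk Q \<beta>))"
  by (subst poly_as_sum_single[of P], subst poly_as_sum_single[of Q]) (simp add: sum_product mult_single)

lemma mult_real_coeffs:
  fixes P Q :: "'n::finite cpoly"
  assumes "\<And>\<alpha>. lk P \<alpha> \<in> \<real>" "\<And>\<alpha>. lk Q \<alpha> \<in> \<real>"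
  shows "lk (P * Q) \<gamma> \<in> \<real>"
  unfolding mult_as_sum_single lookup_sum lookup_single
  using assms by (intro sum_in_Reals) (auto simp: when_def)

lemma lowers_real: "Q \<in> lowers \<alpha> \<Longrightarrow> lk Q \<beta> \<in> \<real>"
  by (cases "\<beta> \<in> Poly_Mapping.keys Q") (auto simp: lowers_def in_keys_iff)

text \<open>Every cross term contains a factor of strictly smaller rank, and ranks are positive and
  multiply. Hence products of polynomials with given leading monomials compete for the product
  monomial, the source of submultiplicativity.\<close>

lemma lead_mult:
  fixes P Q :: "'n::finite cpoly"
  assumes P: "P \<in> lowers \<alpha>" and Q: "Q \<in> lowers \<beta>"
  shows "\<exists>R\<in>lowers (\<alpha> + \<beta>). (xmonom \<alpha> + P) * (xmonom \<beta> + Q) = xmonom (\<alpha> + \<beta>) + R"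
proof
  let ?R = "xmonom \<alpha> * Q + P * xmonom \<beta> + P * Q"
  show "(xmonom \<alpha> + P) * (xmonom \<beta> + Q) = xmonom (\<alpha> + \<beta>) + ?R"
    by (simp add: distrib_left distrib_right mult_single add_ac)
  have real: "lk ?R \<gamma> \<in> \<real>" for \<gamma>
    unfolding lookup_add using lowers_real[OF P] lowers_real[OF Q]
    by (intro Reals_add mult_real_coeffs) (auto simp: lookup_single when_def)
  have P': "mon_degree a = mon_degree \<alpha>" "mon_rank a < mon_rank \<alpha>" if "a \<in> Poly_Mapping.keys P" for a
    using P that by (auto simp: lowers_def)
  have Q': "mon_degree a = mon_degree \<beta>" "mon_rank a < mon_rank \<beta>" if "a \<in> Poly_Mapping.keys Q" for a
    using Q that by (auto simp: lowers_def)
  show "?R \<in> lowers (\<alpha> + \<beta>)"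
    unfolding lowers_def
  proof (intro CollectI ballI conjI real)
    fix \<gamma> assume "\<gamma> \<in> Poly_Mapping.keys ?R"
    then have "\<gamma> \<in> Poly_Mapping.keys (xmonom \<alpha> * Q) \<union> Poly_Mapping.keys (P * xmonom \<beta>) \<union> Poly_Mapping.keys (P * Q)"
      using keys_add[of "xmonom \<alpha> * Q + P * xmonom \<beta>" "P * Q"] keys_add[of "xmonom \<alpha> * Q" "P * xmonom \<beta>"] by blast
    moreover have "mon_degree \<gamma> = mon_degree (\<alpha> + \<beta>) \<and> mon_rank \<gamma> < mon_rank (\<alpha> + \<beta>)" if \<gamma>: "\<gamma> \<in> Poly_Mapping.keys (xmonom \<alpha> * Q)"
    proof -
      obtain b where b: "b \<in> Poly_Mapping.keys Q" "\<gamma> = \<alpha> + b" using \<gamma> keys_mult[of "xmonom \<alpha>" Q] by auto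
      then show ?thesis using Q'[OF b(1)] mon_rank_pos[of \<alpha>] by (simp add: mon_degree_add mon_rank_add)
    qed
    moreover have "mon_degree \<gamma> = mon_degree (\<alpha> + \<beta>) \<and> mon_rank \<gamma> < mon_rank (\<alpha> + \<beta>)" if \<gamma>: "\<gamma> \<in> Poly_Mapping.keys (P * xmonom \<beta>)"
    proof -
      obtain a where a: "a \<in> Poly_Mapping.keys P" "\<gamma> = a + \<beta>" using \<gamma> keys_mult[of P "xmonom \<beta>"] by auto
      then show ?thesis using P'[OF a(1)] mon_rank_pos[of \<beta>] by (simp add: mon_degree_add mon_rank_add)
    qed
    moreover have "mon_degree \<gamma> = mon_degree (\<alpha> + \<beta>) \<and> mon_rank \<gamma> < mon_rank (\<alpha> + \<beta>)" if \<gamma>: "\<gamma> \<in> Poly_Mapping.keys (P * Q)"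
    proof -
      obtain a b where ab: "a \<in> Poly_Mapping.keys P" "b \<in> Poly_Mapping.keys Q" "\<gamma> = a + b"
        using \<gamma> keys_mult[of P Q] by auto
      then show ?thesis using P'[OF ab(1)] Q'[OF ab(2)] by (simp add: mon_degree_add mon_rank_add mult_strict_mono)
    qed
    ultimately show "mon_degree \<gamma> = mon_degree (\<alpha> + \<beta>)" "mon_rank \<gamma> < mon_rank (\<alpha> + \<beta>)" by auto
  qed
qed

section \<open>Monomials as a lattice basis, and the arithmetic degree\<close>

lemma inj_xmonom: "inj (xmonom :: ('n::finite \<Rightarrow>\<^sub>0 nat) \<Rightarrow> _)"
proof (rule injI)
  fix \<alpha> \<beta> :: "'n \<Rightarrow>\<^sub>0 nat" assume "xmonom \<alpha> = xmonom \<beta>"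
  then have "Poly_Mapping.keys (xmonom \<alpha>) = Poly_Mapping.keys (xmonom \<beta>)" by simp
  then show "\<alpha> = \<beta>" by simp
qed

lemma lookup_sum_xmonom:
  assumes "finite A"
  shows "lk (\<Sum>\<alpha>\<in>A. u \<alpha> *\<^sub>R xmonom \<alpha>) \<beta> = (if \<beta> \<in> A then complex_of_real (u \<beta>) else 0)"
proof -
  have "lk (\<Sum>\<alpha>\<in>A. u \<alpha> *\<^sub>R xmonom \<alpha>) \<beta> = (\<Sum>\<alpha>\<in>A. if \<alpha> = \<beta> then complex_of_real (u \<alpha>) else 0)"
    unfolding lookup_sum by (intro sum.cong) (auto simp: lookup_single when_def scaleR_conv_of_real)
  then show ?thesis using assms by simp
qed

lemma real_poly_as_sum:
  assumes "finite A" "Poly_Mapping.keys P \<subseteq> A" "\<And>\<beta>. lk P \<beta> \<in> \<real>"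
  shows "P = (\<Sum>\<alpha>\<in>A. Re (lk P \<alpha>) *\<^sub>R xmonom \<alpha>)"
proof (rule poly_mapping_eqI)
  fix \<beta>
  show "lk P \<beta> = lk (\<Sum>\<alpha>\<in>A. Re (lk P \<alpha>) *\<^sub>R xmonom \<alpha>) \<beta>"
    unfolding lookup_sum_xmonom[OF assms(1)] using assms(2) assms(3)[of \<beta>] by (auto simp: in_keys_iff of_real_Re)
qed

lemma independent_xmonom: "finite A \<Longrightarrow> independent (xmonom ` A :: 'n::finite cpoly set)"
proof -
  assume A: "finite A"
  then have fin: "finite (xmonom ` A :: 'n cpoly set)" by simp
  have inj: "inj_on xmonom A" using inj_xmonom by (rule inj_on_subset) simp
  show ?thesis
    unfolding dependent_finite[OF fin]
  proof
    assume "\<exists>u. (\<exists>v\<in>xmonom ` A. u v \<noteq> 0) \<and> (\<Sum>v\<in>xmonom ` A. u v *\<^sub>R v) = (0 :: 'n cpoly)"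
    then obtain u \<beta> where u: "\<beta> \<in> A" "u (xmonom \<beta>) \<noteq> 0" "(\<Sum>v\<in>xmonom ` A. u v *\<^sub>R v) = (0 :: 'n cpoly)" by auto
    then have "(\<Sum>\<alpha>\<in>A. u (xmonom \<alpha>) *\<^sub>R xmonom \<alpha>) = (0 :: 'n cpoly)" by (simp add: sum.reindex[OF inj])
    then have "lk (\<Sum>\<alpha>\<in>A. u (xmonom \<alpha>) *\<^sub>R xmonom \<alpha> :: 'n cpoly) \<beta> = 0" by simp
    then show False using u by (simp add: lookup_sum_xmonom[OF A])
  qed
qed

lemma lattice_basis_integral: "lattice_basis (integral_sections n) (xmonom ` monomials n :: 'n::finite cpoly set)"
  unfolding lattice_basis_def
proof (intro conjI independent_xmonom finite_imageI finite_monomials)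
  have inj: "inj_on xmonom (monomials n :: ('n \<Rightarrow>\<^sub>0 nat) set)" using inj_xmonom by (rule inj_on_subset) simp
  show "integral_sections n = {\<Sum>b\<in>(xmonom ` monomials n :: 'n cpoly set). of_int (k b) *\<^sub>R b |k. True}"
  proof (intro set_eqI iffI)
    fix P :: "'n cpoly" assume P: "P \<in> integral_sections n"
    then have int: "lk P \<alpha> \<in> \<int>" for \<alpha> by (simp add: integral_sections_def)
    then have re: "lk P \<alpha> \<in> \<real>" "of_int \<lfloor>Re (lk P \<alpha>)\<rfloor> = Re (lk P \<alpha>)" for \<alpha>
      by (metis Ints_cases Reals_of_int) (metis int Ints_cases Re_complex_of_real floor_of_int of_real_of_int_eq)
    have "P = (\<Sum>\<alpha>\<in>monomials n. Re (lk P \<alpha>) *\<^sub>R xmonom \<alpha>)"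
      using P re by (intro real_poly_as_sum finite_monomials) (auto simp: integral_sections_def homogeneous_iff)
    also have "\<dots> = (\<Sum>b\<in>xmonom ` monomials n. of_int \<lfloor>Re (lk P (inv xmonom b))\<rfloor> *\<^sub>R b)"
      by (subst sum.reindex[OF inj]) (simp add: inv_f_f[OF inj_xmonom] re)
    finally show "P \<in> {\<Sum>b\<in>xmonom ` monomials n. of_int (k b) *\<^sub>R b |k. True}"
      by (intro CollectI exI[of _ "\<lambda>b. \<lfloor>Re (lk P (inv xmonom b))\<rfloor>"]) simp
  next
    fix P :: "'n cpoly" assume "P \<in> {\<Sum>b\<in>xmonom ` monomials n. of_int (k b) *\<^sub>R b |k. True}"
    then obtain k where "P = (\<Sum>b\<in>xmonom ` monomials n. of_int (k b) *\<^sub>R b)" by blast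
    then have k: "P = (\<Sum>\<alpha>\<in>monomials n. of_int (k (xmonom \<alpha>)) *\<^sub>R xmonom \<alpha>)" by (simp add: sum.reindex[OF inj])
    have "lk P \<beta> = (if \<beta> \<in> monomials n then of_int (k (xmonom \<beta>)) else 0)" for \<beta>
      unfolding k lookup_sum_xmonom[OF finite_monomials] by simp
    then show "P \<in> integral_sections n"
      by (auto simp: integral_sections_def homogeneous_iff in_keys_iff split: if_splits)
  qed
qed

lemma span_xmonom:
  assumes A: "finite A"
  shows "span (xmonom ` A :: 'n::finite cpoly set) = {P. Poly_Mapping.keys P \<subseteq> A \<and> (\<forall>\<beta>. lk P \<beta> \<in> \<real>)}" (is "_ = ?R")
proof (intro antisym span_minimal)
  show "xmonom ` A \<subseteq> ?R" by (auto simp: lookup_single when_def)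
  show "subspace ?R"
    unfolding subspace_def
  proof (intro conjI ballI allI)
    fix P Q :: "'n cpoly" and c :: real assume P: "P \<in> ?R" "Q \<in> ?R"
    then show "P + Q \<in> ?R" using keys_add[of P Q] by (auto simp: lookup_add)
  next
    fix P :: "'n cpoly" and c :: real assume P: "P \<in> ?R"
    then show "c *\<^sub>R P \<in> ?R" by (auto simp: in_keys_iff scaleR_conv_of_real)
  qed simp
  show "?R \<subseteq> span (xmonom ` A)"
  proof
    fix P :: "'n cpoly" assume "P \<in> ?R"
    then have "P = (\<Sum>\<alpha>\<in>A. Re (lk P \<alpha>) *\<^sub>R xmonom \<alpha>)" using A by (intro real_poly_as_sum) auto
    moreover have "\<dots> \<in> span (xmonom ` A)" by (intro span_sum span_scale span_base) auto
    ultimately show "P \<in> span (xmonom ` A)" by simp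
  qed
qed

lemma span_integral_sections:
  "span (integral_sections n :: 'n::finite cpoly set) = {P. homogeneous n P \<and> (\<forall>\<beta>. lk P \<beta> \<in> \<real>)}"
proof -
  have "span (integral_sections n :: 'n cpoly set) = span (xmonom ` monomials n)"
    by (rule span_lattice[OF lattice_basis_integral])
  then show ?thesis unfolding span_xmonom[OF finite_monomials] by (simp add: homogeneous_iff)
qed

lemma integral_sections_ne: "integral_sections n \<noteq> ({0} :: 'n::finite cpoly set)"
proof -
  obtain \<alpha> :: "'n \<Rightarrow>\<^sub>0 nat" where "\<alpha> \<in> monomials n" using monomials_nonempty by blast
  then have "xmonom \<alpha> \<in> integral_sections n"
    by (auto simp: integral_sections_def homogeneous_iff lookup_single when_def)
  moreover have "xmonom \<alpha> \<noteq> 0" by (metis keys_single keys_zero insert_not_empty zero_neq_one)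
  ultimately show ?thesis by blast
qed

text \<open>Separates the two branches of the arithmetic degree: without definiteness in degree
  \<open>n\<close> its value is \<infinity>.\<close>

definition degree_norm :: "nat \<Rightarrow> ('n::finite cpoly \<Rightarrow> real) \<Rightarrow> bool" where
  "degree_norm n h \<longleftrightarrow> (\<forall>v\<in>span (integral_sections n). v \<noteq> 0 \<longrightarrow> h v \<noteq> 0)"

text \<open>With the monomials numbered increasingly, the span of each initial segment is
  \<open>lowers\<close> of the next monomial, so the distances in the covolume formula are the
  \<open>lead_inf\<close>.\<close>

theorem arith_degree_eq_lead_inf:
  fixes h :: "'n::finite cpoly \<Rightarrow> real"
  assumes h: "hilbertian_seminorm h" and pos: "degree_norm n h"
  shows "arith_degree (integral_sections n) h = ereal (\<Sum>\<alpha>\<in>monomials n. - ln (lead_inf h \<alpha>))"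
    and "\<And>\<alpha>. \<alpha> \<in> monomials n \<Longrightarrow> 0 < lead_inf h \<alpha>"
proof -
  let ?d = "card (monomials n :: ('n \<Rightarrow>\<^sub>0 nat) set)"
  let ?M = "integral_sections n :: 'n cpoly set"
  obtain ip where "semi_inner_product ip h" using hilbertian_seminormD[OF h] by blast
  then interpret semi_inner_product ip h .
  obtain a where a: "bij_betw a {..<?d} (monomials n :: ('n \<Rightarrow>\<^sub>0 nat) set)"
    and rank: "\<And>j k. j < ?d \<Longrightarrow> k < ?d \<Longrightarrow> mon_rank (a j) < mon_rank (a k) \<longleftrightarrow> j < k"
    using monomials_enum[where 'n = 'n, of n] by metis
  let ?b = "\<lambda>k. xmonom (a k)"
  have "?b ` {..<?d} = xmonom ` (a ` {..<?d})" by (simp add: image_image)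
  then have im: "?b ` {..<?d} = xmonom ` monomials n" using a by (simp add: bij_betw_def)
  have aM: "a k \<in> monomials n" if "k < ?d" for k using a that by (auto simp: bij_betw_def)
  have inj: "inj_on ?b {..<?d}"
    using a inj_xmonom by (auto simp: bij_betw_def inj_on_def)
  have B: "lattice_basis ?M (?b ` {..<?d})" unfolding im by (rule lattice_basis_integral)
  have low: "span (?b ` {..<k}) = lowers (a k)" if k: "k < ?d" for k
  proof -
    have "?b ` {..<k} = xmonom ` (a ` {..<k})" by auto
    also have "span \<dots> = {P. Poly_Mapping.keys P \<subseteq> a ` {..<k} \<and> (\<forall>\<beta>. lk P \<beta> \<in> \<real>)}"
      by (rule span_xmonom) simp
    also have "a ` {..<k} = {\<beta>. mon_degree \<beta> = mon_degree (a k) \<and> mon_rank \<beta> < mon_rank (a k)}"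
    proof (intro set_eqI iffI)
      fix \<beta> :: "'n \<Rightarrow>\<^sub>0 nat" assume "\<beta> \<in> a ` {..<k}"
      then obtain j where j: "j < k" "\<beta> = a j" by auto
      then show "\<beta> \<in> {\<beta>. mon_degree \<beta> = mon_degree (a k) \<and> mon_rank \<beta> < mon_rank (a k)}"
        using rank[of j k] aM[of j] aM[OF k] k by (simp add: monomials_def)
    next
      fix \<beta> :: "'n \<Rightarrow>\<^sub>0 nat" assume \<beta>: "\<beta> \<in> {\<beta>. mon_degree \<beta> = mon_degree (a k) \<and> mon_rank \<beta> < mon_rank (a k)}"
      then have "\<beta> \<in> monomials n" using aM[OF k] by (simp add: monomials_def)
      then obtain j where j: "j < ?d" "\<beta> = a j" using a by (auto simp: bij_betw_def)
      then show "\<beta> \<in> a ` {..<k}" using rank[of j k] \<beta> k by auto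
    qed
    also have "{P. Poly_Mapping.keys P \<subseteq> {\<beta>. mon_degree \<beta> = mon_degree (a k) \<and> mon_rank \<beta> < mon_rank (a k)} \<and> (\<forall>\<beta>. lk P \<beta> \<in> \<real>)} = lowers (a k)"
      using lowers_real[of _ "a k"] by (auto simp: lowers_def in_keys_iff)
    finally show ?thesis .
  qed
  have lead: "lead_dist ?b k = lead_inf h (a k)" if "k < ?d" for k
    unfolding lead_dist_def lead_inf_def low[OF that] ..
  have nz: "h v \<noteq> 0" if "v \<in> span ?M" "v \<noteq> 0" for v using pos that by (simp add: degree_norm_def)
  have cov: "covol ?M h = (\<Prod>k<?d. lead_dist ?b k)" "\<And>k. k < ?d \<Longrightarrow> 0 < lead_dist ?b k"
    by (rule covol_eq_prod_lead_dist[OF B inj nz]; assumption)+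
  show lpos: "0 < lead_inf h \<alpha>" if "\<alpha> \<in> monomials n" for \<alpha>
  proof -
    obtain k where "k < ?d" "\<alpha> = a k" using a \<open>\<alpha> \<in> monomials n\<close> by (auto simp: bij_betw_def)
    then show ?thesis using cov(2)[of k] lead by simp
  qed
  have "covol ?M h = (\<Prod>k<?d. lead_inf h (a k))"
    unfolding cov(1) by (intro prod.cong) (auto simp: lead)
  also have "\<dots> = (\<Prod>\<alpha>\<in>monomials n. lead_inf h \<alpha>)" by (rule prod.reindex_bij_betw[OF a])
  finally have "covol ?M h = (\<Prod>\<alpha>\<in>monomials n. lead_inf h \<alpha>)" .
  moreover have "ln (\<Prod>\<alpha>\<in>monomials n. lead_inf h \<alpha>) = (\<Sum>\<alpha>\<in>monomials n. ln (lead_inf h \<alpha>))"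
    by (rule Transcendental.ln_prod[OF finite_monomials less_imp_neq[OF lpos, symmetric]])
  ultimately have "- ln (covol ?M h) = (\<Sum>\<alpha>\<in>monomials n. - ln (lead_inf h \<alpha>))"
    by (simp add: sum_negf)
  then show "arith_degree ?M h = ereal (\<Sum>\<alpha>\<in>monomials n. - ln (lead_inf h \<alpha>))"
    using pos integral_sections_ne[where 'n = 'n, of n] by (auto simp: arith_degree_def degree_norm_def)
qed

lemma arith_degree_infinity: "\<not> degree_norm n h \<Longrightarrow> arith_degree (integral_sections n) h = \<infinity>"
  using integral_sections_ne[of n] by (auto simp: arith_degree_def degree_norm_def)

text \<open>If \<open>h'\<close> is degenerate, the right-hand side is \<infinity>. Otherwise
  \<open>h\<close> is definite as well, and each of the distances, one per monomial, changes by at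
  most the factor \<open>C\<close>.\<close>

lemma arith_degree_mono:
  fixes h h' :: "'n::finite cpoly \<Rightarrow> real"
  assumes h: "hilbertian_seminorm h" "hilbertian_seminorm h'" and C: "0 < C" and le: "\<And>P. h' P \<le> C * h P"
  shows "arith_degree (integral_sections n) h \<le>
    arith_degree (integral_sections n) h' + ereal (real (card (monomials n :: ('n \<Rightarrow>\<^sub>0 nat) set)) * ln C)"
proof (cases "degree_norm n h'")
  case False
  then show ?thesis by (simp add: arith_degree_infinity)
next
  case True
  have "degree_norm n h"
    unfolding degree_norm_def
  proof (intro ballI impI notI)
    fix v assume v: "v \<in> span (integral_sections n)" "v \<noteq> 0" "h v = 0"
    then have "h' v \<le> 0" using le[of v] by simp
    then show False using True v hilbertian_seminorm_nonneg[OF h(2), of v] by (auto simp: degree_norm_def)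
  qed
  note A = arith_degree_eq_lead_inf[OF h(1) this] and A' = arith_degree_eq_lead_inf[OF h(2) True]
  have "- ln (lead_inf h \<alpha>) \<le> - ln (lead_inf h' \<alpha>) + ln C" if \<alpha>: "\<alpha> \<in> monomials n" for \<alpha>
  proof -
    have "lead_inf h' \<alpha> \<le> C * lead_inf h \<alpha>"
      by (rule lead_inf_mono[OF hilbertian_seminorm_nonneg[OF h(2)] C le])
    then have "ln (lead_inf h' \<alpha>) \<le> ln (C * lead_inf h \<alpha>)" using A'(2)[OF \<alpha>] by simp
    also have "\<dots> = ln C + ln (lead_inf h \<alpha>)" using C A(2)[OF \<alpha>] by (simp add: ln_mult)
    finally show ?thesis by simp
  qed
  then have "(\<Sum>\<alpha>\<in>monomials n. - ln (lead_inf h \<alpha>)) \<le> (\<Sum>\<alpha>\<in>monomials n. - ln (lead_inf h' \<alpha>) + ln C)"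
    by (intro sum_mono)
  also have "\<dots> = (\<Sum>\<alpha>\<in>monomials n. - ln (lead_inf h' \<alpha>)) + real (card (monomials n :: ('n \<Rightarrow>\<^sub>0 nat) set)) * ln C"
    by (subst sum.distrib) simp
  finally show ?thesis unfolding A(1) A'(1) by simp
qed

section \<open>Chebyshev constants of the sup norms\<close>

context circled_compact
begin

lemma degree_norm_total_norm: "degree_norm n (total_norm i)"
  unfolding degree_norm_def
proof (intro ballI impI notI)
  fix v :: "'n cpoly" assume v: "v \<in> span (integral_sections n)" "v \<noteq> 0" "total_norm i v = 0"
  have hom: "homogeneous n v" using v(1) by (simp add: span_integral_sections)
  have q: "sample_norm i n v = 0" using v(3) total_norm_homogeneous[OF hom] by simp
  have "lk v \<alpha> = 0" for \<alpha>
    using sample_norm_eq_0[OF q, of \<alpha>] hom by (cases "\<alpha> \<in> monomials n") (auto simp: homogeneous_iff in_keys_iff)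
  then show False using v(2) by (simp add: poly_mapping_eqI)
qed

text \<open>Taken for the sup norm, which is submultiplicative with constant 1. A sample norm would
  bring in a further factor at each product and spoil exact superadditivity.\<close>

definition chebyshev :: "nat \<Rightarrow> ('n \<Rightarrow>\<^sub>0 nat) \<Rightarrow> real" where
  "chebyshev i \<alpha> = lead_inf (sup_norm (nbhd_seq i) (mon_degree \<alpha>)) \<alpha>"

lemma lead_inf_total_norm_pos: "0 < lead_inf (total_norm i) \<alpha>"
  using arith_degree_eq_lead_inf(2)[OF hilbertian_total_norm degree_norm_total_norm, of \<alpha> "mon_degree \<alpha>"] by (simp add: monomials_def)

lemma lead_inf_total_norm_le: "lead_inf (total_norm i) \<alpha> \<le> sample_const i * chebyshev i \<alpha>"
  unfolding chebyshev_def
  by (rule lead_inf_mono[OF hilbertian_seminorm_nonneg[OF hilbertian_total_norm] sample_const_pos])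
    (simp add: total_norm_homogeneous sample_norm_le_sup_norm')

lemma chebyshev_le: "chebyshev (Suc i) \<alpha> \<le> sample_const i * lead_inf (total_norm i) \<alpha>"
  unfolding chebyshev_def
  by (rule lead_inf_mono[OF sup_norm_nonneg[OF compact_nbhd_seq nbhd_seq_ne] sample_const_pos])
    (simp add: total_norm_homogeneous sup_norm_le_sample_norm)

lemma chebyshev_pos: "0 < chebyshev i \<alpha>"
  using less_le_trans[OF lead_inf_total_norm_pos lead_inf_total_norm_le] sample_const_pos[of i] by (simp add: zero_less_mult_iff not_less_iff_gr_or_eq) (metis not_less_iff_gr_or_eq)

text \<open>Products of competitors for the two factors are competitors for the product. The infima
  need not be attained, so one factor is fixed while the other varies, dividing by a quantity known
  to be positive.\<close>

lemma chebyshev_add: "chebyshev i (\<alpha> + \<beta>) \<le> chebyshev i \<alpha> * chebyshev i \<beta>"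
proof -
  let ?f = "\<lambda>\<alpha>. sup_norm (nbhd_seq i) (mon_degree \<alpha>)"
  have nn: "0 \<le> sup_norm (nbhd_seq i) n P" for n P by (rule sup_norm_nonneg[OF compact_nbhd_seq nbhd_seq_ne])
  have key: "chebyshev i (\<alpha> + \<beta>) \<le> ?f \<alpha> (xmonom \<alpha> + P) * ?f \<beta> (xmonom \<beta> + Q)" if P: "P \<in> lowers \<alpha>" and Q: "Q \<in> lowers \<beta>" for P Q
  proof -
    obtain R where R: "R \<in> lowers (\<alpha> + \<beta>)" "(xmonom \<alpha> + P) * (xmonom \<beta> + Q) = xmonom (\<alpha> + \<beta>) + R"
      using lead_mult[OF P Q] by blast
    have "chebyshev i (\<alpha> + \<beta>) \<le> ?f (\<alpha> + \<beta>) (xmonom (\<alpha> + \<beta>) + R)"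
      unfolding chebyshev_def by (rule lead_inf_le[OF nn R(1)])
    also have "\<dots> \<le> ?f \<alpha> (xmonom \<alpha> + P) * ?f \<beta> (xmonom \<beta> + Q)"
      using sup_norm_mult[OF compact_nbhd_seq nbhd_seq_ne homogeneous_lead[OF P] homogeneous_lead[OF Q]] homogeneous_lead[OF R(1)]
      by (simp add: R(2) mon_degree_add)
    finally show ?thesis .
  qed
  have "chebyshev i (\<alpha> + \<beta>) / chebyshev i \<alpha> \<le> chebyshev i \<beta>"
    unfolding chebyshev_def[of i \<beta>]
  proof (rule lead_inf_ge)
    fix Q assume Q: "Q \<in> lowers \<beta>"
    have fpos: "0 < ?f \<beta> (xmonom \<beta> + Q)"
      using chebyshev_pos[of i \<beta>] lead_inf_le[OF nn Q] unfolding chebyshev_def by (rule less_le_trans)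
    have "chebyshev i (\<alpha> + \<beta>) / ?f \<beta> (xmonom \<beta> + Q) \<le> chebyshev i \<alpha>"
      unfolding chebyshev_def[of i \<alpha>]
    proof (rule lead_inf_ge)
      fix P assume "P \<in> lowers \<alpha>"
      then show "chebyshev i (\<alpha> + \<beta>) / ?f \<beta> (xmonom \<beta> + Q) \<le> ?f \<alpha> (xmonom \<alpha> + P)"
        using key[OF _ Q] fpos by (simp add: divide_le_eq)
    qed
    then show "chebyshev i (\<alpha> + \<beta>) / chebyshev i \<alpha> \<le> ?f \<beta> (xmonom \<beta> + Q)"
      using fpos chebyshev_pos[of i \<alpha>] by (simp add: divide_le_eq mult.commute)
  qed
  then show ?thesis using chebyshev_pos[of i \<alpha>] by (simp add: divide_le_eq mult.commute)
qed

text \<open>The monomial itself competes, and on a bounded set it is at most a power of the radius.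
  This is the linear lower bound for \<open>- ln\<close> that keeps the limits away from
  -\<infinity>.\<close>

lemma chebyshev_bound: "\<exists>C. \<forall>\<alpha>. ln (chebyshev i \<alpha>) \<le> C * real (mon_degree \<alpha>)"
proof -
  obtain R where R: "0 < R" "\<And>v. v \<in> nbhd_seq i \<Longrightarrow> norm v \<le> R" using closed_nbhd_bounded unfolding nbhd_seq_def by blast
  have "ln (chebyshev i \<alpha>) \<le> ln R * real (mon_degree \<alpha>)" for \<alpha>
  proof -
    have "chebyshev i \<alpha> \<le> sup_norm (nbhd_seq i) (mon_degree \<alpha>) (xmonom \<alpha> + 0)"
      unfolding chebyshev_def by (rule lead_inf_le[OF sup_norm_nonneg[OF compact_nbhd_seq nbhd_seq_ne] zero_in_lowers])
    also have "\<dots> \<le> R ^ mon_degree \<alpha>"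
    proof (rule sup_norm_least[OF nbhd_seq_ne])
      fix v assume v: "v \<in> nbhd_seq i"
      have "norm (comp_val (mon_degree \<alpha>) (xmonom \<alpha> + 0) v) = (\<Prod>j\<in>UNIV. norm (v $ j) ^ lk \<alpha> j)"
        by (simp add: comp_val_homogeneous[OF homogeneous_xmonom] poly_eval_single monom_val_def norm_power prod_norm[symmetric])
      also have "\<dots> \<le> (\<Prod>j\<in>UNIV. R ^ lk \<alpha> j)"
        using order_trans[OF Finite_Cartesian_Product.norm_nth_le R(2)[OF v]] by (intro prod_mono) (auto intro: power_mono)
      also have "\<dots> = R ^ mon_degree \<alpha>" by (simp add: mon_degree_def power_sum)
      finally show "norm (comp_val (mon_degree \<alpha>) (xmonom \<alpha> + 0) v) \<le> R ^ mon_degree \<alpha>" .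
    qed
    finally have "ln (chebyshev i \<alpha>) \<le> ln (R ^ mon_degree \<alpha>)" by (intro ln_mono chebyshev_pos)
    then show ?thesis using R(1) by (simp add: ln_realpow mult.commute)
  qed
  then show ?thesis by blast
qed

end

section \<open>Limits of arithmetic degrees\<close>

definition scaled_degree :: "nat \<Rightarrow> ('n::finite cpoly \<Rightarrow> real) \<Rightarrow> nat \<Rightarrow> ereal" where
  "scaled_degree r h n = ereal (fact r / real n ^ r) * arith_degree (integral_sections n) h"

text \<open>A bounded factor in each distance costs a multiple of the number of monomials, of order
  \<open>n ^ l\<close>, and disappears after division by \<open>n ^ (l + 1)\<close>.\<close>

lemma card_monomials_null:
  assumes "CARD('n) = l + 1"
  shows "(\<lambda>n. fact (l + 1) / real n ^ (l + 1) * (real (card (monomials n :: ('n::finite \<Rightarrow>\<^sub>0 nat) set)) * K)) \<longlonglongrightarrow> 0"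
proof (rule Lim_null_comparison)
  let ?c = "fact (l + 1) * 2 ^ l * \<bar>K\<bar>"
  show "(\<lambda>n. ?c * (1 / real n)) \<longlonglongrightarrow> 0"
    by (rule tendsto_mult_right_zero) (rule lim_1_over_n)
  show "\<forall>\<^sub>F n in sequentially. norm (fact (l + 1) / real n ^ (l + 1) * (real (card (monomials n :: ('n \<Rightarrow>\<^sub>0 nat) set)) * K)) \<le> ?c * (1 / real n)"
    using eventually_gt_at_top[of 0]
  proof eventually_elim
    case (elim n)
    have "norm (fact (l + 1) / real n ^ (l + 1) * (real (card (monomials n :: ('n \<Rightarrow>\<^sub>0 nat) set)) * K)) =
        fact (l + 1) / real n ^ (l + 1) * (real (card (monomials n :: ('n \<Rightarrow>\<^sub>0 nat) set)) * \<bar>K\<bar>)"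
      by (simp add: abs_mult)
    also have "\<dots> \<le> fact (l + 1) / real n ^ (l + 1) * ((2 ^ l * real n ^ l) * \<bar>K\<bar>)"
      by (intro mult_left_mono mult_right_mono card_monomials_bound[OF assms elim]) auto
    also have "\<dots> = ?c * (1 / real n)" using elim by (simp add: field_simps)
    finally show ?case .
  qed
qed

lemma limsup_liminf_le_of_null:
  fixes F G :: "nat \<Rightarrow> ereal"
  assumes le: "\<And>n. F n \<le> G n + ereal (e n)" and e: "e \<longlonglongrightarrow> 0"
  shows "limsup F \<le> limsup G" "liminf F \<le> liminf G"
proof -
  have e': "(\<lambda>n. ereal (e n)) \<longlonglongrightarrow> ereal 0" using e by simp
  have "limsup F \<le> limsup (\<lambda>n. ereal (e n) + G n)"
    using le by (intro Limsup_mono always_eventually) (simp add: add.commute)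
  also have "\<dots> = ereal 0 + limsup G" by (rule ereal_limsup_lim_add[OF e']) simp
  finally show "limsup F \<le> limsup G" by (simp add: zero_ereal_def[symmetric])
  have "liminf F \<le> liminf (\<lambda>n. ereal (e n) + G n)"
    using le by (intro Liminf_mono always_eventually) (simp add: add.commute)
  also have "\<dots> = ereal 0 + liminf G" by (rule ereal_liminf_lim_add[OF e']) simp
  finally show "liminf F \<le> liminf G" by (simp add: zero_ereal_def[symmetric])
qed

lemma scaled_degree_le:
  fixes h h' :: "'n::finite cpoly \<Rightarrow> real"
  assumes h: "hilbertian_seminorm h" "hilbertian_seminorm h'" and C: "0 < C" and le: "\<And>P. h' P \<le> C * h P"
  shows "scaled_degree r h n \<le> scaled_degree r h' n + ereal (fact r / real n ^ r * (real (card (monomials n :: ('n \<Rightarrow>\<^sub>0 nat) set)) * ln C))"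
proof -
  have "scaled_degree r h n \<le> ereal (fact r / real n ^ r) *
      (arith_degree (integral_sections n) h' + ereal (real (card (monomials n :: ('n \<Rightarrow>\<^sub>0 nat) set)) * ln C))"
    unfolding scaled_degree_def by (intro ereal_mult_left_mono arith_degree_mono assms) simp
  also have "\<dots> = scaled_degree r h' n + ereal (fact r / real n ^ r * (real (card (monomials n :: ('n \<Rightarrow>\<^sub>0 nat) set)) * ln C))"
    unfolding scaled_degree_def by (subst ereal_pos_distrib) auto
  finally show ?thesis .
qed

lemma limsup_liminf_scaled_degree_mono:
  fixes h h' :: "'n::finite cpoly \<Rightarrow> real"
  assumes L: "CARD('n) = l + 1"
    and h: "hilbertian_seminorm h" "hilbertian_seminorm h'" and C: "0 < C" and le: "\<And>P. h' P \<le> C * h P"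
  shows "limsup (scaled_degree (l + 1) h) \<le> limsup (scaled_degree (l + 1) h')" "liminf (scaled_degree (l + 1) h) \<le> liminf (scaled_degree (l + 1) h')"
  using limsup_liminf_le_of_null[OF scaled_degree_le[OF h C le] card_monomials_null[OF L]] by blast+

text \<open>The unit ball of \<open>h i\<close> is bounded, hence bounded for some
  \<open>h' j\<close>, and scaling gives the inequality. Where \<open>h i\<close> vanishes, all
  multiples stay in the ball, so \<open>h' j\<close> has to vanish too.\<close>

lemma bounded_sets_compare:
  assumes h: "\<And>i. hilbertian_seminorm (h i)" "\<And>i. hilbertian_seminorm (h' i)"
    and B: "\<And>B. (\<exists>i. \<exists>R>0. \<forall>P\<in>B. h i P \<le> R) \<Longrightarrow> (\<exists>i. \<exists>R>0. \<forall>P\<in>B. h' i P \<le> R)"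
  shows "\<exists>j. \<exists>R>0. \<forall>P. h' j P \<le> R * h i P"
proof -
  have "\<exists>i'. \<exists>R>0. \<forall>P\<in>{P. h i P \<le> 1}. h i' P \<le> R" by (intro exI[of _ i] exI[of _ 1]) auto
  from B[OF this] obtain j R where R: "0 < R" "\<And>P. h i P \<le> 1 \<Longrightarrow> h' j P \<le> R" by blast
  have sc: "h i (Poly_Mapping.single 0 (of_real t) * P) = t * h i P"
      "h' j (Poly_Mapping.single 0 (of_real t) * P) = t * h' j P" if "0 < t" for t P
    using that by (simp_all add: hilbertian_seminorm_cmult[OF h(1)] hilbertian_seminorm_cmult[OF h(2)])
  have "h' j P \<le> R * h i P" for P
  proof (cases "h i P = 0")
    case False
    then have pos: "0 < h i P" using hilbertian_seminorm_nonneg[OF h(1), of i P] by simp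
    from R(2)[of "Poly_Mapping.single 0 (of_real (1 / h i P)) * P"] sc[of "1 / h i P" P] pos
    have "1 / h i P * h' j P \<le> R" by (simp del: of_real_divide)
    then show ?thesis using pos by (simp add: field_simps)
  next
    case True
    have "h' j P \<le> 0"
    proof (rule ccontr)
      assume "\<not> h' j P \<le> 0"
      then have pos: "0 < h' j P" by simp
      define t where "t = (R + 1) / h' j P"
      have t: "0 < t" "t * h' j P = R + 1" using pos R(1) by (auto simp: t_def)
      from R(2)[of "Poly_Mapping.single 0 (of_real t) * P"] show False
        using True t by (simp add: sc)
    qed
    then show ?thesis using True by simp
  qed
  then show ?thesis using R(1) by blast
qed

context circled_compact
begin

text \<open>The common value is the supremum of the limits \<Lambda> i for the sup norms. Any other
  sequence with the same bounded sets is interleaved with \<open>std_norm\<close>, up to constants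
  and a shift of indices, and neither affects the supremum.\<close>

theorem hilbert_limits:
  assumes L: "CARD('n) = l + 1"
  shows "\<exists>c. c \<noteq> -\<infinity> \<and> (\<forall>h.
    (\<forall>i. hilbertian_seminorm (h i)) \<longrightarrow> (\<forall>i P. h (Suc i) P \<le> h i P) \<longrightarrow>
    (\<forall>B. (\<exists>i. \<exists>R>0. \<forall>P\<in>B. h i P \<le> R) \<longleftrightarrow> (\<exists>i. \<exists>R>0. \<forall>P\<in>B. std_norm i P \<le> R)) \<longrightarrow>
    lim (\<lambda>i. limsup (scaled_degree (l + 1) (h i))) = c \<and> lim (\<lambda>i. liminf (scaled_degree (l + 1) (h i))) = c)"
proof -
  let ?r = "l + 1"
  \<comment> \<open>The normalising factor \<open>fact ?r\<close> is built into the superadditive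
    function, so that its limits compare directly with the scaled degrees.\<close>
  define g where "g i \<alpha> = - (fact ?r * ln (chebyshev i \<alpha>))" for i and \<alpha> :: "'n \<Rightarrow>\<^sub>0 nat"
  have "\<exists>\<Lambda>. \<Lambda> \<noteq> -\<infinity> \<and> (\<lambda>n. ereal ((\<Sum>\<alpha>\<in>monomials n. g i \<alpha>) / real n ^ ?r)) \<longlonglongrightarrow> \<Lambda>" for i
  proof -
    obtain C where C: "\<And>\<alpha>. ln (chebyshev i \<alpha>) \<le> C * real (mon_degree \<alpha>)" using chebyshev_bound by blast
    show ?thesis
    proof (rule superadditive_limit[OF L])
      fix \<alpha> \<beta> :: "'n \<Rightarrow>\<^sub>0 nat"
      have "ln (chebyshev i (\<alpha> + \<beta>)) \<le> ln (chebyshev i \<alpha> * chebyshev i \<beta>)" by (intro ln_mono chebyshev_add chebyshev_pos)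
      also have "\<dots> = ln (chebyshev i \<alpha>) + ln (chebyshev i \<beta>)" using chebyshev_pos[of i \<alpha>] chebyshev_pos[of i \<beta>] by (simp add: ln_mult)
      finally have "fact ?r * ln (chebyshev i (\<alpha> + \<beta>)) \<le> fact ?r * (ln (chebyshev i \<alpha>) + ln (chebyshev i \<beta>))"
        by (intro mult_left_mono) auto
      then show "g i \<alpha> + g i \<beta> \<le> g i (\<alpha> + \<beta>)" by (simp add: g_def distrib_left del: fact_Suc)
      have "fact ?r * ln (chebyshev i \<alpha>) \<le> fact ?r * (C * real (mon_degree \<alpha>))" by (intro mult_left_mono C) auto
      then show "- (fact ?r * C) * real (mon_degree \<alpha>) \<le> g i \<alpha>" by (simp add: g_def mult.assoc del: fact_Suc)
    qed
  qed
  then obtain \<Lambda> where \<Lambda>: "\<And>i. \<Lambda> i \<noteq> -\<infinity>" "\<And>i. (\<lambda>n. ereal ((\<Sum>\<alpha>\<in>monomials n. g i \<alpha>) / real n ^ ?r)) \<longlonglongrightarrow> \<Lambda> i"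
    by metis
  let ?e = "\<lambda>i n. fact ?r / real n ^ ?r * (real (card (monomials n :: ('n \<Rightarrow>\<^sub>0 nat) set)) * ln (sample_const i))"
  have e: "?e i \<longlonglongrightarrow> 0" for i by (rule card_monomials_null[OF L])
  have F0: "scaled_degree ?r (total_norm i) n = ereal (fact ?r / real n ^ ?r * (\<Sum>\<alpha>\<in>monomials n. - ln (lead_inf (total_norm i) \<alpha>)))" for i n
    by (simp add: scaled_degree_def arith_degree_eq_lead_inf(1)[OF hilbertian_total_norm degree_norm_total_norm])
  have G: "(\<Sum>\<alpha>\<in>monomials n. g i \<alpha>) / real n ^ ?r = fact ?r / real n ^ ?r * (\<Sum>\<alpha>\<in>monomials n. - ln (chebyshev i \<alpha>))" for i n
  proof -
    have "(\<Sum>\<alpha>\<in>monomials n. g i \<alpha>) = fact ?r * (\<Sum>\<alpha>\<in>monomials n. - ln (chebyshev i \<alpha>))"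
      unfolding sum_distrib_left by (intro sum.cong) (auto simp: g_def)
    then show ?thesis by simp
  qed
  have low: "ereal ((\<Sum>\<alpha>\<in>monomials n. g i \<alpha>) / real n ^ ?r) \<le> scaled_degree ?r (total_norm i) n + ereal (?e i n)" for i n
  proof -
    have "- ln (chebyshev i \<alpha>) \<le> - ln (lead_inf (total_norm i) \<alpha>) + ln (sample_const i)" for \<alpha>
    proof -
      have "ln (lead_inf (total_norm i) \<alpha>) \<le> ln (sample_const i * chebyshev i \<alpha>)" by (intro ln_mono lead_inf_total_norm_le lead_inf_total_norm_pos)
      then show ?thesis using sample_const_pos[of i] chebyshev_pos[of i \<alpha>] by (simp add: ln_mult)
    qed
    then have "(\<Sum>\<alpha>\<in>monomials n. - ln (chebyshev i \<alpha>)) \<le> (\<Sum>\<alpha>\<in>monomials n. - ln (lead_inf (total_norm i) \<alpha>) + ln (sample_const i))"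
      by (intro sum_mono)
    also have "\<dots> = (\<Sum>\<alpha>\<in>monomials n. - ln (lead_inf (total_norm i) \<alpha>)) + real (card (monomials n :: ('n \<Rightarrow>\<^sub>0 nat) set)) * ln (sample_const i)"
      by (subst sum.distrib) simp
    finally have "fact ?r / real n ^ ?r * (\<Sum>\<alpha>\<in>monomials n. - ln (chebyshev i \<alpha>)) \<le>
      fact ?r / real n ^ ?r * ((\<Sum>\<alpha>\<in>monomials n. - ln (lead_inf (total_norm i) \<alpha>)) + real (card (monomials n :: ('n \<Rightarrow>\<^sub>0 nat) set)) * ln (sample_const i))"
      by (intro mult_left_mono) auto
    then show ?thesis unfolding F0 G by (simp only: distrib_left plus_ereal.simps ereal_less_eq)
  qed
  have up: "scaled_degree ?r (total_norm i) n \<le> ereal ((\<Sum>\<alpha>\<in>monomials n. g (Suc i) \<alpha>) / real n ^ ?r) + ereal (?e i n)" for i n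
  proof -
    have "- ln (lead_inf (total_norm i) \<alpha>) \<le> - ln (chebyshev (Suc i) \<alpha>) + ln (sample_const i)" for \<alpha>
    proof -
      have "ln (chebyshev (Suc i) \<alpha>) \<le> ln (sample_const i * lead_inf (total_norm i) \<alpha>)" by (intro ln_mono chebyshev_le chebyshev_pos)
      then show ?thesis using sample_const_pos[of i] lead_inf_total_norm_pos[of i \<alpha>] by (simp add: ln_mult)
    qed
    then have "(\<Sum>\<alpha>\<in>monomials n. - ln (lead_inf (total_norm i) \<alpha>)) \<le> (\<Sum>\<alpha>\<in>monomials n. - ln (chebyshev (Suc i) \<alpha>) + ln (sample_const i))"
      by (intro sum_mono)
    also have "\<dots> = (\<Sum>\<alpha>\<in>monomials n. - ln (chebyshev (Suc i) \<alpha>)) + real (card (monomials n :: ('n \<Rightarrow>\<^sub>0 nat) set)) * ln (sample_const i)"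
      by (subst sum.distrib) simp
    finally have "fact ?r / real n ^ ?r * (\<Sum>\<alpha>\<in>monomials n. - ln (lead_inf (total_norm i) \<alpha>)) \<le>
      fact ?r / real n ^ ?r * ((\<Sum>\<alpha>\<in>monomials n. - ln (chebyshev (Suc i) \<alpha>)) + real (card (monomials n :: ('n \<Rightarrow>\<^sub>0 nat) set)) * ln (sample_const i))"
      by (intro mult_left_mono) auto
    then show ?thesis unfolding F0 G by (simp only: distrib_left plus_ereal.simps ereal_less_eq)
  qed
  have lim\<Lambda>: "liminf (\<lambda>n. ereal ((\<Sum>\<alpha>\<in>monomials n. g i \<alpha>) / real n ^ ?r)) = \<Lambda> i"
    "limsup (\<lambda>n. ereal ((\<Sum>\<alpha>\<in>monomials n. g i \<alpha>) / real n ^ ?r)) = \<Lambda> i" for i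
    using \<Lambda>(2)[of i] by (auto intro: lim_imp_Liminf lim_imp_Limsup)
  have low': "\<Lambda> i \<le> liminf (scaled_degree ?r (total_norm i))" for i
    using limsup_liminf_le_of_null(2)[OF low e, of i] unfolding lim\<Lambda> .
  have up': "limsup (scaled_degree ?r (total_norm i)) \<le> \<Lambda> (Suc i)" for i
    using limsup_liminf_le_of_null(1)[OF up e, of i] unfolding lim\<Lambda> .
  show ?thesis
  proof (intro exI[of _ "SUP i. \<Lambda> i"] conjI allI impI)
    have "\<Lambda> 0 \<le> (SUP i. \<Lambda> i)" by (rule SUP_upper) simp
    then show "(SUP i. \<Lambda> i) \<noteq> -\<infinity>" using \<Lambda>(1)[of 0] by auto
  next
    fix h :: "nat \<Rightarrow> 'n cpoly \<Rightarrow> real"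
    assume hil: "\<forall>i. hilbertian_seminorm (h i)" and dec: "\<forall>i P. h (Suc i) P \<le> h i P"
      and born: "\<forall>B. (\<exists>i. \<exists>R>0. \<forall>P\<in>B. h i P \<le> R) \<longleftrightarrow> (\<exists>i. \<exists>R>0. \<forall>P\<in>B. std_norm i P \<le> R)"
    have hil': "hilbertian_seminorm (h i)" for i using hil by blast
    \<comment> \<open>Rescaling by this constant changes the arithmetic degree by a multiple of the
      number of monomials, hence does not change the limits.\<close>
    let ?c = "\<lambda>i. \<Prod>j<i. 1 / (sample_const (Suc j) * sample_const j)"
    have "limsup (scaled_degree ?r (h i)) \<le> (SUP i. \<Lambda> i)" for i
    proof -
      obtain j R where "0 < R" "\<And>P. std_norm j P \<le> R * h i P"
        using bounded_sets_compare[of h std_norm, OF hil' hilbertian_std_norm] born by metis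
      then have "limsup (scaled_degree ?r (h i)) \<le> limsup (scaled_degree ?r (std_norm j))"
        by (intro limsup_liminf_scaled_degree_mono[OF L hil' hilbertian_std_norm]) auto
      also have "\<dots> \<le> limsup (scaled_degree ?r (total_norm j))"
      proof (rule limsup_liminf_scaled_degree_mono(1)[OF L hilbertian_std_norm hilbertian_total_norm])
        show "0 < 1 / ?c j" by (intro divide_pos_pos std_norm_const_pos) simp
        have "total_norm j P \<le> 1 / c * (c * total_norm j P)" if "0 < c" for c :: real and P using that by simp
        from this[OF std_norm_const_pos] show "total_norm j P \<le> 1 / ?c j * std_norm j P" for P unfolding std_norm_def .
      qed
      also have "\<dots> \<le> \<Lambda> (Suc j)" by (rule up')
      also have "\<dots> \<le> (SUP i. \<Lambda> i)" by (rule SUP_upper) simp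
      finally show ?thesis .
    qed
    then have A: "(SUP i. limsup (scaled_degree ?r (h i))) \<le> (SUP i. \<Lambda> i)" by (intro SUP_least)
    have "\<Lambda> i \<le> (SUP i. liminf (scaled_degree ?r (h i)))" for i
    proof -
      obtain j R where R: "0 < R" "\<And>P. h j P \<le> R * std_norm i P"
        using bounded_sets_compare[of std_norm h, OF hilbertian_std_norm hil'] born by metis
      have "\<Lambda> i \<le> liminf (scaled_degree ?r (total_norm i))" by (rule low')
      also have "\<dots> \<le> liminf (scaled_degree ?r (std_norm i))"
        using std_norm_const_pos[of i] by (intro limsup_liminf_scaled_degree_mono(2)[OF L hilbertian_total_norm hilbertian_std_norm]) (auto simp: std_norm_def)
      also have "\<dots> \<le> liminf (scaled_degree ?r (h j))"
        using R by (intro limsup_liminf_scaled_degree_mono[OF L hilbertian_std_norm hil']) auto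
      also have "\<dots> \<le> (SUP i. liminf (scaled_degree ?r (h i)))" by (rule SUP_upper) simp
      finally show ?thesis .
    qed
    then have B: "(SUP i. \<Lambda> i) \<le> (SUP i. liminf (scaled_degree ?r (h i)))" by (intro SUP_least)
    have C: "(SUP i. liminf (scaled_degree ?r (h i))) \<le> (SUP i. limsup (scaled_degree ?r (h i)))"
      by (intro SUP_mono') (simp add: Liminf_le_Limsup)
    have step: "limsup (scaled_degree ?r (h i)) \<le> limsup (scaled_degree ?r (h (Suc i)))" "liminf (scaled_degree ?r (h i)) \<le> liminf (scaled_degree ?r (h (Suc i)))" for i
      using limsup_liminf_scaled_degree_mono[OF L hil' hil', of 1 "Suc i" i] dec by auto
    have "lim (\<lambda>i. limsup (scaled_degree ?r (h i))) = (SUP i. limsup (scaled_degree ?r (h i)))"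
      by (intro limI LIMSEQ_SUP incseq_SucI step)
    moreover have "lim (\<lambda>i. liminf (scaled_degree ?r (h i))) = (SUP i. liminf (scaled_degree ?r (h i)))"
      by (intro limI LIMSEQ_SUP incseq_SucI step)
    ultimately show "lim (\<lambda>i. limsup (scaled_degree ?r (h i))) = (SUP i. \<Lambda> i)" "lim (\<lambda>i. liminf (scaled_degree ?r (h i))) = (SUP i. \<Lambda> i)"
      using A B C by auto
  qed
qed

end

section \<open>The tube as a circled compact set\<close>

lemma topspace_proj_space: "topspace (proj_space :: (complex ^ 'n) set topology) = cline ` (- {0})"
  by (simp add: proj_space_def topspace_quotient_topology)

lemma topspace_taut_space: "topspace (taut_space :: 'n::finite tube_pt topology) = taut_map ` ((- {0}) \<times> UNIV)"
  by (simp add: taut_space_def topspace_quotient_topology)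

lemma taut_map_in_space: "z \<noteq> 0 \<Longrightarrow> taut_map (z, t) \<in> topspace taut_space"
  by (auto simp: topspace_taut_space)

lemma open_proj_preimage:
  assumes "openin proj_space (U :: (complex ^ 'n::finite) set set)"
  shows "open {z. z \<noteq> 0 \<and> cline z \<in> U}"
proof -
  have "openin (top_of_set (- {0})) {z \<in> - {0}. cline z \<in> U}"
    using assms by (simp add: proj_space_def openin_quotient_topology)
  then have "open {z \<in> - {0}. cline z \<in> U}" by (rule openin_open_trans) auto
  then show ?thesis by simp
qed

lemma open_taut_preimage:
  assumes "openin taut_space (U :: 'n::finite tube_pt set)"
  shows "open {(z, t). z \<noteq> 0 \<and> taut_map (z, t) \<in> U}"
proof -
  have o: "open ((- {0 :: complex ^ 'n}) \<times> (UNIV :: complex set))" by (intro open_Times) auto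
  have "openin (top_of_set ((- {0}) \<times> UNIV)) {x \<in> (- {0}) \<times> UNIV. taut_map x \<in> U}"
    using assms by (simp add: taut_space_def openin_quotient_topology)
  then have "open {x \<in> (- {0}) \<times> UNIV. taut_map x \<in> U}" by (rule openin_open_trans[OF _ o])
  moreover have "{x \<in> (- {0}) \<times> UNIV. taut_map x \<in> U} = {(z, t). z \<noteq> 0 \<and> taut_map (z, t) \<in> U}" by auto
  ultimately show ?thesis by simp
qed

lemma openin_taut_spaceI:
  fixes U :: "'n::finite tube_pt set"
  assumes "U \<subseteq> topspace taut_space" "open {(z, t). z \<noteq> 0 \<and> taut_map (z, t) \<in> U}"
  shows "openin taut_space U"
proof -
  have o: "open ((- {0 :: complex ^ 'n}) \<times> (UNIV :: complex set))" by (intro open_Times) auto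
  have "{x \<in> (- {0}) \<times> UNIV. taut_map x \<in> U} = {(z, t). z \<noteq> 0 \<and> taut_map (z, t) \<in> U}" by auto
  moreover have "{(z, t). z \<noteq> 0 \<and> taut_map (z, t) \<in> U} \<subseteq> (- {0}) \<times> UNIV" by auto
  ultimately show ?thesis
    using assms o by (simp add: taut_space_def openin_quotient_topology topspace_quotient_topology openin_open_eq)
qed

lemma self_in_cline: "z \<in> cline z"
  unfolding cline_def by (rule range_eqI[of _ _ 1]) simp

lemma scale_in_cline: "c *s z \<in> cline z"
  unfolding cline_def by (rule rangeI)

lemma cline_scale: "c \<noteq> 0 \<Longrightarrow> cline (c *s z) = cline z"
proof -
  assume c: "c \<noteq> 0"
  have "a *s z = (a / c) *s (c *s z)" "a *s (c *s z) = (a * c) *s z" for a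
    using c by (simp_all add: vector_smult_assoc)
  then have "a *s z \<in> cline (c *s z)" "a *s (c *s z) \<in> cline z" for a
    using scale_in_cline by metis+
  then show ?thesis unfolding cline_def[of z] cline_def[of "c *s z"] by (auto simp: cline_def)
qed

lemma snd_taut_map [simp]: "snd (taut_map (z, t)) = t *s z"
  by (simp add: taut_map_def)

text \<open>The basis of the fibre of O(1) dual to the basis vector \<open>z\<close> of the
  line.\<close>

definition unit_form :: "complex ^ 'n \<Rightarrow> complex ^ 'n \<Rightarrow> complex" where
  "unit_form z = (\<lambda>v\<in>cline z. THE c. v = c *s z)"

lemma unit_form_scale: "z \<noteq> 0 \<Longrightarrow> unit_form z (c *s z) = c"
  by (simp add: unit_form_def scale_in_cline)

lemma unit_form_fibre: "z \<noteq> 0 \<Longrightarrow> unit_form z \<in> fibre_O1 (cline z)"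
proof -
  assume z: "z \<noteq> 0"
  have "unit_form z (a *s z + b *s z) = a + b" "unit_form z (c *s (a *s z)) = c * a" for a b c
    using unit_form_scale[OF z, of "a + b"] unit_form_scale[OF z, of "c * a"] by (simp_all add: vector_sadd_rdistrib vector_smult_assoc)
  then show ?thesis
    using unit_form_scale[OF z] unfolding fibre_O1_def by (auto simp: unit_form_def cline_def)
qed

lemma fibre_eq:
  assumes z: "z \<noteq> 0" and \<phi>: "\<phi> \<in> fibre_O1 (cline z)"
  shows "\<phi> = (\<lambda>v\<in>cline z. \<phi> z * unit_form z v)"
proof
  fix v
  show "\<phi> v = (\<lambda>v\<in>cline z. \<phi> z * unit_form z v) v"
  proof (cases "v \<in> cline z")
    case True
    then obtain c where "v = c *s z" by (auto simp: cline_def)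
    then show ?thesis using \<phi> z self_in_cline[of z] by (simp add: fibre_O1_def unit_form_scale scale_in_cline)
  next
    case False
    then show ?thesis using \<phi> by (simp add: fibre_O1_def extensional_def)
  qed
qed

section \<open>The seminorm as one function on nonzero vectors\<close>

locale seminormed =
  fixes N :: "'n::finite O1_seminorm"
  assumes N: "seminormed_O1 N"
begin

text \<open>Fibres are one-dimensional, so this function, homogeneous of degree -1 in absolute
  value, carries the whole seminorm.\<close>

definition section_norm :: "complex ^ 'n \<Rightarrow> real" where
  "section_norm z = N (cline z) (unit_form z)"

lemma N_fibre:
  assumes "z \<noteq> 0" "\<phi> \<in> fibre_O1 (cline z)"
  shows "N (cline z) \<phi> = norm (\<phi> z) * section_norm z"
proof -
  have x: "cline z \<in> topspace proj_space" using assms by (simp add: topspace_proj_space)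
  have "N (cline z) (restrict (\<lambda>v. \<phi> z * unit_form z v) (cline z)) = cmod (\<phi> z) * N (cline z) (unit_form z)"
    using N x unit_form_fibre[OF assms(1)] by (auto simp: seminormed_O1_def fibrewise_seminorm_def)
  then show ?thesis using fibre_eq[OF assms] by (simp add: section_norm_def)
qed

lemma section_norm_nonneg: "z \<noteq> 0 \<Longrightarrow> 0 \<le> section_norm z"
  using N unit_form_fibre[of z] by (auto simp: section_norm_def seminormed_O1_def fibrewise_seminorm_def topspace_proj_space)

lemma section_norm_scale:
  assumes "z \<noteq> 0" "c \<noteq> 0" shows "section_norm (c *s z) = section_norm z / norm c"
proof -
  have cz: "c *s z \<noteq> 0" using assms by (simp add: vector_mul_eq_0)
  have f: "unit_form (c *s z) \<in> fibre_O1 (cline z)" using unit_form_fibre[OF cz] cline_scale[OF assms(2), of z] by simp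
  have "unit_form (c *s z) z = unit_form (c *s z) ((1 / c) *s (c *s z))" using assms by (simp add: vector_smult_assoc)
  also have "\<dots> = 1 / c" by (rule unit_form_scale[OF cz])
  finally show ?thesis
    using N_fibre[OF assms(1) f] cline_scale[OF assms(2), of z] by (simp add: section_norm_def norm_divide)
qed

lemma vec_cnj_eq_0: "vec_cnj z = 0 \<longleftrightarrow> z = 0"
  by (auto simp: vec_cnj_def vec_eq_iff)

lemma vec_cnj_scale: "vec_cnj (c *s z) = cnj c *s vec_cnj z"
  by (simp add: vec_cnj_def vec_eq_iff)

lemma cline_cnj: "vec_cnj ` cline z = cline (vec_cnj z)"
proof -
  have "vec_cnj ` cline z = range (\<lambda>c. cnj c *s vec_cnj z)"
    by (simp add: cline_def image_image vec_cnj_scale)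
  also have "\<dots> = cline (vec_cnj z)"
  proof -
    have "c *s vec_cnj z \<in> range (\<lambda>c. cnj c *s vec_cnj z)" for c
      by (rule range_eqI[of _ _ "cnj c"]) simp
    then show ?thesis by (auto simp: cline_def)
  qed
  finally show ?thesis .
qed

lemma section_norm_cnj:
  assumes "z \<noteq> 0" shows "section_norm (vec_cnj z) = section_norm z"
proof -
  let ?w = "vec_cnj z"
  have w: "?w \<noteq> 0" using assms by (simp add: vec_cnj_eq_0)
  have "form_cnj (cline z) (unit_form z) = unit_form ?w"
  proof
    fix v
    show "form_cnj (cline z) (unit_form z) v = unit_form ?w v"
    proof (cases "v \<in> cline ?w")
      case True
      then obtain c where c: "v = c *s ?w" by (auto simp: cline_def)
      have "form_cnj (cline z) (unit_form z) v = cnj (unit_form z (cnj c *s z))"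
        unfolding form_cnj_def cline_cnj using True by (simp add: c vec_cnj_scale)
      then show ?thesis using assms w by (simp add: unit_form_scale c)
    next
      case False
      then show ?thesis by (simp add: form_cnj_def cline_cnj unit_form_def)
    qed
  qed
  then have "N (cline ?w) (unit_form ?w) = N (cline z) (unit_form z)"
  proof -
    have "\<forall>x\<in>topspace proj_space. \<forall>\<phi>\<in>fibre_O1 x. N (vec_cnj ` x) (form_cnj x \<phi>) = N x \<phi>"
      using N by (simp add: seminormed_O1_def cnj_invariant_seminorm_def)
    moreover have "cline z \<in> topspace proj_space" using assms by (simp add: topspace_proj_space)
    ultimately have "N (vec_cnj ` cline z) (form_cnj (cline z) (unit_form z)) = N (cline z) (unit_form z)"
      using unit_form_fibre[OF assms] by blast
    then show ?thesis by (simp only: cline_cnj \<open>form_cnj (cline z) (unit_form z) = unit_form ?w\<close>)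
  qed
  then show ?thesis by (simp add: section_norm_def)
qed

text \<open>The product is the norm of the global section given by the coordinate \<open>i\<close>,
  the only kind of section to which upper semicontinuity is applied.\<close>

lemma open_coordinate_section: "open {z. z \<noteq> 0 \<and> norm (z $ i) * section_norm z < a}"
proof -
  let ?s = "\<lambda>x. \<lambda>v\<in>x. v $ i"
  have fib: "?s (cline z) \<in> fibre_O1 (cline z)" for z :: "complex ^ 'n"
  proof -
    have "u + v \<in> cline z" "c *s v \<in> cline z" if "u \<in> cline z" "v \<in> cline z" for u v c
      using that by (auto simp: cline_def vector_smult_assoc simp flip: vector_sadd_rdistrib)
    then show ?thesis by (auto simp: fibre_O1_def)
  qed
  have "analytic_section_O1 (topspace proj_space) ?s"
    unfolding analytic_section_O1_def
  proof (intro conjI ballI)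
    fix x :: "(complex ^ 'n) set" assume "x \<in> topspace proj_space"
    then show "?s x \<in> fibre_O1 x" using fib by (auto simp: topspace_proj_space)
  next
    have "bounded_linear (\<lambda>z :: complex ^ 'n. z $ i)" by (rule bounded_linear_vec_nth)
    then have "((\<lambda>z :: complex ^ 'n. z $ i) has_derivative (\<lambda>z. z $ i)) (at x)" for x
      by (rule bounded_linear_imp_has_derivative)
    moreover have "(\<lambda>z. ?s (cline z) z) = (\<lambda>z :: complex ^ 'n. z $ i)"
      by (auto simp: self_in_cline fun_eq_iff)
    ultimately show "holomorphic_wrt (*s) (\<lambda>z. ?s (cline z) z) {z. z \<noteq> 0 \<and> cline z \<in> topspace proj_space}"
      unfolding holomorphic_wrt_def by (auto intro!: exI[of _ "\<lambda>z. z $ i"])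
  qed
  then have "openin proj_space {x \<in> topspace proj_space. N x (?s x) < a}"
    using N openin_topspace unfolding seminormed_O1_def usc_seminorm_def by blast
  from open_proj_preimage[OF this]
  have "open {z. z \<noteq> 0 \<and> N (cline z) (?s (cline z)) < a}"
    by (rule back_subst[where P = "open"]) (auto simp: topspace_proj_space)
  moreover have "N (cline z) (?s (cline z)) = norm (z $ i) * section_norm z" if "z \<noteq> 0" for z
    using N_fibre[OF that fib] self_in_cline[of z] by simp
  ultimately show ?thesis by (simp cong: conj_cong)
qed

text \<open>Near a point with nonzero coordinate \<open>i\<close>, the norm of the coordinate
  section may be divided by the continuous positive function \<open>norm (z $ i)\<close>; the
  intermediate \<open>b\<close> keeps the inequality strict.\<close>

lemma open_section_norm_less: "open {z. z \<noteq> 0 \<and> section_norm z < a}"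
proof (subst open_subopen, intro ballI)
  fix z assume "z \<in> {z. z \<noteq> 0 \<and> section_norm z < a}"
  then have z: "z \<noteq> 0" "section_norm z < a" by auto
  then obtain i where i: "z $ i \<noteq> 0" by (auto simp: vec_eq_iff)
  have a: "0 < a" using section_norm_nonneg[OF z(1)] z(2) by simp
  have "norm (z $ i) * section_norm z < norm (z $ i) * a" using z i by simp
  then obtain b where b: "norm (z $ i) * section_norm z < b" "b < norm (z $ i) * a" using dense by blast
  let ?O = "{w. w \<noteq> 0 \<and> norm (w $ i) * section_norm w < b} \<inter> {w. b / a < norm (w $ i)}"
  have "open ?O"
    by (intro open_Int open_coordinate_section open_Collect_less continuous_intros)
  moreover have "z \<in> ?O" using z b a by (auto simp: divide_less_eq)
  moreover have "?O \<subseteq> {z. z \<noteq> 0 \<and> section_norm z < a}"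
  proof
    fix w assume w: "w \<in> ?O"
    then have "norm (w $ i) * section_norm w < norm (w $ i) * a" using a by (auto simp: divide_less_eq)
    then have "section_norm w < a" by (simp add: mult_less_cancel_left)
    then show "w \<in> {z. z \<noteq> 0 \<and> section_norm z < a}" using w by auto
  qed
  ultimately show "\<exists>T. open T \<and> z \<in> T \<and> T \<subseteq> {z. z \<noteq> 0 \<and> section_norm z < a}" by blast
qed

text \<open>
  As \<open>section_norm (t z) = section_norm z / |t|\<close>, these are the \<open>t z\<close> with \<open>|t| \<le> section_norm z\<close>,
  that is, the vectors of dual pseudo-norm at most 1.
\<close>

definition K :: "(complex ^ 'n) set" where
  "K = insert 0 {v. v \<noteq> 0 \<and> 1 \<le> section_norm v}"

lemma closed_K: "closed K"
proof -
  have "- K = {z. z \<noteq> 0 \<and> section_norm z < 1}" by (auto simp: K_def)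
  then show ?thesis using open_section_norm_less[of 1] by (simp add: closed_def)
qed

text \<open>An upper semicontinuous function is bounded above on the compact unit sphere, and
  homogeneity carries the bound to all of \<open>K\<close>.\<close>

lemma bounded_K: "\<exists>R. \<forall>v\<in>K. norm v \<le> R"
proof -
  let ?S = "sphere 0 1 :: (complex ^ 'n) set"
  have "\<exists>C. \<forall>z\<in>?S. section_norm z \<le> C"
  proof -
    let ?U = "\<lambda>m::nat. {z. z \<noteq> 0 \<and> section_norm z < real m}"
    have "?S \<subseteq> (\<Union>m\<in>UNIV. ?U m)"
      using reals_Archimedean2 by fastforce
    then obtain M where M: "finite M" "?S \<subseteq> (\<Union>m\<in>M. ?U m)"
      by (rule compactE_image[OF compact_sphere open_section_norm_less])
    have "section_norm z \<le> real (Max M)" if "z \<in> ?S" for z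
    proof -
      obtain m where "m \<in> M" "section_norm z < real m" using M(2) \<open>z \<in> ?S\<close> by blast
      then show ?thesis using Max_ge[OF M(1), of m] by linarith
    qed
    then show ?thesis by blast
  qed
  then obtain C where C: "\<And>z. z \<in> ?S \<Longrightarrow> section_norm z \<le> C" by blast
  have "norm v \<le> max C 0" if v: "v \<in> K" for v
  proof (cases "v = 0")
    case False
    let ?c = "complex_of_real (1 / norm v)"
    have c: "?c \<noteq> 0" "norm ?c = 1 / norm v" using False by (simp_all add: norm_divide)
    have "norm (?c *s v) = norm ?c * norm v" by (rule norm_vscale)
    then have "?c *s v \<in> ?S" using False c by simp
    then have "section_norm v * norm v \<le> C" using C[of "?c *s v"] section_norm_scale[OF False c(1)] c(2) by simp
    moreover have "norm v \<le> section_norm v * norm v" using v False by (simp add: K_def)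
    ultimately show ?thesis by simp
  qed simp
  then show ?thesis by blast
qed

sublocale circled_compact K
proof
  show "compact K" using closed_K bounded_K by (auto simp: compact_eq_bounded_closed bounded_iff)
  show "0 \<in> K" by (simp add: K_def)
  fix v assume v: "v \<in> K"
  show "vec_cnj v \<in> K" using v section_norm_cnj by (auto simp: K_def vec_cnj_eq_0)
  fix c :: complex assume c: "norm c \<le> 1"
  show "c *s v \<in> K"
  proof (cases "v = 0 \<or> c = 0")
    case False
    then have "1 \<le> section_norm v" using v by (simp add: K_def)
    also have "\<dots> \<le> section_norm v / norm c" using c False section_norm_nonneg[of v] by (simp add: le_divide_eq mult_left_le)
    finally show ?thesis using False by (simp add: K_def section_norm_scale)
  qed (auto simp: K_def)
qed

lemma dual_pseudonorm_le_1:
  assumes z: "z \<noteq> 0"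
  shows "dual_pseudonorm N (taut_map (z, t)) \<le> 1 \<longleftrightarrow> norm t \<le> section_norm z"
proof -
  have val: "\<phi> (t *s z) = t * \<phi> z" if "\<phi> \<in> fibre_O1 (cline z)" for \<phi>
    using that self_in_cline[of z] by (auto simp: fibre_O1_def)
  have d: "dual_pseudonorm N (taut_map (z, t)) =
      (SUP \<phi> \<in> {\<phi> \<in> fibre_O1 (cline z). norm (\<phi> z) * section_norm z \<le> 1}. ereal (norm t * norm (\<phi> z)))"
    unfolding dual_pseudonorm_def taut_map_def
    by (simp add: N_fibre[OF z] val norm_mult cong: SUP_cong_simp conj_cong)
  show ?thesis
  proof
    assume t: "norm t \<le> section_norm z"
    show "dual_pseudonorm N (taut_map (z, t)) \<le> 1"
      unfolding d
    proof (rule SUP_least)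
      fix \<phi> assume "\<phi> \<in> {\<phi> \<in> fibre_O1 (cline z). norm (\<phi> z) * section_norm z \<le> 1}"
      then have "norm (\<phi> z) * section_norm z \<le> 1" by simp
      moreover have "norm t * norm (\<phi> z) \<le> section_norm z * norm (\<phi> z)" using t by (intro mult_right_mono) auto
      ultimately show "ereal (norm t * norm (\<phi> z)) \<le> 1" by (simp add: mult.commute)
    qed
  next
    assume le: "dual_pseudonorm N (taut_map (z, t)) \<le> 1"
    show "norm t \<le> section_norm z"
    proof (rule ccontr)
      assume nt: "\<not> norm t \<le> section_norm z"
      have g0: "0 \<le> section_norm z" by (rule section_norm_nonneg[OF z])
      \<comment> \<open>The scale of a form of norm at most 1 that takes a value larger than 1 at
        \<open>t z\<close>. If \<open>section_norm z\<close> is 0, all forms have norm 0 and the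
        factor is only adapted to \<open>t\<close>.\<close>
      define a where "a = (if section_norm z = 0 then 2 / norm t else 1 / section_norm z)"
      have a: "0 < a" "a * section_norm z \<le> 1" "1 < norm t * a" using nt g0 by (auto simp: a_def field_simps)
      define \<phi> where "\<phi> = (\<lambda>v\<in>cline z. of_real a * unit_form z v)"
      have mem: "\<phi> \<in> fibre_O1 (cline z)"
        using unit_form_fibre[OF z] unfolding fibre_O1_def \<phi>_def
        by (auto simp: cline_def distrib_left vector_smult_assoc simp flip: vector_sadd_rdistrib)
      have val\<phi>: "norm (\<phi> z) = a" using unit_form_scale[OF z, of 1] self_in_cline[of z] a by (simp add: \<phi>_def norm_mult)
      have "ereal (norm t * norm (\<phi> z)) \<le> dual_pseudonorm N (taut_map (z, t))"
        unfolding d using a mem val\<phi> by (intro SUP_upper) auto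
      then have "ereal (norm t * a) \<le> 1" using le val\<phi> order_trans by metis
      then show False using a by simp
    qed
  qed
qed

lemma analytic_tube_eq: "analytic_tube N = {p \<in> topspace taut_space. snd p \<in> K}"
proof -
  have "dual_pseudonorm N (taut_map (z, t)) \<le> 1 \<longleftrightarrow> t *s z \<in> K" if z: "z \<noteq> 0" for z t
  proof (cases "t = 0")
    case True
    then show ?thesis using dual_pseudonorm_le_1[OF z, of t] section_norm_nonneg[OF z] by (simp add: K_def)
  next
    case False
    then have "t *s z \<in> K \<longleftrightarrow> 1 \<le> section_norm z / norm t" using z by (simp add: K_def section_norm_scale)
    then show ?thesis using dual_pseudonorm_le_1[OF z, of t] False by (simp add: le_divide_eq)
  qed
  then show ?thesis by (auto simp: analytic_tube_def topspace_taut_space)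
qed

end

section \<open>Taylor coefficients along the fibres\<close>

lemma deriv_funpow_poly_0: "(deriv ^^ n) (poly p) 0 = fact n * coeff p n" for p :: "complex poly"
proof (induction n arbitrary: p)
  case 0
  then show ?case by (simp add: poly_0_coeff_0)
next
  case (Suc n)
  have "deriv (poly p) = poly (pderiv p)" by (intro ext DERIV_imp_deriv poly_DERIV)
  then have "(deriv ^^ Suc n) (poly p) 0 = (deriv ^^ n) (poly (pderiv p)) 0"
    by (simp only: funpow_Suc_right o_def)
  then show ?case by (simp add: Suc.IH coeff_pderiv algebra_simps)
qed

lemma continuous_vscale: "continuous_on S (\<lambda>(z, t). t *s (z :: complex ^ 'n::finite))"
  unfolding vector_scalar_mult_def case_prod_unfold by (intro continuous_intros)

text \<open>The condition of \<open>holomorphic_wrt\<close> at one point, in a shape for which sum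
  and product rules can be stated.\<close>

definition complex_diff :: "((complex ^ 'n::finite) \<times> complex \<Rightarrow> complex) \<Rightarrow> (complex ^ 'n) \<times> complex \<Rightarrow> bool" where
  "complex_diff f x \<longleftrightarrow> (\<exists>D. (f has_derivative D) (at x) \<and> (\<forall>c v. D ((\<lambda>c (z, t). (c *s z, c * t)) c v) = c * D v))"

lemma analytic_function_iff:
  "analytic_function U f \<longleftrightarrow> (\<forall>z t. z \<noteq> 0 \<longrightarrow> taut_map (z, t) \<in> U \<longrightarrow> complex_diff (f \<circ> taut_map) (z, t))"
  by (auto simp: analytic_function_def holomorphic_wrt_def complex_diff_def)

lemma complex_diff_const: "complex_diff (\<lambda>_. c) x"
  unfolding complex_diff_def by (intro exI[of _ "\<lambda>_. 0"]) auto

lemma complex_diff_fst: "complex_diff (\<lambda>p. fst p $ i) x"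
  unfolding complex_diff_def
proof (intro exI conjI allI)
  show "((\<lambda>p. fst p $ i) has_derivative (\<lambda>h. fst h $ i)) (at x)"
    by (rule bounded_linear_imp_has_derivative)
      (rule bounded_linear_compose[OF bounded_linear_vec_nth bounded_linear_fst])
qed (auto simp: case_prod_unfold)

lemma complex_diff_snd: "complex_diff snd x"
  unfolding complex_diff_def
proof (intro exI conjI allI)
  show "(snd has_derivative snd) (at x)"
    by (rule bounded_linear_imp_has_derivative) (rule bounded_linear_snd)
qed (auto simp: case_prod_unfold)

lemma complex_diff_add:
  assumes "complex_diff f x" "complex_diff g x" shows "complex_diff (\<lambda>p. f p + g p) x"
proof -
  obtain D E where D: "(f has_derivative D) (at x)" "\<forall>c v. D ((\<lambda>c (z, t). (c *s z, c * t)) c v) = c * D v"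
    and E: "(g has_derivative E) (at x)" "\<forall>c v. E ((\<lambda>c (z, t). (c *s z, c * t)) c v) = c * E v"
    using assms unfolding complex_diff_def by blast
  show ?thesis
    unfolding complex_diff_def using D(2) E(2)
    by (intro exI[of _ "\<lambda>h. D h + E h"] conjI has_derivative_add[OF D(1) E(1)]) (simp add: distrib_left)
qed

lemma complex_diff_mult:
  assumes "complex_diff f x" "complex_diff g x" shows "complex_diff (\<lambda>p. f p * g p) x"
proof -
  obtain D E where D: "(f has_derivative D) (at x)" "\<forall>c v. D ((\<lambda>c (z, t). (c *s z, c * t)) c v) = c * D v"
    and E: "(g has_derivative E) (at x)" "\<forall>c v. E ((\<lambda>c (z, t). (c *s z, c * t)) c v) = c * E v"
    using assms unfolding complex_diff_def by blast
  show ?thesis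
    unfolding complex_diff_def using D(2) E(2)
    by (intro exI[of _ "\<lambda>h. f x * E h + D h * g x"] conjI has_derivative_mult[OF D(1) E(1)]) (simp add: distrib_left mult_ac)
qed

lemma complex_diff_sum: "(\<And>a. a \<in> A \<Longrightarrow> complex_diff (f a) x) \<Longrightarrow> complex_diff (\<lambda>p. \<Sum>a\<in>A. f a p) x"
  by (induction A rule: infinite_finite_induct) (auto intro: complex_diff_add complex_diff_const)

lemma complex_diff_prod: "(\<And>a. a \<in> A \<Longrightarrow> complex_diff (f a) x) \<Longrightarrow> complex_diff (\<lambda>p. \<Prod>a\<in>A. f a p) x"
  by (induction A rule: infinite_finite_induct) (auto intro: complex_diff_mult complex_diff_const)

lemma complex_diff_power: "complex_diff f x \<Longrightarrow> complex_diff (\<lambda>p. f p ^ n) x"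
  by (induction n) (auto intro: complex_diff_mult complex_diff_const)

abbreviation tube_fun :: "'n::finite cpoly \<Rightarrow> 'n tube_pt \<Rightarrow> complex" where
  "tube_fun P \<equiv> (\<lambda>(x, v). poly_eval P v)"

lemma tube_fun_taut_map: "tube_fun P (taut_map (z, t)) = poly_eval P (t *s z)"
  by (simp add: taut_map_def)

lemma analytic_tube_fun: "analytic_function U (tube_fun P)"
proof -
  have "tube_fun P \<circ> taut_map = (\<lambda>p. \<Sum>\<alpha>\<in>Poly_Mapping.keys P. lk P \<alpha> * (\<Prod>i\<in>UNIV. (snd p * fst p $ i) ^ lk \<alpha> i))"
    by (auto simp: fun_eq_iff taut_map_def poly_eval_def)
  then show ?thesis
    unfolding analytic_function_iff
    by (auto intro!: complex_diff_sum complex_diff_mult complex_diff_const complex_diff_prod complex_diff_power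
        complex_diff_fst complex_diff_snd)
qed

lemma analytic_function_mono: "analytic_function U f \<Longrightarrow> V \<subseteq> U \<Longrightarrow> analytic_function V f"
  unfolding analytic_function_iff by blast

lemma analytic_function_cmult: "analytic_function U f \<Longrightarrow> analytic_function U (\<lambda>p. c * f p)"
  unfolding analytic_function_iff o_def by (auto intro: complex_diff_mult complex_diff_const)

lemma analytic_function_slice:
  assumes "analytic_function U f" "z \<noteq> 0" "taut_map (z, t) \<in> U"
  shows "(\<lambda>s. f (taut_map (z, s))) field_differentiable (at t)"
proof -
  obtain D where D: "((f \<circ> taut_map) has_derivative D) (at (z, t))" and lin: "\<And>c z t. D (c *s z, c * t) = c * D (z, t)"
    using assms unfolding analytic_function_iff complex_diff_def by fastforce
  have "((\<lambda>s. (z, s)) has_derivative (\<lambda>h. (0, h))) (at t)"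
    by (intro has_derivative_Pair has_derivative_const has_derivative_ident)
  from diff_chain_at[OF this D]
  have "((\<lambda>s. f (taut_map (z, s))) has_derivative (\<lambda>h. D (0, h))) (at t)"
    by (simp add: o_def)
  moreover have "(\<lambda>h. D (0, h)) = (*) (D (0, 1))"
  proof
    fix h
    show "D (0, h) = D (0, 1) * h" using lin[of h 0 1] by simp
  qed
  ultimately show ?thesis
    unfolding field_differentiable_def has_field_derivative_def by auto
qed

lemma analytic_function_isCont:
  assumes "analytic_function U f" "z \<noteq> 0" "taut_map (z, t) \<in> U"
  shows "isCont (f \<circ> taut_map) (z, t)"
  using assms unfolding analytic_function_iff complex_diff_def by (metis has_derivative_continuous)

text \<open>The Taylor coefficient of a germ along the line through \<open>z\<close>, which makes
  sense near the tube because the tube contains the zero section. It extends the homogeneous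
  components from polynomials to all germs.\<close>

definition fibre_coeff :: "('n::finite tube_pt \<Rightarrow> complex) \<Rightarrow> nat \<Rightarrow> complex ^ 'n \<Rightarrow> complex" where
  "fibre_coeff f n z = (deriv ^^ n) (\<lambda>s. f (taut_map (z, s))) 0 / fact n"

lemma fibre_coeff_tube_fun: "fibre_coeff (tube_fun P) n z = comp_val n P z"
proof -
  let ?p = "\<Sum>m\<in>degree_set P. monom (comp_val m P z) m"
  have "tube_fun P (taut_map (z, s)) = poly ?p s" for s
  proof -
    have "tube_fun P (taut_map (z, s)) = (\<Sum>m\<in>degree_set P. comp_val m P (s *s z))"
      unfolding tube_fun_taut_map by (rule poly_eval_eq_sum_comp_val) auto
    then show ?thesis by (simp add: comp_val_scale poly_sum poly_monom mult.commute)
  qed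
  then have "(\<lambda>s. tube_fun P (taut_map (z, s))) = poly ?p" by blast
  then have "fibre_coeff (tube_fun P) n z = coeff ?p n"
    unfolding fibre_coeff_def by (simp only: deriv_funpow_poly_0) simp
  also have "\<dots> = comp_val n P z"
    by (cases "n \<in> degree_set P") (auto simp: coeff_sum if_distrib comp_val_eq_0 cong: if_cong)
  finally show ?thesis .
qed

section \<open>Compact neighbourhoods of the tube and Cauchy estimates\<close>

context seminormed
begin

abbreviation "tube \<equiv> analytic_tube N"

text \<open>Restricting \<open>z\<close> to the unit sphere makes the set compact, while its image
  still contains all points of the total space lying over \<open>nbhd_seq j\<close>.\<close>

definition unit_nbhd :: "nat \<Rightarrow> ((complex ^ 'n) \<times> complex) set" where
  "unit_nbhd j = {(z, t). norm z = 1 \<and> t *s z \<in> nbhd_seq j}"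

lemma taut_map_in_tube: "z \<noteq> 0 \<Longrightarrow> t *s z \<in> K \<Longrightarrow> taut_map (z, t) \<in> tube"
  by (simp add: analytic_tube_eq taut_map_in_space)

lemma zero_section_in_tube: "z \<noteq> 0 \<Longrightarrow> taut_map (z, 0) \<in> tube"
  by (rule taut_map_in_tube) (simp_all add: K_zero)

lemma nbhd_seq_bounded: "\<exists>R>0. \<forall>i. \<forall>v\<in>nbhd_seq i. norm v \<le> R"
proof -
  obtain R where "R > 0" "\<forall>v\<in>nbhd_seq 0. norm v \<le> R" using closed_nbhd_bounded unfolding nbhd_seq_def by blast
  then show ?thesis using nbhd_seq_mono[of 0] by blast
qed

lemma compact_unit_nbhd: "compact (unit_nbhd j)"
proof -
  obtain R where R: "\<And>v. v \<in> nbhd_seq j \<Longrightarrow> norm v \<le> R" using nbhd_seq_bounded by blast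
  have "unit_nbhd j \<subseteq> sphere 0 1 \<times> cball 0 R"
    using R by (force simp: unit_nbhd_def norm_vscale)
  moreover have "unit_nbhd j = (sphere 0 1 \<times> cball 0 R) \<inter> (\<lambda>(z, t). t *s z) -` nbhd_seq j"
    using R by (force simp: unit_nbhd_def norm_vscale)
  moreover have "closed ((\<lambda>(z, t). t *s (z :: complex ^ 'n)) -` nbhd_seq j)"
    by (rule closed_vimage[OF compact_imp_closed[OF compact_nbhd_seq] continuous_vscale])
  ultimately show ?thesis
    by (metis compact_Int_closed compact_Times compact_sphere compact_cball)
qed

text \<open>Otherwise points outside \<open>U\<close> over smaller and smaller neighbourhoods would,
  by compactness, accumulate at a point over \<open>K\<close>; that point lies in the tube, hence in
  the open set \<open>U\<close>.\<close>

lemma nbhd_nbhd_seq: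
  assumes "open_nbhd tube U"
  shows "\<exists>j. \<forall>(z, t)\<in>unit_nbhd j. taut_map (z, t) \<in> U"
proof (rule ccontr)
  assume "\<not> ?thesis"
  then have "\<forall>j. \<exists>p. p \<in> unit_nbhd j \<and> taut_map p \<notin> U" by fastforce
  then obtain p where p: "\<And>j. p j \<in> unit_nbhd j" "\<And>j. taut_map (p j) \<notin> U" by metis
  have "p j \<in> unit_nbhd 0" for j using p(1)[of j] nbhd_seq_mono[of 0 j] by (auto simp: unit_nbhd_def)
  then obtain l r where r: "l \<in> unit_nbhd 0" "strict_mono r" "(p \<circ> r) \<longlonglongrightarrow> l"
    using compact_unit_nbhd[of 0] unfolding compact_def by metis
  obtain z t where l: "l = (z, t)" by force
  have z: "z \<noteq> 0" using r(1) by (auto simp: l unit_nbhd_def)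
  have "isCont (\<lambda>(z, t). t *s (z :: complex ^ 'n)) l"
    using continuous_vscale[where S = UNIV] continuous_on_eq_continuous_at[OF open_UNIV] by blast
  from isCont_tendsto_compose[OF this r(3)]
  have "(\<lambda>i. (\<lambda>(z, t). t *s z) ((p \<circ> r) i)) \<longlonglongrightarrow> (\<lambda>(z, t). t *s z) l" .
  then have "(\<lambda>i. infdist ((\<lambda>(z, t). t *s z) ((p \<circ> r) i)) K) \<longlonglongrightarrow> infdist (t *s z) K"
    using tendsto_infdist by (fastforce simp: l)
  moreover have "(\<lambda>i. 1 / real (Suc i)) \<longlonglongrightarrow> 0" by (rule LIMSEQ_Suc[OF lim_1_over_n])
  moreover have "infdist ((\<lambda>(z, t). t *s z) ((p \<circ> r) i)) K \<le> 1 / real (Suc i)" for i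
  proof -
    have "(\<lambda>(z, t). t *s z) (p (r i)) \<in> nbhd_seq i"
      using p(1)[of "r i"] nbhd_seq_mono[OF seq_suble[OF r(2)], of i] by (auto simp: unit_nbhd_def)
    then show ?thesis by (simp add: nbhd_seq_def closed_nbhd_def)
  qed
  ultimately have "infdist (t *s z) K \<le> 0"
    by (intro LIMSEQ_le[of _ _ "\<lambda>i. 1 / real (Suc i)"]) auto
  then have "t *s z \<in> K"
    using in_closed_iff_infdist_zero[OF closed_K K_ne] infdist_nonneg[of "t *s z" K] by simp
  then have "taut_map (z, t) \<in> U" using assms taut_map_in_tube[OF z] by (auto simp: open_nbhd_def)
  then have "l \<in> {(z, t). z \<noteq> 0 \<and> taut_map (z, t) \<in> U}" using z by (simp add: l)
  moreover have "open {(z, t). z \<noteq> 0 \<and> taut_map (z, t) \<in> U}"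
    using assms by (intro open_taut_preimage) (simp add: open_nbhd_def)
  ultimately have "\<forall>\<^sub>F i in sequentially. (p \<circ> r) i \<in> {(z, t). z \<noteq> 0 \<and> taut_map (z, t) \<in> U}"
    using topological_tendstoD[OF r(3)] by blast
  from eventually_happens'[OF sequentially_bot this]
  obtain i where "(p \<circ> r) i \<in> {(z, t). z \<noteq> 0 \<and> taut_map (z, t) \<in> U}" by (rule exE)
  then show False using p(2)[of "r i"] by auto
qed

definition unit_nbhd_image :: "nat \<Rightarrow> 'n tube_pt set" where
  "unit_nbhd_image j = taut_map ` unit_nbhd j"

lemma unit_nbhd_ne: "\<exists>z. (z, 0) \<in> unit_nbhd j"
proof -
  obtain z :: "complex ^ 'n" where "norm z = 1" using vector_choose_size[of 1] by auto
  then show ?thesis using nbhd_seq_zero[of j] by (auto simp: unit_nbhd_def)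
qed

lemma unit_nbhd_image_ne: "unit_nbhd_image j \<noteq> {}"
  using unit_nbhd_ne by (auto simp: unit_nbhd_image_def)

lemma compactin_unit_nbhd_image: "compactin taut_space (unit_nbhd_image j)"
proof -
  have "compactin (top_of_set ((- {0}) \<times> UNIV)) (unit_nbhd j)"
    using compact_unit_nbhd[of j] by (auto simp: compactin_subtopology unit_nbhd_def)
  moreover have "continuous_map (top_of_set ((- {0}) \<times> UNIV)) taut_space (taut_map :: _ \<Rightarrow> 'n tube_pt)"
    unfolding taut_space_def by (intro quotient_imp_continuous_map quotient_map_quotient_topology)
  ultimately show ?thesis unfolding unit_nbhd_image_def by (rule image_compactin)
qed

definition sup_near_tube :: "nat \<Rightarrow> ('n tube_pt \<Rightarrow> complex) \<Rightarrow> real" where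
  "sup_near_tube j f = (SUP p\<in>unit_nbhd_image j. cmod (f p))"

lemma sup_near_tube_upper:
  assumes U: "\<forall>(z, t)\<in>unit_nbhd j. taut_map (z, t) \<in> U" and f: "analytic_function U f" and zt: "(z, t) \<in> unit_nbhd j"
  shows "cmod (f (taut_map (z, t))) \<le> sup_near_tube j f"
proof -
  have cont: "isCont (f \<circ> taut_map) p" if "p \<in> unit_nbhd j" for p
  proof -
    obtain z t where p: "p = (z, t)" by force
    have "z \<noteq> 0" "taut_map (z, t) \<in> U" using U that by (auto simp: p unit_nbhd_def)
    then show ?thesis unfolding p by (rule analytic_function_isCont[OF f])
  qed
  have "continuous_on (unit_nbhd j) (\<lambda>p. cmod ((f \<circ> taut_map) p))"
    by (intro continuous_on_norm continuous_at_imp_continuous_on ballI cont)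
  then have "bdd_above ((\<lambda>p. cmod ((f \<circ> taut_map) p)) ` unit_nbhd j)"
    by (intro bounded_imp_bdd_above compact_imp_bounded compact_continuous_image compact_unit_nbhd)
  then have "bdd_above ((\<lambda>p. cmod (f p)) ` unit_nbhd_image j)" by (simp add: unit_nbhd_image_def image_image)
  then show ?thesis unfolding sup_near_tube_def using zt by (intro cSUP_upper) (auto simp: unit_nbhd_image_def)
qed

lemma nbhd_seq_circled: "norm c \<le> 1 \<Longrightarrow> v \<in> nbhd_seq j \<Longrightarrow> c *s v \<in> nbhd_seq j"
  unfolding nbhd_seq_def by (rule closed_nbhd_circled)

text \<open>Cauchy's inequality on the disc of radius \<open>norm t\<close> in the fibre;
  circledness of the neighbourhood keeps that disc inside it.\<close>

lemma fibre_coeff_bound: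
  assumes U: "\<forall>(z, t)\<in>unit_nbhd j. taut_map (z, t) \<in> U" and f: "analytic_function U f" and zt: "(z, t) \<in> unit_nbhd j"
  shows "cmod (fibre_coeff f n z) * cmod t ^ n \<le> sup_near_tube j f"
proof -
  have z: "norm z = 1" "z \<noteq> 0" and t: "t *s z \<in> nbhd_seq j" using zt by (auto simp: unit_nbhd_def)
  have in_unit_nbhd: "(z, s) \<in> unit_nbhd j" if "norm s \<le> norm t" for s
  proof (cases "t = 0")
    case False
    have "(s / t) *s (t *s z) \<in> nbhd_seq j" using that False by (intro nbhd_seq_circled t) (simp add: norm_divide divide_le_eq)
    then show ?thesis using z False by (simp add: unit_nbhd_def vector_smult_assoc)
  qed (use that zt in auto)
  have b: "cmod (f (taut_map (z, s))) \<le> sup_near_tube j f" if "norm s \<le> norm t" for s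
    by (rule sup_near_tube_upper[OF U f in_unit_nbhd[OF that]])
  have S0: "0 \<le> sup_near_tube j f" using b[of t] norm_ge_zero order_trans by blast
  let ?F = "\<lambda>s. f (taut_map (z, s))"
  show ?thesis
  proof (cases "t = 0")
    \<comment> \<open>For \<open>t = 0\<close> only degree 0 contributes, because
      \<open>0 ^ 0 = 1\<close>.\<close>
    case True
    then show ?thesis using b[of 0] S0 by (cases n) (auto simp: fibre_coeff_def)
  next
    case False
    have fd: "?F field_differentiable (at s)" if "norm s \<le> norm t" for s
      using analytic_function_slice[OF f z(2)] U in_unit_nbhd[OF that] by auto
    have hol: "?F holomorphic_on cball 0 (norm t)"
    proof (rule holomorphic_onI)
      fix s :: complex assume "s \<in> cball 0 (norm t)"
      then have "norm s \<le> norm t" by simp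
      from field_differentiable_at_within[OF fd[OF this]]
      show "?F field_differentiable (at s within cball 0 (norm t))" .
    qed
    have "norm ((deriv ^^ n) ?F 0) \<le> fact n * sup_near_tube j f / norm t ^ n"
    proof (rule Cauchy_inequality)
      show "?F holomorphic_on ball 0 (norm t)" by (rule holomorphic_on_subset[OF hol]) auto
      show "continuous_on (cball 0 (norm t)) ?F" by (rule holomorphic_on_imp_continuous_on[OF hol])
      show "0 < norm t" using False by simp
      fix s :: complex assume "norm (0 - s) = norm t"
      then show "norm (?F s) \<le> sup_near_tube j f" by (intro b) simp
    qed
    then show ?thesis using False by (simp add: fibre_coeff_def norm_divide field_simps)
  qed
qed

text \<open>All but finitely many degrees are measured inside \<open>nbhd_seq j\<close>, where
  Cauchy's estimate applies. In the remaining ones a dilation by a fixed \<open>c\<close> leads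
  there, and its cost is bounded because these degrees are finite in number.\<close>

lemma fibre_coeff_bound_slow:
  assumes U: "\<forall>(z, t)\<in>unit_nbhd j. taut_map (z, t) \<in> U" and k: "finite {n. k n < j}"
  shows "\<exists>C. \<forall>f n z t. analytic_function U f \<longrightarrow> (z, t) \<in> unit_nbhd (k n) \<longrightarrow> cmod (fibre_coeff f n z) * cmod t ^ n \<le> C * sup_near_tube j f"
proof -
  obtain R where R: "R > 0" "\<And>i v. v \<in> nbhd_seq i \<Longrightarrow> norm v \<le> R" using nbhd_seq_bounded by blast
  \<comment> \<open>Scaling by \<open>c\<close> brings all neighbourhoods of the sequence into the
    ball of radius \<open>1 / Suc j\<close>, which \<open>nbhd_seq j\<close> contains.\<close>
  define c where "c = (1 / real (Suc j)) / R"
  have c: "0 < c" using R by (simp add: c_def)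
  define C where "C = 1 + (\<Sum>n\<in>{n. k n < j}. (1 / c) ^ n)"
  show ?thesis
  proof (intro exI[of _ C] allI impI)
    fix f n z t assume f: "analytic_function U f" and zt: "(z, t) \<in> unit_nbhd (k n)"
    have "0 \<le> sup_near_tube j f"
      using unit_nbhd_ne[of j] sup_near_tube_upper[OF U f] norm_ge_zero order_trans by blast
    show "cmod (fibre_coeff f n z) * cmod t ^ n \<le> C * sup_near_tube j f"
    proof (cases "k n < j")
      case False
      then have "(z, t) \<in> unit_nbhd j" using zt nbhd_seq_mono[of j "k n"] by (auto simp: unit_nbhd_def)
      then have "cmod (fibre_coeff f n z) * cmod t ^ n \<le> 1 * sup_near_tube j f" using fibre_coeff_bound[OF U f] by simp
      also have "\<dots> \<le> C * sup_near_tube j f" using \<open>0 \<le> sup_near_tube j f\<close> c unfolding C_def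
        by (intro mult_right_mono) (auto intro!: sum_nonneg)
      finally show ?thesis .
    next
      case True
      have z: "norm z = 1" and t: "norm t \<le> R"
        using zt R(2)[of "t *s z" "k n"] by (auto simp: unit_nbhd_def norm_vscale)
      have "norm ((of_real c * t) *s z) = c * norm t" using c z by (simp add: norm_vscale norm_mult)
      also have "\<dots> \<le> c * R" using c t by (intro mult_left_mono) auto
      also have "\<dots> = 1 / real (Suc j)" using R(1) by (simp add: c_def)
      finally have "norm ((of_real c * t) *s z) \<le> 1 / real (Suc j)" .
      then have "(of_real c * t) *s z \<in> nbhd_seq j" unfolding nbhd_seq_def by (rule ball_sub_closed_nbhd)
      then have "(z, of_real c * t) \<in> unit_nbhd j" using z by (simp add: unit_nbhd_def)
      from fibre_coeff_bound[OF U f this, of n]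
      have "cmod (fibre_coeff f n z) * cmod t ^ n \<le> (1 / c) ^ n * sup_near_tube j f"
        using c by (simp add: norm_mult power_mult_distrib field_simps)
      also have "(1 / c) ^ n \<le> (\<Sum>n\<in>{n. k n < j}. (1 / c) ^ n)"
        using True k c by (intro member_le_sum[of n]) auto
      then have "(1 / c) ^ n * sup_near_tube j f \<le> C * sup_near_tube j f"
        using \<open>0 \<le> sup_near_tube j f\<close> unfolding C_def by (intro mult_right_mono) auto
      finally show ?thesis .
    qed
  qed
qed

end

section \<open>The bornology of the tube\<close>

lemma continuous_Pair_slice: "continuous_on UNIV (\<lambda>s :: complex. (z :: complex ^ 'n::finite, s))"
  by (intro continuous_intros)

lemma open_slice:
  assumes "openin taut_space (U :: 'n::finite tube_pt set)" "z \<noteq> 0"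
  shows "open {s. taut_map (z, s) \<in> U}"
proof -
  have "open ((\<lambda>s. (z, s)) -` {(z, t). z \<noteq> 0 \<and> taut_map (z, t) \<in> U})"
    by (rule open_vimage[OF open_taut_preimage[OF assms(1)] continuous_Pair_slice])
  moreover have "(\<lambda>s. (z, s)) -` {(z, t). z \<noteq> 0 \<and> taut_map (z, t) \<in> U} = {s. taut_map (z, s) \<in> U}"
    using assms(2) by auto
  ultimately show ?thesis by simp
qed

lemma holomorphic_slice:
  assumes "openin taut_space U" "analytic_function U f" "z \<noteq> 0"
  shows "(\<lambda>s. f (taut_map (z, s))) holomorphic_on {s. taut_map (z, s) \<in> U}"
proof (rule holomorphic_onI)
  fix s assume "s \<in> {s. taut_map (z, s) \<in> U}"
  then have "taut_map (z, s) \<in> U" by simp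
  from field_differentiable_at_within[OF analytic_function_slice[OF assms(2,3) this]]
  show "(\<lambda>s. f (taut_map (z, s))) field_differentiable (at s within {s. taut_map (z, s) \<in> U})" .
qed

context seminormed
begin

lemma open_nbhdD: "open_nbhd tube U \<Longrightarrow> openin taut_space U" "open_nbhd tube U \<Longrightarrow> z \<noteq> 0 \<Longrightarrow> taut_map (z, 0) \<in> U"
  using zero_section_in_tube by (auto simp: open_nbhd_def)

lemma open_nbhd_Int: "open_nbhd tube U \<Longrightarrow> open_nbhd tube V \<Longrightarrow> open_nbhd tube (U \<inter> V)"
  by (auto simp: open_nbhd_def)

text \<open>The coefficient depends only on values near the zero section, over which
  \<open>U\<close> is a neighbourhood.\<close>

lemma fibre_coeff_cong:
  assumes U: "open_nbhd tube U" and eq: "\<And>p. p \<in> U \<Longrightarrow> f p = h p" and z: "z \<noteq> 0"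
  shows "fibre_coeff f n z = fibre_coeff h n z"
proof -
  have "open {s. taut_map (z, s) \<in> U}" "0 \<in> {s. taut_map (z, s) \<in> U}"
    using open_slice[OF open_nbhdD(1)[OF U] z] open_nbhdD(2)[OF U z] by auto
  then have "\<forall>\<^sub>F s in nhds 0. s \<in> {s. taut_map (z, s) \<in> U}" by (rule eventually_nhds_in_open)
  then have "\<forall>\<^sub>F s in nhds 0. f (taut_map (z, s)) = h (taut_map (z, s))"
    by eventually_elim (simp add: eq)
  then have "(deriv ^^ n) (\<lambda>s. f (taut_map (z, s))) 0 = (deriv ^^ n) (\<lambda>s. h (taut_map (z, s))) 0"
    by (rule higher_deriv_cong_ev) simp
  then show ?thesis by (simp add: fibre_coeff_def)
qed

lemma fibre_coeff_cmult:
  assumes U: "open_nbhd tube U" and f: "analytic_function U f" and z: "z \<noteq> 0"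
  shows "fibre_coeff (\<lambda>p. c * f p) n z = c * fibre_coeff f n z"
proof -
  have "(deriv ^^ n) (\<lambda>s. c * f (taut_map (z, s))) 0 = c * (deriv ^^ n) (\<lambda>s. f (taut_map (z, s))) 0"
    using open_nbhdD[OF U] z
    by (intro higher_deriv_cmult[OF holomorphic_slice[OF open_nbhdD(1)[OF U] f z]] open_slice) auto
  then show ?thesis by (simp add: fibre_coeff_def)
qed

lemma fibre_coeff_add:
  assumes U: "open_nbhd tube U" and f: "analytic_function U f" "analytic_function U h" and z: "z \<noteq> 0"
  shows "fibre_coeff (\<lambda>p. f p + h p) n z = fibre_coeff f n z + fibre_coeff h n z"
proof -
  have "(deriv ^^ n) (\<lambda>s. f (taut_map (z, s)) + h (taut_map (z, s))) 0 =
      (deriv ^^ n) (\<lambda>s. f (taut_map (z, s))) 0 + (deriv ^^ n) (\<lambda>s. h (taut_map (z, s))) 0"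
    using open_nbhdD[OF U] z
    by (intro higher_deriv_add[OF holomorphic_slice[OF open_nbhdD(1)[OF U] f(1) z] holomorphic_slice[OF open_nbhdD(1)[OF U] f(2) z]] open_slice) auto
  then show ?thesis by (simp add: fibre_coeff_def add_divide_distrib)
qed

text \<open>
  The neighbourhood used to measure the Taylor coefficient of degree \<open>n\<close> may shrink to the tube as
  \<open>n\<close> grows. Seminorms of this form detect the unbounded sets.
\<close>

definition coeff_seminorm :: "(nat \<Rightarrow> nat) \<Rightarrow> ('n tube_pt \<Rightarrow> complex) \<Rightarrow> real" where
  "coeff_seminorm k f = (SUP (n, z, t) \<in> {(n, z, t). (z, t) \<in> unit_nbhd (k n)}. cmod (fibre_coeff f n z) * cmod t ^ n)"

lemma coeff_seminorm_upper:
  assumes k: "\<And>j. finite {n. k n < j}" and f: "f \<in> near_sections tube" and zt: "(z, t) \<in> unit_nbhd (k n)"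
  shows "cmod (fibre_coeff f n z) * cmod t ^ n \<le> coeff_seminorm k f"
proof -
  obtain U where U: "open_nbhd tube U" "analytic_function U f" using f by (auto simp: near_sections_def)
  obtain j where j: "\<forall>(z, t)\<in>unit_nbhd j. taut_map (z, t) \<in> U" using nbhd_nbhd_seq[OF U(1)] by (rule exE)
  obtain C where C: "\<forall>f n z t. analytic_function U f \<longrightarrow> (z, t) \<in> unit_nbhd (k n) \<longrightarrow> cmod (fibre_coeff f n z) * cmod t ^ n \<le> C * sup_near_tube j f"
    using fibre_coeff_bound_slow[OF j k] by (rule exE)
  have "bdd_above ((\<lambda>(n, z, t). cmod (fibre_coeff f n z) * cmod t ^ n) ` {(n, z, t). (z, t) \<in> unit_nbhd (k n)})"
    by (rule bdd_aboveI[of _ "C * sup_near_tube j f"]) (use C U(2) in auto)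
  from cSUP_upper[OF _ this, of "(n, z, t)"] zt show ?thesis by (simp add: coeff_seminorm_def)
qed

lemma coeff_seminorm_least:
  assumes "\<And>n z t. (z, t) \<in> unit_nbhd (k n) \<Longrightarrow> cmod (fibre_coeff f n z) * cmod t ^ n \<le> b"
  shows "coeff_seminorm k f \<le> b"
  unfolding coeff_seminorm_def
proof (rule cSUP_least)
  show "{(n, z, t). (z, t) \<in> unit_nbhd (k n)} \<noteq> {}" using unit_nbhd_ne[of "k 0"] by auto
qed (use assms in auto)

lemma unit_nbhd_nz: "(z, t) \<in> unit_nbhd j \<Longrightarrow> z \<noteq> 0"
  by (auto simp: unit_nbhd_def)

lemma coeff_seminorm_cmult:
  assumes k: "\<And>j. finite {n. k n < j}" and f: "f \<in> near_sections tube"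
  shows "coeff_seminorm k (\<lambda>p. c * f p) = cmod c * coeff_seminorm k f"
proof -
  obtain U where U: "open_nbhd tube U" "analytic_function U f" using f by (auto simp: near_sections_def)
  have cf: "(\<lambda>p. c * f p) \<in> near_sections tube"
    using U analytic_function_cmult[OF U(2)] by (auto simp: near_sections_def)
  have coef: "fibre_coeff (\<lambda>p. c * f p) n z = c * fibre_coeff f n z" if "z \<noteq> 0" for n z
    by (rule fibre_coeff_cmult[OF U that])
  have nn: "0 \<le> coeff_seminorm k h" if "h \<in> near_sections tube" for h
  proof -
    obtain z where "(z, 0) \<in> unit_nbhd (k 0)" using unit_nbhd_ne by blast
    from coeff_seminorm_upper[OF k that this] show ?thesis by (rule order_trans[rotated]) simp
  qed
  show ?thesis
  proof (rule antisym)
    show "coeff_seminorm k (\<lambda>p. c * f p) \<le> cmod c * coeff_seminorm k f"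
    proof (rule coeff_seminorm_least)
      fix n z t assume zt: "(z, t) \<in> unit_nbhd (k n)"
      show "cmod (fibre_coeff (\<lambda>p. c * f p) n z) * cmod t ^ n \<le> cmod c * coeff_seminorm k f"
        using mult_left_mono[OF coeff_seminorm_upper[OF k f zt], of "cmod c"] coef[OF unit_nbhd_nz[OF zt]]
        by (simp add: norm_mult mult.assoc)
    qed
    show "cmod c * coeff_seminorm k f \<le> coeff_seminorm k (\<lambda>p. c * f p)"
    proof (cases "c = 0")
      case False
      have "coeff_seminorm k f \<le> coeff_seminorm k (\<lambda>p. c * f p) / cmod c"
      proof (rule coeff_seminorm_least)
        fix n z t assume zt: "(z, t) \<in> unit_nbhd (k n)"
        show "cmod (fibre_coeff f n z) * cmod t ^ n \<le> coeff_seminorm k (\<lambda>p. c * f p) / cmod c"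
          using coeff_seminorm_upper[OF k cf zt] coef[OF unit_nbhd_nz[OF zt]] False
          by (simp add: norm_mult field_simps)
      qed
      then show ?thesis using False by (simp add: field_simps)
    qed (use nn[OF cf] in simp)
  qed
qed

text \<open>A neighbourhood \<open>U\<close> contains the compact image of index \<open>j\<close>
  for some \<open>j\<close>, and the sup over it controls all Taylor coefficients at once, whatever
  the speed at which \<open>k\<close> tends to infinity.\<close>

lemma coeff_seminorm_continuous:
  assumes k: "\<And>j. finite {n. k n < j}"
  shows "continuous_seminorm_on_germs tube (coeff_seminorm k)"
  unfolding continuous_seminorm_on_germs_def seminorm_on_germs_def
proof (intro conjI ballI allI impI)
  fix f h assume "same_germ tube f h"
  then obtain U where U: "open_nbhd tube U" "\<And>p. p \<in> U \<Longrightarrow> f p = h p" by (auto simp: same_germ_def)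
  have "fibre_coeff f n z = fibre_coeff h n z" if "(z, t) \<in> unit_nbhd (k n)" for n z t
    by (rule fibre_coeff_cong[OF U unit_nbhd_nz[OF that]])
  then have "(\<lambda>(n, z, t). cmod (fibre_coeff f n z) * cmod t ^ n) ` {(n, z, t). (z, t) \<in> unit_nbhd (k n)} =
      (\<lambda>(n, z, t). cmod (fibre_coeff h n z) * cmod t ^ n) ` {(n, z, t). (z, t) \<in> unit_nbhd (k n)}"
    by (intro image_cong) auto
  then show "coeff_seminorm k f = coeff_seminorm k h" by (simp add: coeff_seminorm_def)
next
  fix f assume f: "f \<in> near_sections tube"
  obtain z where "(z, 0) \<in> unit_nbhd (k 0)" using unit_nbhd_ne by blast
  from coeff_seminorm_upper[OF k f this] show "0 \<le> coeff_seminorm k f" by (rule order_trans[rotated]) simp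
next
  fix f c assume "f \<in> near_sections tube"
  then show "coeff_seminorm k (\<lambda>p. c * f p) = cmod c * coeff_seminorm k f" by (rule coeff_seminorm_cmult[OF k])
next
  fix f h assume f: "f \<in> near_sections tube" and h: "h \<in> near_sections tube"
  obtain U where U: "open_nbhd tube U" "analytic_function U f" using f by (auto simp: near_sections_def)
  obtain V where V: "open_nbhd tube V" "analytic_function V h" using h by (auto simp: near_sections_def)
  have UV: "open_nbhd tube (U \<inter> V)" "analytic_function (U \<inter> V) f" "analytic_function (U \<inter> V) h"
    using open_nbhd_Int[OF U(1) V(1)] analytic_function_mono[OF U(2)] analytic_function_mono[OF V(2)] by auto
  show "coeff_seminorm k (\<lambda>p. f p + h p) \<le> coeff_seminorm k f + coeff_seminorm k h"
  proof (rule coeff_seminorm_least)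
    fix n z t assume zt: "(z, t) \<in> unit_nbhd (k n)"
    have "cmod (fibre_coeff (\<lambda>p. f p + h p) n z) * cmod t ^ n \<le> (cmod (fibre_coeff f n z) + cmod (fibre_coeff h n z)) * cmod t ^ n"
      unfolding fibre_coeff_add[OF UV unit_nbhd_nz[OF zt]] by (intro mult_right_mono norm_triangle_ineq) simp
    also have "\<dots> \<le> coeff_seminorm k f + coeff_seminorm k h"
      using coeff_seminorm_upper[OF k f zt] coeff_seminorm_upper[OF k h zt] by (simp add: distrib_right)
    finally show "cmod (fibre_coeff (\<lambda>p. f p + h p) n z) * cmod t ^ n \<le> coeff_seminorm k f + coeff_seminorm k h" .
  qed
next
  fix U assume U: "open_nbhd tube U"
  obtain j where j: "\<forall>(z, t)\<in>unit_nbhd j. taut_map (z, t) \<in> U" using nbhd_nbhd_seq[OF U] by (rule exE)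
  obtain C where C: "\<forall>f n z t. analytic_function U f \<longrightarrow> (z, t) \<in> unit_nbhd (k n) \<longrightarrow> cmod (fibre_coeff f n z) * cmod t ^ n \<le> C * sup_near_tube j f"
    using fibre_coeff_bound_slow[OF j k] by (rule exE)
  have "coeff_seminorm k f \<le> C * (SUP p\<in>unit_nbhd_image j. cmod (f p))" if "analytic_function U f" for f
    unfolding sup_near_tube_def[symmetric] by (rule coeff_seminorm_least) (use C that in auto)
  moreover have "unit_nbhd_image j \<subseteq> U" using j by (auto simp: unit_nbhd_image_def)
  ultimately show "\<exists>K C. compactin taut_space K \<and> K \<noteq> {} \<and> K \<subseteq> U \<and>
      (\<forall>f. analytic_function U f \<longrightarrow> coeff_seminorm k f \<le> C * (SUP p\<in>K. cmod (f p)))"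
    using compactin_unit_nbhd_image[of j] unit_nbhd_image_ne[of j] by blast
qed

section \<open>Bounded sets of polynomials\<close>

lemma tube_fun_near: "tube_fun P \<in> near_sections tube"
proof -
  have "open_nbhd tube (topspace taut_space)" by (auto simp: open_nbhd_def analytic_tube_def)
  then show ?thesis using analytic_tube_fun[of "topspace taut_space" P] by (auto simp: near_sections_def)
qed

lemma tube_bounded_slow:
  assumes B: "tube_bounded N B" and k: "\<And>j. finite {n. k n < j}"
  shows "\<exists>R. \<forall>P\<in>B. \<forall>n. sup_norm (nbhd_seq (k n)) n P \<le> R"
proof -
  obtain R where R: "\<And>P. P \<in> B \<Longrightarrow> coeff_seminorm k (tube_fun P) \<le> R"
    using B coeff_seminorm_continuous[OF k] unfolding tube_bounded_def bounded_germs_def by fastforce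
  have "sup_norm (nbhd_seq (k n)) n P \<le> R" if P: "P \<in> B" for P n
  proof (rule sup_norm_least[OF nbhd_seq_ne])
    fix v assume v: "v \<in> nbhd_seq (k n)"
    obtain z t where zt: "v = t *s z" "(z, t) \<in> unit_nbhd (k n)"
    proof (cases "v = 0")
      case True
      obtain z where "(z, 0) \<in> unit_nbhd (k n)" using unit_nbhd_ne by blast
      then show thesis using True by (intro that[of 0 z]) auto
    next
      case False
      let ?t = "complex_of_real (norm v)" and ?z = "(1 / complex_of_real (norm v)) *s v"
      have "v = ?t *s ?z" using False by (simp add: vector_smult_assoc)
      moreover have "norm ?z = 1" using False by (simp add: norm_vscale norm_divide)
      ultimately show thesis using v that[of ?t ?z] by (simp add: unit_nbhd_def)
    qed
    have "norm (comp_val n P v) = cmod (fibre_coeff (tube_fun P) n z) * cmod t ^ n"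
      by (simp add: zt(1) comp_val_scale norm_mult norm_power fibre_coeff_tube_fun)
    also have "\<dots> \<le> R"
      using coeff_seminorm_upper[OF k tube_fun_near zt(2)] R[OF P] by (rule order_trans)
    finally show "norm (comp_val n P v) \<le> R" .
  qed
  then show ?thesis by blast
qed

lemma sup_norm_nbhd_seq_compare: "\<exists>C. \<forall>P. sup_norm (nbhd_seq i) n P \<le> C * sup_norm (nbhd_seq j) n P"
proof -
  obtain R where R: "R > 0" "\<And>v. v \<in> nbhd_seq i \<Longrightarrow> norm v \<le> R" using nbhd_seq_bounded by blast
  define c where "c = (1 / real (Suc j)) / R"
  have c: "0 < c" using R by (simp add: c_def)
  have "sup_norm (nbhd_seq i) n P \<le> (1 / c ^ n) * sup_norm (nbhd_seq j) n P" for P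
  proof (rule sup_norm_least[OF nbhd_seq_ne])
    fix v assume v: "v \<in> nbhd_seq i"
    have "norm (complex_of_real c *s v) = c * norm v" using c by (simp add: norm_vscale)
    also have "\<dots> \<le> c * R" using c R(2)[OF v] by (intro mult_left_mono) auto
    also have "\<dots> = 1 / real (Suc j)" using R(1) by (simp add: c_def)
    finally have "complex_of_real c *s v \<in> nbhd_seq j" unfolding nbhd_seq_def by (rule ball_sub_closed_nbhd)
    from sup_norm_upper[OF compact_nbhd_seq this, of n P]
    show "norm (comp_val n P v) \<le> (1 / c ^ n) * sup_norm (nbhd_seq j) n P"
      using c by (simp add: comp_val_scale norm_mult norm_power field_simps)
  qed
  then show ?thesis by blast
qed

text \<open>If every neighbourhood failed, there would be degrees \<open>m 0 < m 1 < ...\<close>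
  such that some element of \<open>B\<close> exceeds \<open>i\<close> on the neighbourhood of index
  \<open>i\<close> in degree \<open>m i\<close>. A \<open>k\<close> tending to infinity with
  \<open>k (m i) = i\<close> then gives a continuous seminorm unbounded on \<open>B\<close>.\<close>

lemma tube_bounded_imp:
  assumes B: "tube_bounded N B"
  shows "\<exists>i R. \<forall>P\<in>B. \<forall>n. sup_norm (nbhd_seq i) n P \<le> R"
proof (rule ccontr)
  assume neg: "\<not> ?thesis"
  \<comment> \<open>The diagonal choice of neighbourhoods bounds each single degree, so large values
    are forced into arbitrarily high degrees.\<close>
  have "\<exists>R. \<forall>P\<in>B. \<forall>n. sup_norm (nbhd_seq n) n P \<le> R"
    using tube_bounded_slow[OF B, of "\<lambda>n. n"] by simp
  then obtain R0 where R0: "\<And>P n. P \<in> B \<Longrightarrow> sup_norm (nbhd_seq n) n P \<le> R0" by blast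
  have deg: "\<exists>D. \<forall>P\<in>B. sup_norm (nbhd_seq i) n P \<le> D" for i n
  proof -
    obtain C where C: "\<And>P. sup_norm (nbhd_seq i) n P \<le> C * sup_norm (nbhd_seq n) n P" using sup_norm_nbhd_seq_compare by blast
    have "sup_norm (nbhd_seq i) n P \<le> \<bar>C\<bar> * R0" if "P \<in> B" for P
    proof -
      have "0 \<le> sup_norm (nbhd_seq n) n P" by (rule sup_norm_nonneg[OF compact_nbhd_seq nbhd_seq_ne])
      then have "C * sup_norm (nbhd_seq n) n P \<le> \<bar>C\<bar> * R0" using R0[OF that] by (intro mult_mono) auto
      then show ?thesis using C order_trans by blast
    qed
    then show ?thesis by blast
  qed
  then obtain D where D: "\<And>i n P. P \<in> B \<Longrightarrow> sup_norm (nbhd_seq i) n P \<le> D i n" by metis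
  have large: "\<exists>P n. P \<in> B \<and> m \<le> n \<and> real i < sup_norm (nbhd_seq i) n P" for i m
  proof (rule ccontr)
    assume no: "\<not> ?thesis"
    have "sup_norm (nbhd_seq i) n P \<le> real i + (\<Sum>n<m. \<bar>D i n\<bar>)" if P: "P \<in> B" for P n
    proof (cases "m \<le> n")
      case True
      then have "sup_norm (nbhd_seq i) n P \<le> real i" using no P by (meson not_le)
      moreover have "0 \<le> (\<Sum>n<m. \<bar>D i n\<bar>)" by (intro sum_nonneg) auto
      ultimately show ?thesis by linarith
    next
      case False
      then have "\<bar>D i n\<bar> \<le> (\<Sum>n<m. \<bar>D i n\<bar>)" by (intro member_le_sum) auto
      then show ?thesis using D[OF P, of i n] by linarith
    qed
    then show False using neg by blast
  qed
  have "\<exists>m. \<forall>i. (\<exists>P\<in>B. real i < sup_norm (nbhd_seq i) (m i) P) \<and> m i < m (Suc i)"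
  proof (rule dependent_nat_choice)
    show "\<exists>x. \<exists>P\<in>B. real 0 < sup_norm (nbhd_seq 0) x P" using large[of 0 0] by blast
    show "\<exists>y. (\<exists>P\<in>B. real (Suc n) < sup_norm (nbhd_seq (Suc n)) y P) \<and> x < y" for x n
      using large[of "Suc x" "Suc n"] by (auto simp: Suc_le_eq)
  qed
  then obtain m where m: "\<And>i. \<exists>P\<in>B. real i < sup_norm (nbhd_seq i) (m i) P" "\<And>i. m i < m (Suc i)" by blast
  have sm: "strict_mono m" using m(2) by (simp add: strict_mono_Suc_iff)
  \<comment> \<open>This function equals \<open>i\<close> from just above \<open>m (i - 1)\<close>
    up to \<open>m i\<close>, so it tends to infinity and meets every chosen degree on the
    neighbourhood where the large value occurs.\<close>
  define k where "k n = (LEAST i. n \<le> m i)" for n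
  have ex: "\<exists>i. n \<le> m i" for n using seq_suble[OF sm, of n] by blast
  have km: "k (m i) = i" for i
    unfolding k_def by (rule Least_equality) (auto simp: strict_mono_less_eq[OF sm])
  have "finite {n. k n < j}" for j
  proof (rule finite_subset)
    show "{n. k n < j} \<subseteq> {..m j}"
    proof clarify
      fix n assume "k n < j"
      have "n \<le> m (k n)" unfolding k_def using ex[of n] by (rule LeastI_ex)
      also have "\<dots> \<le> m j" using \<open>k n < j\<close> by (simp add: strict_mono_less_eq[OF sm])
      finally show "n \<le> m j" .
    qed
  qed simp
  from tube_bounded_slow[OF B this] obtain R where R: "\<And>P n. P \<in> B \<Longrightarrow> sup_norm (nbhd_seq (k n)) n P \<le> R" by blast
  obtain i :: nat where i: "R < real i" using reals_Archimedean2 by blast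
  obtain P where "P \<in> B" "real i < sup_norm (nbhd_seq i) (m i) P" using m(1) by blast
  then show False using R[of P "m i"] i by (simp add: km)
qed

text \<open>A bound common to all degrees on one neighbourhood becomes a geometrically decaying one
  on a smaller neighbourhood, where the sum of all components is therefore bounded. That smaller
  neighbourhood is the \<open>U\<close> on which continuity of the seminorm is used.\<close>

lemma tube_bounded_if:
  assumes R: "\<And>P n. P \<in> B \<Longrightarrow> sup_norm (nbhd_seq i) n P \<le> R"
  shows "tube_bounded N B"
  unfolding tube_bounded_def bounded_germs_def
proof (intro allI impI)
  fix q assume q: "continuous_seminorm_on_germs tube q"
  define \<epsilon> where "\<epsilon> = 1 / real (Suc (Suc i))"
  have \<epsilon>: "0 < \<epsilon>" by (simp add: \<epsilon>_def)
  define V where "V = {v. infdist v K < \<epsilon>}"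
  define U where "U = {p \<in> topspace taut_space. snd p \<in> V}"
  have "open V" unfolding V_def by (intro open_Collect_less continuous_intros)
  then have "open (((- {0}) \<times> UNIV) \<inter> (\<lambda>(z, t). t *s z) -` V)"
    by (intro open_Int open_Times open_vimage continuous_vscale) auto
  moreover have "{(z, t). z \<noteq> 0 \<and> taut_map (z, t) \<in> U} = ((- {0}) \<times> UNIV) \<inter> (\<lambda>(z, t). t *s z) -` V"
    by (auto simp: U_def taut_map_in_space)
  ultimately have "openin taut_space U" by (intro openin_taut_spaceI) (auto simp: U_def)
  moreover have "tube \<subseteq> U"
    using \<epsilon> by (auto simp: U_def V_def analytic_tube_eq)
  ultimately have "open_nbhd tube U" by (simp add: open_nbhd_def)
  then obtain K' C where K': "K' \<noteq> {}" "K' \<subseteq> U" and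
    C: "\<And>f. analytic_function U f \<Longrightarrow> q f \<le> C * (SUP p\<in>K'. cmod (f p))"
    using q unfolding continuous_seminorm_on_germs_def by metis
  obtain x where x: "1 < x" "\<And>n P. x ^ n * sup_norm (closed_nbhd \<epsilon>) n P \<le> sup_norm (nbhd_seq i) n P"
    using sup_norm_gain[of \<epsilon> "1 / real (Suc i)"] by (auto simp: \<epsilon>_def nbhd_seq_def frac_less2)
  define D where "D = \<bar>R\<bar> * (1 / (1 - 1 / x))"
  have "q (tube_fun P) \<le> \<bar>C\<bar> * D" if P: "P \<in> B" for P
  proof -
    have b: "cmod (tube_fun P p) \<le> D" if "p \<in> K'" for p
    proof -
      let ?v = "snd p"
      have v: "?v \<in> closed_nbhd \<epsilon>" using that K'(2) by (auto simp: U_def V_def closed_nbhd_def)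
      have "norm (comp_val n P ?v) \<le> \<bar>R\<bar> * (1 / x) ^ n" for n
      proof -
        have "x ^ n * sup_norm (closed_nbhd \<epsilon>) n P \<le> \<bar>R\<bar>" using x(2)[of n P] R[OF P, of n] by linarith
        then have "sup_norm (closed_nbhd \<epsilon>) n P \<le> \<bar>R\<bar> * (1 / x) ^ n" using x(1) by (simp add: power_divide field_simps)
        then show ?thesis using sup_norm_upper[OF compact_closed_nbhd v, of n P] by linarith
      qed
      then have "(\<Sum>n\<in>degree_set P. norm (comp_val n P ?v)) \<le> (\<Sum>n\<in>degree_set P. \<bar>R\<bar> * (1 / x) ^ n)" by (intro sum_mono)
      also have "\<dots> = \<bar>R\<bar> * (\<Sum>n\<in>degree_set P. (1 / x) ^ n)" by (simp add: sum_distrib_left)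
      also have "\<dots> \<le> \<bar>R\<bar> * suminf (\<lambda>n. (1 / x) ^ n)"
        using x(1) by (intro mult_left_mono sum_le_suminf summable_geometric) auto
      also have "suminf (\<lambda>n. (1 / x) ^ n) = 1 / (1 - 1 / x)"
        using x(1) by (intro suminf_geometric) auto
      finally have "(\<Sum>n\<in>degree_set P. norm (comp_val n P ?v)) \<le> D" by (simp only: D_def)
      moreover have "tube_fun P p = (\<Sum>n\<in>degree_set P. comp_val n P ?v)"
        unfolding case_prod_unfold by (rule poly_eval_eq_sum_comp_val) auto
      ultimately show ?thesis using norm_sum[of "\<lambda>n. comp_val n P ?v" "degree_set P"] by simp
    qed
    then have le: "(SUP p\<in>K'. cmod (tube_fun P p)) \<le> D" by (intro cSUP_least K')
    \<comment> \<open>The constant \<open>C\<close> carries no sign condition; replacing it by its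
      absolute value requires the supremum to be nonnegative.\<close>
    obtain p where p: "p \<in> K'" using K'(1) by blast
    have "bdd_above ((\<lambda>p. cmod (tube_fun P p)) ` K')" by (rule bdd_aboveI[of _ D]) (use b in blast)
    from cSUP_upper[OF p this] have "0 \<le> (SUP p\<in>K'. cmod (tube_fun P p))"
      by (rule order_trans[OF norm_ge_zero])
    then have "C * (SUP p\<in>K'. cmod (tube_fun P p)) \<le> \<bar>C\<bar> * D"
      using le by (intro mult_mono) auto
    then show ?thesis using C[OF analytic_tube_fun[of U P]] by linarith
  qed
  then show "\<exists>R. \<forall>f\<in>tube_fun ` B. q f \<le> R" by blast
qed

lemma tube_bounded_iff: "tube_bounded N B \<longleftrightarrow> (\<exists>i. \<exists>R>0. \<forall>P\<in>B. std_norm i P \<le> R)"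
  unfolding std_norm_bounded_iff using tube_bounded_imp tube_bounded_if by blast

text \<open>Without a sequence of this kind the definite descriptions of the invariants would hold
  of every value; evaluating them at \<open>std_norm\<close> gives uniqueness.\<close>

lemma defines_bornology_std_norm: "defines_bornology N std_norm"
  unfolding defines_bornology_def using hilbertian_std_norm std_norm_cnj std_norm_Suc_le tube_bounded_iff by blast

end

theorem theorem1p4:
  fixes l :: nat and N :: "'n::finite O1_seminorm"
  assumes "CARD('n) = l + 1"
    and "seminormed_O1 N"
  shows "lower_hilbert_invariant (l + 1) N = upper_hilbert_invariant (l + 1) N \<and>
    upper_hilbert_invariant (l + 1) N \<in> range ereal \<union> {\<infinity>}"
proof -
  interpret seminormed N by standard (rule assms)
  obtain c where c: "c \<noteq> -\<infinity> \<and> (\<forall>h.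
    (\<forall>i. hilbertian_seminorm (h i)) \<longrightarrow> (\<forall>i P. h (Suc i) P \<le> h i P) \<longrightarrow>
    (\<forall>B. (\<exists>i. \<exists>R>0. \<forall>P\<in>B. h i P \<le> R) \<longleftrightarrow> (\<exists>i. \<exists>R>0. \<forall>P\<in>B. std_norm i P \<le> R)) \<longrightarrow>
    lim (\<lambda>i. limsup (scaled_degree (l + 1) (h i))) = c \<and> lim (\<lambda>i. liminf (scaled_degree (l + 1) (h i))) = c)"
    using hilbert_limits[OF assms(1)] by (rule exE)
  have lims: "lim (\<lambda>i. limsup (scaled_degree (l + 1) (h i))) = c \<and> lim (\<lambda>i. liminf (scaled_degree (l + 1) (h i))) = c"
    if h: "defines_bornology N h" for h
  proof (rule conjunct2[OF c, rule_format])
    show "hilbertian_seminorm (h i)" "h (Suc i) P \<le> h i P" for i P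
      using h by (auto simp: defines_bornology_def)
    show "(\<exists>i. \<exists>R>0. \<forall>P\<in>B. h i P \<le> R) \<longleftrightarrow> (\<exists>i. \<exists>R>0. \<forall>P\<in>B. std_norm i P \<le> R)" for B
      unfolding tube_bounded_iff[symmetric] using h by (simp add: defines_bornology_def)
  qed
  note * = lims[unfolded scaled_degree_def[abs_def], THEN conjunct1] lims[unfolded scaled_degree_def[abs_def], THEN conjunct2]
  have "upper_hilbert_invariant (l + 1) N = c"
    unfolding upper_hilbert_invariant_def
    by (rule the_equality) (use * defines_bornology_std_norm in auto)
  moreover have "lower_hilbert_invariant (l + 1) N = c"
    unfolding lower_hilbert_invariant_def
    by (rule the_equality) (use * defines_bornology_std_norm in auto)
  ultimately show ?thesis using c by (cases c) auto
qed

end
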